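(* For every integer $n\ge 1$ there exists a Hodge metric on the $n$-th Hirzebruch surface $\mathbb{F}_n=\mathbb{P}(\mathcal{O}_{\mathbb{P}^1}(n)\oplus\mathcal{O}_{\mathbb{P}^1})$ whose holomorphic sectional curvature is positive and $\frac{1}{(1+2n)^2}$-pinched.
   Context: Here $\mathbb{P}^1$ is the complex projective line, $\mathcal{O}_{\mathbb{P}^1}(n)$ is the holomorphic line bundle of degree $n$ on it, and $\mathbb{P}(\cdot)$ denotes projectivization of a vector bundle. Let $M$ be an $m$-dimensional complex manifold with local holomorphic coordinates $z_1,\dots,z_m$. A Hermitian metric $g=\sum_{i,j=1}^m g_{i\bar j}\,dz_i\otimes d\bar z_j$ has associated $(1,1)$-form $\omega=\frac{\sqrt{-1}}{2}\sum_{i,j=1}^m g_{i\bar j}\,dz_i\wedge d\bar z_j$ (also referred to as the metric). The metric is Kähler if $d\omega=0$, and Hodge if it is Kähler and the cohomology class of $\omega$ is rational. The curvature components (of the metric, i.e. Chern, connection) are $$R_{i\bar jk\bar l}=-\frac{\partial^2 g_{i\bar j}}{\partial z_k\partial\bar z_l}+\sum_{p,q=1}^m g^{p\bar q}\frac{\partial g_{i\bar p}}{\partial z_k}\frac{\partial g_{q\bar j}}{\partial\bar z_l},$$ where $(g^{p\bar q})$ is the inverse matrix of $(g_{i\bar j})$. For a non-zero tangent vector $\xi=\sum_i\xi_i\frac{\partial}{\partial z_i}$ at a point $p\in M$, the holomorphic sectional curvature is $$K(\xi)=\Big(2\sum_{i,j,k,l=1}^m R_{i\bar jk\bar l}(p)\,\xi_i\bar\xi_j\xi_k\bar\xi_l\Big)\Big/\Big(\sum_{i,j,k,l=1}^m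 g_{i\bar j}(p)g_{k\bar l}(p)\,\xi_i\bar\xi_j\xi_k\bar\xi_l\Big).$$ For a constant $c\in(0,1]$, positive holomorphic sectional curvature is called $c$-pinched if $\frac{\inf_\xi K(\xi)}{\sup_\xi K(\xi)}=c$ (equality), where the infimum and supremum are over all non-zero tangent vectors at all points of the manifold. *)

theory Defs
  imports "HOL-Analysis.Analysis"
begin

section \<open>Complex manifolds\<close>

text \<open>
  A local holomorphic coordinate system on a set of points is given by the inverse of a chart:
  a pair \<open>(D, \<psi>)\<close> of an open set \<open>D\<close> of coordinate vectors and an injective parametrization
  \<open>\<psi>\<close> of a set of points by \<open>D\<close>.  The values of \<open>\<psi>\<close> outside \<open>D\<close> are irrelevant.
  An atlas is an indexed family of these, and geometric objects are families of local
  expressions over the same index type.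
\<close>

type_synonym ('a, 'm) param = "(complex ^ 'm) set \<times> (complex ^ 'm \<Rightarrow> 'a)"

definition coords_in :: "('i \<Rightarrow> ('a, 'm) param) \<Rightarrow> 'i \<Rightarrow> 'a set \<Rightarrow> (complex ^ 'm) set" where
  "coords_in A i V = {z \<in> fst (A i). snd (A i) z \<in> V}"

definition patch :: "('i \<Rightarrow> ('a, 'm) param) \<Rightarrow> 'i \<Rightarrow> 'a set" where
  "patch A i = snd (A i) ` fst (A i)"

text \<open>Coordinate change from the \<open>i\<close>-th to the \<open>j\<close>-th coordinates; meaningful on
  \<open>coords_in A i (patch A j)\<close>.\<close>

definition coord_change ::
    "('i \<Rightarrow> ('a, 'm) param) \<Rightarrow> 'i \<Rightarrow> 'i \<Rightarrow> complex ^ 'm \<Rightarrow> complex ^ 'm" where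
  "coord_change A i j = inv_into (fst (A j)) (snd (A j)) \<circ> snd (A i)"

abbreviation deriv_at ::
    "('x::real_normed_vector \<Rightarrow> 'y::real_normed_vector) \<Rightarrow> 'x \<Rightarrow> 'x \<Rightarrow> 'y" where
  "deriv_at f z \<equiv> frechet_derivative f (at z)"

definition holomorphic_map_on ::
    "(complex ^ 'm::finite) set \<Rightarrow> (complex ^ 'm \<Rightarrow> complex ^ 'k::finite) \<Rightarrow> bool" where
  "holomorphic_map_on S f \<longleftrightarrow>
     (\<forall>z\<in>S. \<exists>T. (f has_derivative T) (at z) \<and> (\<forall>c u. T (c *s u) = c *s T u))"

definition manifold_open :: "'a set \<Rightarrow> ('i \<Rightarrow> ('a, 'm::finite) param) \<Rightarrow> 'a set \<Rightarrow> bool" where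
  "manifold_open M A V \<longleftrightarrow> V \<subseteq> M \<and> (\<forall>i. open (coords_in A i V))"

definition manifold_topology :: "'a set \<Rightarrow> ('i \<Rightarrow> ('a, 'm::finite) param) \<Rightarrow> 'a topology" where
  "manifold_topology M A = topology (manifold_open M A)"

definition complex_manifold :: "'a set \<Rightarrow> ('i \<Rightarrow> ('a, 'm::finite) param) \<Rightarrow> bool" where
  "complex_manifold M A \<longleftrightarrow>
     (\<forall>i. open (fst (A i)) \<and> inj_on (snd (A i)) (fst (A i))) \<and>
     (\<Union>i. patch A i) = M \<and>
     (\<forall>i j. open (coords_in A i (patch A j)) \<and>
            holomorphic_map_on (coords_in A i (patch A j)) (coord_change A i j)) \<and>
     Hausdorff_space (manifold_topology M A) \<and>
     second_countable (manifold_topology M A)"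


section \<open>Smooth functions and differential forms\<close>

primrec Ck_on ::
    "nat \<Rightarrow> 'x::real_normed_vector set \<Rightarrow> ('x \<Rightarrow> 'y::real_normed_vector) \<Rightarrow> bool" where
  "Ck_on 0 S f \<longleftrightarrow> continuous_on S f"
| "Ck_on (Suc k) S f \<longleftrightarrow>
     (\<forall>x\<in>S. f differentiable (at x)) \<and> (\<forall>v. Ck_on k S (\<lambda>x. deriv_at f x v))"

text \<open>Smoothness in the real sense, to be used on open sets of finite-dimensional spaces.\<close>

definition smooth_on ::
    "'x::real_normed_vector set \<Rightarrow> ('x \<Rightarrow> 'y::real_normed_vector) \<Rightarrow> bool" where
  "smooth_on S f \<longleftrightarrow> (\<forall>k. Ck_on k S f)"

definition smooth_function_on ::
    "('i \<Rightarrow> ('a, 'm::finite) param) \<Rightarrow> 'a set \<Rightarrow> ('a \<Rightarrow> real) \<Rightarrow> bool" where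
  "smooth_function_on A V f \<longleftrightarrow> (\<forall>i. smooth_on (coords_in A i V) (f \<circ> snd (A i)))"

text \<open>
  A real differential form is a family of local expressions: \<open>\<theta> i z u\<close> is the value of a 1-form
  on the tangent vector \<open>u\<close> (in real directions of \<open>complex ^ 'm\<close>) at the point with \<open>i\<close>-th
  coordinates \<open>z\<close>; similarly \<open>\<omega> i z u v\<close> for a 2-form.
\<close>

definition one_form_on ::
    "('i \<Rightarrow> ('a, 'm::finite) param) \<Rightarrow> 'a set
       \<Rightarrow> ('i \<Rightarrow> complex ^ 'm \<Rightarrow> complex ^ 'm \<Rightarrow> real) \<Rightarrow> bool" where
  "one_form_on A V \<theta> \<longleftrightarrow>
     (\<forall>i. \<forall>z \<in> coords_in A i V. linear (\<theta> i z)) \<and>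
     (\<forall>i u. smooth_on (coords_in A i V) (\<lambda>z. \<theta> i z u)) \<and>
     (\<forall>i j. \<forall>z \<in> coords_in A i (V \<inter> patch A j). \<forall>u.
        \<theta> i z u = \<theta> j (coord_change A i j z) (deriv_at (coord_change A i j) z u))"

text \<open>Exterior derivatives, evaluated on constant vector fields.\<close>

definition ext_deriv1 ::
    "('x::real_normed_vector \<Rightarrow> 'x \<Rightarrow> real) \<Rightarrow> 'x \<Rightarrow> 'x \<Rightarrow> 'x \<Rightarrow> real" where
  "ext_deriv1 \<theta> z u v = deriv_at (\<lambda>w. \<theta> w v) z u - deriv_at (\<lambda>w. \<theta> w u) z v"

definition ext_deriv2 ::
    "('x::real_normed_vector \<Rightarrow> 'x \<Rightarrow> 'x \<Rightarrow> real) \<Rightarrow> 'x \<Rightarrow> 'x \<Rightarrow> 'x \<Rightarrow> 'x \<Rightarrow> real" where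
  "ext_deriv2 \<omega> z u v w =
     deriv_at (\<lambda>x. \<omega> x v w) z u - deriv_at (\<lambda>x. \<omega> x u w) z v + deriv_at (\<lambda>x. \<omega> x u v) z w"

text \<open>
  The isomorphism of de Rham cohomology with the Cech cohomology of the constant sheaf \<open>\<real>\<close>, in
  degree 2: if the closed 2-form \<open>\<omega>\<close> equals \<open>d\<theta>\<^sub>V\<close> on each \<open>V\<close> of an open cover, and
  \<open>\<theta>\<^sub>W - \<theta>\<^sub>V = d f\<^sub>V\<^sub>W\<close> on \<open>V \<inter> W\<close>, then the class of \<open>\<omega>\<close> corresponds to that of the cocycle
  \<open>c\<^sub>V\<^sub>W\<^sub>X = f\<^sub>W\<^sub>X - f\<^sub>V\<^sub>X + f\<^sub>V\<^sub>W\<close> (which is automatically locally constant).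
\<close>

definition Cech_de_Rham ::
    "'a set \<Rightarrow> ('i \<Rightarrow> ('a, 'm::finite) param)
       \<Rightarrow> ('i \<Rightarrow> complex ^ 'm \<Rightarrow> complex ^ 'm \<Rightarrow> complex ^ 'm \<Rightarrow> real)
       \<Rightarrow> 'a set set \<Rightarrow> ('a set \<Rightarrow> 'a set \<Rightarrow> 'a set \<Rightarrow> 'a \<Rightarrow> real) \<Rightarrow> bool" where
  "Cech_de_Rham M A \<omega> \<U> c \<longleftrightarrow>
     (\<forall>V\<in>\<U>. manifold_open M A V) \<and> \<Union>\<U> = M \<and>
     (\<exists>\<theta> f.
        (\<forall>V\<in>\<U>. one_form_on A V (\<theta> V) \<and>
           (\<forall>i. \<forall>z \<in> coords_in A i V. \<forall>u v. \<omega> i z u v = ext_deriv1 (\<theta> V i) z u v)) \<and>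
        (\<forall>V\<in>\<U>. \<forall>W\<in>\<U>. smooth_function_on A (V \<inter> W) (f V W) \<and>
           (\<forall>i. \<forall>z \<in> coords_in A i (V \<inter> W). \<forall>u.
              \<theta> W i z u - \<theta> V i z u = deriv_at (f V W \<circ> snd (A i)) z u)) \<and>
        (\<forall>V\<in>\<U>. \<forall>W\<in>\<U>. \<forall>X\<in>\<U>. \<forall>p \<in> V \<inter> W \<inter> X.
           c V W X p = f W X p - f V X p + f V W p))"

text \<open>The class of \<open>\<omega>\<close> lies in the image of the cohomology with coefficients in \<open>\<rat>\<close>.\<close>

definition rational_class ::
    "'a set \<Rightarrow> ('i \<Rightarrow> ('a, 'm::finite) param)
       \<Rightarrow> ('i \<Rightarrow> complex ^ 'm \<Rightarrow> complex ^ 'm \<Rightarrow> complex ^ 'm \<Rightarrow> real) \<Rightarrow> bool" where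
  "rational_class M A \<omega> \<longleftrightarrow>
     (\<exists>\<U> c. Cech_de_Rham M A \<omega> \<U> c \<and>
        (\<forall>V\<in>\<U>. \<forall>W\<in>\<U>. \<forall>X\<in>\<U>. \<forall>p \<in> V \<inter> W \<inter> X. c V W X p \<in> \<rat>))"


section \<open>Hermitian, Kaehler and Hodge metrics\<close>

definition sesq :: "complex ^ 'm ^ 'm \<Rightarrow> complex ^ 'm \<Rightarrow> complex ^ 'm::finite \<Rightarrow> complex" where
  "sesq G u v = (\<Sum>a\<in>UNIV. \<Sum>b\<in>UNIV. G $ a $ b * u $ a * cnj (v $ b))"

text \<open>A metric is given by its components: \<open>g i z $ a $ b\<close> is \<open>g\<^bsub>a\<bar>b\<^esub>\<close> in the \<open>i\<close>-th coordinates.\<close>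

definition hermitian_metric ::
    "'a set \<Rightarrow> ('i \<Rightarrow> ('a, 'm::finite) param)
       \<Rightarrow> ('i \<Rightarrow> complex ^ 'm \<Rightarrow> complex ^ 'm ^ 'm) \<Rightarrow> bool" where
  "hermitian_metric M A g \<longleftrightarrow>
     complex_manifold M A \<and>
     (\<forall>i. \<forall>z \<in> fst (A i).
        (\<forall>a b. g i z $ b $ a = cnj (g i z $ a $ b)) \<and>
        (\<forall>\<xi>. \<xi> \<noteq> 0 \<longrightarrow> 0 < Re (sesq (g i z) \<xi> \<xi>))) \<and>
     (\<forall>i a b. smooth_on (fst (A i)) (\<lambda>z. g i z $ a $ b)) \<and>
     (\<forall>i j. \<forall>z \<in> coords_in A i (patch A j). \<forall>u v.
        sesq (g i z) u v =
        sesq (g j (coord_change A i j z))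
          (deriv_at (coord_change A i j) z u) (deriv_at (coord_change A i j) z v))"

text \<open>The form \<open>\<i>/2 \<Sum> g\<^bsub>a\<bar>b\<^esub> dz\<^sub>a \<and> d\<bar>z\<^sub>b\<close>; its values are real because \<open>g\<close> is Hermitian, so
  \<^const>\<open>Re\<close> only changes the type.\<close>

definition assoc_form ::
    "(complex ^ 'm \<Rightarrow> complex ^ 'm ^ 'm) \<Rightarrow> complex ^ 'm \<Rightarrow> complex ^ 'm \<Rightarrow> complex ^ 'm::finite
       \<Rightarrow> real" where
  "assoc_form G z u v =
     Re (\<i> / 2 * (\<Sum>a\<in>UNIV. \<Sum>b\<in>UNIV.
        G z $ a $ b * (u $ a * cnj (v $ b) - v $ a * cnj (u $ b))))"

definition kaehler_metric ::
    "'a set \<Rightarrow> ('i \<Rightarrow> ('a, 'm::finite) param)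
       \<Rightarrow> ('i \<Rightarrow> complex ^ 'm \<Rightarrow> complex ^ 'm ^ 'm) \<Rightarrow> bool" where
  "kaehler_metric M A g \<longleftrightarrow>
     hermitian_metric M A g \<and>
     (\<forall>i. \<forall>z \<in> fst (A i). \<forall>u v w. ext_deriv2 (assoc_form (g i)) z u v w = 0)"

definition hodge_metric ::
    "'a set \<Rightarrow> ('i \<Rightarrow> ('a, 'm::finite) param)
       \<Rightarrow> ('i \<Rightarrow> complex ^ 'm \<Rightarrow> complex ^ 'm ^ 'm) \<Rightarrow> bool" where
  "hodge_metric M A g \<longleftrightarrow>
     kaehler_metric M A g \<and> rational_class M A (\<lambda>i. assoc_form (g i))"


section \<open>Holomorphic sectional curvature\<close>

text \<open>The Wirtinger derivatives \<open>\<partial>/\<partial>z\<^sub>k\<close> and \<open>\<partial>/\<partial>\<bar>z\<^sub>k\<close>.\<close>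

definition dz :: "'m::finite \<Rightarrow> (complex ^ 'm \<Rightarrow> complex) \<Rightarrow> complex ^ 'm \<Rightarrow> complex" where
  "dz k f z = (deriv_at f z (axis k 1) - \<i> * deriv_at f z (axis k \<i>)) / 2"

definition dzbar :: "'m::finite \<Rightarrow> (complex ^ 'm \<Rightarrow> complex) \<Rightarrow> complex ^ 'm \<Rightarrow> complex" where
  "dzbar k f z = (deriv_at f z (axis k 1) + \<i> * deriv_at f z (axis k \<i>)) / 2"

definition curv ::
    "(complex ^ 'm \<Rightarrow> complex ^ 'm ^ 'm) \<Rightarrow> 'm \<Rightarrow> 'm \<Rightarrow> 'm \<Rightarrow> 'm::finite
       \<Rightarrow> complex ^ 'm \<Rightarrow> complex" where
  "curv G i j k l z =
     - dz k (dzbar l (\<lambda>w. G w $ i $ j)) z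
     + (\<Sum>p\<in>UNIV. \<Sum>q\<in>UNIV.
          matrix_inv (G z) $ p $ q * dz k (\<lambda>w. G w $ i $ p) z * dzbar l (\<lambda>w. G w $ q $ j) z)"

text \<open>The quotient is a real number for Hermitian \<open>G\<close>, so \<^const>\<open>Re\<close> only changes the type.\<close>

definition hol_sec_curv ::
    "(complex ^ 'm \<Rightarrow> complex ^ 'm ^ 'm) \<Rightarrow> complex ^ 'm \<Rightarrow> complex ^ 'm::finite \<Rightarrow> real" where
  "hol_sec_curv G z \<xi> =
     Re ((2 * (\<Sum>i\<in>UNIV. \<Sum>j\<in>UNIV. \<Sum>k\<in>UNIV. \<Sum>l\<in>UNIV.
               curv G i j k l z * \<xi> $ i * cnj (\<xi> $ j) * \<xi> $ k * cnj (\<xi> $ l))) /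
         (\<Sum>i\<in>UNIV. \<Sum>j\<in>UNIV. \<Sum>k\<in>UNIV. \<Sum>l\<in>UNIV.
               G z $ i $ j * G z $ k $ l * \<xi> $ i * cnj (\<xi> $ j) * \<xi> $ k * cnj (\<xi> $ l)))"

definition hol_sec_curv_values ::
    "('i \<Rightarrow> ('a, 'm::finite) param) \<Rightarrow> ('i \<Rightarrow> complex ^ 'm \<Rightarrow> complex ^ 'm ^ 'm) \<Rightarrow> real set" where
  "hol_sec_curv_values A g = {hol_sec_curv (g i) z \<xi> | i z \<xi>. z \<in> fst (A i) \<and> \<xi> \<noteq> 0}"

definition positive_hol_sec_curv ::
    "('i \<Rightarrow> ('a, 'm::finite) param) \<Rightarrow> ('i \<Rightarrow> complex ^ 'm \<Rightarrow> complex ^ 'm ^ 'm) \<Rightarrow> bool" where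
  "positive_hol_sec_curv A g \<longleftrightarrow> (\<forall>K \<in> hol_sec_curv_values A g. 0 < K)"

text \<open>The real supremum is meaningful only for sets bounded above; if the curvature is unbounded,
  the ratio of infimum to supremum is not a positive number.\<close>

definition pinched ::
    "('i \<Rightarrow> ('a, 'm::finite) param) \<Rightarrow> ('i \<Rightarrow> complex ^ 'm \<Rightarrow> complex ^ 'm ^ 'm) \<Rightarrow> real \<Rightarrow> bool" where
  "pinched A g c \<longleftrightarrow>
     0 < c \<and> c \<le> 1 \<and> positive_hol_sec_curv A g \<and>
     bdd_above (hol_sec_curv_values A g) \<and>
     Inf (hol_sec_curv_values A g) / Sup (hol_sec_curv_values A g) = c"


section \<open>Hirzebruch surfaces\<close>

text \<open>
  The total space of \<open>\<O>(a) \<oplus> \<O>(b)\<close> over the projective line is the quotient of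
  \<open>(\<complex>\<^sup>2 \<setminus> 0) \<times> \<complex>\<^sup>2\<close> by the action \<open>s \<cdot> (x, v, w) = (s x, s\<^sup>a v, s\<^sup>b w)\<close> of the non-zero
  complex numbers: homogeneous polynomials of degree \<open>d\<close> in \<open>x\<close> are the sections of \<open>\<O>(d)\<close>.
\<close>

definition bundle_vec ::
    "nat \<Rightarrow> nat \<Rightarrow> complex \<times> complex \<Rightarrow> complex \<times> complex
       \<Rightarrow> ((complex \<times> complex) \<times> (complex \<times> complex)) set" where
  "bundle_vec a b x v =
     {((s * fst x, s * snd x), (s ^ a * fst v, s ^ b * snd v)) | s. s \<noteq> 0}"

text \<open>The line spanned by a non-zero vector in a fibre, without its zero vector.\<close>

definition bundle_line ::
    "nat \<Rightarrow> nat \<Rightarrow> complex \<times> complex \<Rightarrow> complex \<times> complex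
       \<Rightarrow> ((complex \<times> complex) \<times> (complex \<times> complex)) set set" where
  "bundle_line a b x v = {bundle_vec a b x (r * fst v, r * snd v) | r. r \<noteq> 0}"

definition projectivized_sum ::
    "nat \<Rightarrow> nat \<Rightarrow> ((complex \<times> complex) \<times> (complex \<times> complex)) set set set" where
  "projectivized_sum a b = {bundle_line a b x v | x v. x \<noteq> 0 \<and> v \<noteq> 0}"

definition hirzebruch ::
    "nat \<Rightarrow> ((complex \<times> complex) \<times> (complex \<times> complex)) set set set" where
  "hirzebruch n = projectivized_sum n 0"

text \<open>
  The standard coordinates: on each of the two affine charts of the base (where one homogeneous
  coordinate is normalized to 1) the bundle is trivialized, and the fibre, a projective line, is
  covered by its two affine charts.
\<close>

definition affine_pt :: "bool \<Rightarrow> complex \<Rightarrow> complex \<times> complex" where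
  "affine_pt s t = (if s then (1, t) else (t, 1))"

definition hirzebruch_atlas ::
    "nat \<Rightarrow> bool \<times> bool \<Rightarrow> (((complex \<times> complex) \<times> (complex \<times> complex)) set set, 2) param" where
  "hirzebruch_atlas n i =
     (UNIV, \<lambda>z. bundle_line n 0 (affine_pt (fst i) (z $ 1)) (affine_pt (snd i) (z $ 2)))"


section \<open>The Hirzebruch surfaces are complex manifolds\<close>

lemma mem_bundle_vec: "(x, v) \<in> bundle_vec a b x v"
  unfolding bundle_vec_def by (cases x; cases v) (auto intro!: exI[of _ 1])

lemma bundle_vec_scale:
  assumes "s \<noteq> 0"
  shows "bundle_vec a b (s * fst x, s * snd x) (s ^ a * fst v, s ^ b * snd v) = bundle_vec a b x v"
proof (intro equalityI subsetI)
  fix p assume "p \<in> bundle_vec a b (s * fst x, s * snd x) (s ^ a * fst v, s ^ b * snd v)"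
  then obtain r where "r \<noteq> 0" "p = ((r * (s * fst x), r * (s * snd x)),
      (r ^ a * (s ^ a * fst v), r ^ b * (s ^ b * snd v)))"
    unfolding bundle_vec_def by auto
  with assms show "p \<in> bundle_vec a b x v"
    unfolding bundle_vec_def by (auto intro!: exI[of _ "r * s"] simp: power_mult_distrib)
next
  fix p assume "p \<in> bundle_vec a b x v"
  then obtain r where "r \<noteq> 0" "p = ((r * fst x, r * snd x), (r ^ a * fst v, r ^ b * snd v))"
    unfolding bundle_vec_def by auto
  with assms show "p \<in> bundle_vec a b (s * fst x, s * snd x) (s ^ a * fst v, s ^ b * snd v)"
    unfolding bundle_vec_def by (auto intro!: exI[of _ "r / s"] simp: power_divide)
qed

lemma bundle_line_eq_iff:
  "bundle_line a b x v = bundle_line a b x' v' \<longleftrightarrow>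
   (\<exists>s r. s \<noteq> 0 \<and> r \<noteq> 0 \<and> x' = (s * fst x, s * snd x) \<and>
          v' = (r * s ^ a * fst v, r * s ^ b * snd v))"
proof
  assume eq: "bundle_line a b x v = bundle_line a b x' v'"
  have "bundle_vec a b x' v' \<in> bundle_line a b x' v'"
    unfolding bundle_line_def by (auto intro!: exI[of _ 1])
  then obtain r where r: "r \<noteq> 0"
      and e: "bundle_vec a b x' v' = bundle_vec a b x (r * fst v, r * snd v)"
    unfolding eq[symmetric] unfolding bundle_line_def by blast
  have "(x', v') \<in> bundle_vec a b x (r * fst v, r * snd v)"
    using mem_bundle_vec[of x' v' a b] e by simp
  with r show "\<exists>s r. s \<noteq> 0 \<and> r \<noteq> 0 \<and> x' = (s * fst x, s * snd x) \<and>
          v' = (r * s ^ a * fst v, r * s ^ b * snd v)"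
    unfolding bundle_vec_def by (auto simp: mult_ac)
next
  assume "\<exists>s r. s \<noteq> 0 \<and> r \<noteq> 0 \<and> x' = (s * fst x, s * snd x) \<and>
          v' = (r * s ^ a * fst v, r * s ^ b * snd v)"
  then obtain s r where s: "s \<noteq> 0" and r: "r \<noteq> 0" and x': "x' = (s * fst x, s * snd x)"
    and v': "v' = (r * s ^ a * fst v, r * s ^ b * snd v)" by blast
  have *: "bundle_vec a b x' (t * fst v', t * snd v') =
        bundle_vec a b x ((t * r) * fst v, (t * r) * snd v)" for t
    using bundle_vec_scale[OF s, of a b x "((t * r) * fst v, (t * r) * snd v)"]
    by (simp add: x' v' mult_ac)
  show "bundle_line a b x v = bundle_line a b x' v'"
    unfolding bundle_line_def *
  proof (intro equalityI subsetI; clarify)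
    fix t :: complex assume "t \<noteq> 0"
    with r show "\<exists>q. bundle_vec a b x (t * fst v, t * snd v) =
        bundle_vec a b x (q * r * fst v, q * r * snd v) \<and> q \<noteq> 0"
      by (intro exI[of _ "t / r"]) auto
  next
    fix t :: complex assume "t \<noteq> 0"
    with r show "\<exists>q. bundle_vec a b x (t * r * fst v, t * r * snd v) =
        bundle_vec a b x (q * fst v, q * snd v) \<and> q \<noteq> 0"
      by (intro exI[of _ "t * r"]) auto
  qed
qed

text \<open>The point with \<open>i\<close>-th coordinates \<open>z\<close>, and the coordinates of a point given by homogeneous coordinates (with \<open>sel (fst i) x\<close> and \<open>sel (snd i) v\<close> non-zero).\<close>

definition hpt :: "nat \<Rightarrow> bool \<times> bool \<Rightarrow> complex ^ 2
    \<Rightarrow> ((complex \<times> complex) \<times> (complex \<times> complex)) set set" where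
  "hpt n i z = bundle_line n 0 (affine_pt (fst i) (z $ 1)) (affine_pt (snd i) (z $ 2))"

definition sel :: "bool \<Rightarrow> complex \<times> complex \<Rightarrow> complex" where
  "sel s x = (if s then fst x else snd x)"

definition hco :: "nat \<Rightarrow> bool \<times> bool \<Rightarrow> complex \<times> complex \<Rightarrow> complex \<times> complex \<Rightarrow> complex ^ 2" where
  "hco n i x v = vector [sel (\<not> fst i) x / sel (fst i) x,
     if snd i then snd v * sel (fst i) x ^ n / fst v else fst v / (sel (fst i) x ^ n * snd v)]"

lemma sel_simps [simp]: "sel s (affine_pt s t) = 1" "sel (\<not> s) (affine_pt s t) = t"
  by (auto simp: sel_def affine_pt_def)

lemma atlas_simps [simp]: "fst (hirzebruch_atlas n i) = UNIV" "snd (hirzebruch_atlas n i) = hpt n i"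
  by (auto simp: hirzebruch_atlas_def hpt_def fun_eq_iff)

lemma hpt_hco:
  assumes "sel (fst i) x \<noteq> 0" "sel (snd i) v \<noteq> 0"
  shows "hpt n i (hco n i x v) = bundle_line n 0 x v"
proof -
  obtain a b where i: "i = (a, b)" by (cases i)
  obtain x0 x1 v0 v1 where xv: "x = (x0, x1)" "v = (v0, v1)" by (cases x; cases v)
  let ?s = "sel a x" and ?r = "if b then fst v / sel a x ^ n else snd v"
  show ?thesis
    unfolding hpt_def bundle_line_eq_iff
    apply (rule exI[of _ ?s], rule exI[of _ ?r])
    using assms by (cases a; cases b; simp add: i xv hco_def affine_pt_def sel_def)
qed

lemma hco_scale:
  assumes "s \<noteq> 0" "r \<noteq> 0"
  shows "hco n i (s * fst x, s * snd x) (r * s ^ n * fst v, r * s ^ 0 * snd v) = hco n i x v"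
  using assms by (cases "fst i"; cases "snd i")
    (simp_all add: hco_def sel_def power_mult_distrib)

lemma hco_affine_pt:
  "hco n i (affine_pt (fst i) (z $ 1)) (affine_pt (snd i) (z $ 2)) = z"
  by (cases "fst i"; cases "snd i")
     (simp_all add: hco_def sel_def affine_pt_def vec_eq_iff forall_2)

lemma hpt_in_iff:
  "bundle_line n 0 x v = hpt n i z \<longleftrightarrow>
     sel (fst i) x \<noteq> 0 \<and> sel (snd i) v \<noteq> 0 \<and> z = hco n i x v"
proof
  assume "bundle_line n 0 x v = hpt n i z"
  then obtain s r where sr: "s \<noteq> 0" "r \<noteq> 0"
    "affine_pt (fst i) (z $ 1) = (s * fst x, s * snd x)"
    "affine_pt (snd i) (z $ 2) = (r * s ^ n * fst v, r * s ^ 0 * snd v)"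
    unfolding hpt_def bundle_line_eq_iff by blast
  have 1: "s * sel (fst i) x = 1"
    using arg_cong[OF sr(3), of "sel (fst i)"] by (cases "fst i") (simp_all add: sel_def affine_pt_def)
  have "(if snd i then r * s ^ n else r) * sel (snd i) v = 1"
    using arg_cong[OF sr(4), of "sel (snd i)"] by (cases "snd i") (simp_all add: sel_def affine_pt_def)
  then have "sel (snd i) v \<noteq> 0" by (metis mult_zero_right zero_neq_one)
  moreover have "sel (fst i) x \<noteq> 0" using 1 by (metis mult_zero_right zero_neq_one)
  moreover have "z = hco n i x v"
    using hco_scale[OF sr(1,2), of n i x v] hco_affine_pt[of n i z] sr(3,4) by simp
  ultimately show "sel (fst i) x \<noteq> 0 \<and> sel (snd i) v \<noteq> 0 \<and> z = hco n i x v" by simp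
next
  assume "sel (fst i) x \<noteq> 0 \<and> sel (snd i) v \<noteq> 0 \<and> z = hco n i x v"
  then show "bundle_line n 0 x v = hpt n i z" using hpt_hco[of i x v n] by auto
qed


subsection \<open>Holomorphic coordinate changes\<close>

definition hol_at :: "(complex ^ 2 \<Rightarrow> complex) \<Rightarrow> complex ^ 2 \<Rightarrow> bool" where
  "hol_at f z \<longleftrightarrow> (\<exists>T. (f has_derivative T) (at z) \<and> (\<forall>c u. T (c *s u) = c * T u))"

lemma hol_at_const: "hol_at (\<lambda>_. c) z"
  unfolding hol_at_def by (intro exI[of _ "\<lambda>_. 0"]) auto

lemma hol_at_nth: "hol_at (\<lambda>w. w $ k) z"
  unfolding hol_at_def
  by (intro exI[of _ "\<lambda>w. w $ k"]) (auto intro: bounded_linear.has_derivative[OF bounded_linear_vec_nth])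

lemma hol_at_mult:
  assumes "hol_at f z" "hol_at g z"
  shows "hol_at (\<lambda>w. f w * g w) z"
proof -
  obtain S T where "(f has_derivative S) (at z)" "\<forall>c u. S (c *s u) = c * S u"
    "(g has_derivative T) (at z)" "\<forall>c u. T (c *s u) = c * T u"
    using assms unfolding hol_at_def by blast
  then show ?thesis unfolding hol_at_def
    by (intro exI[of _ "\<lambda>u. f z * T u + S u * g z"] conjI)
       (rule has_derivative_mult, assumption+, simp add: algebra_simps)
qed

lemma hol_at_divide:
  assumes "hol_at f z" "hol_at g z" "g z \<noteq> 0"
  shows "hol_at (\<lambda>w. f w / g w) z"
proof -
  obtain S T where S: "(f has_derivative S) (at z)" "\<And>c u. S (c *s u) = c * S u"
    and T: "(g has_derivative T) (at z)" "\<And>c u. T (c *s u) = c * T u"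
    using assms unfolding hol_at_def by metis
  have eq: "(c * p * y - x * (c * q)) / (y * y) = c * ((p * y - x * q) / (y * y))"
    for c p q x y :: complex
    by (metis (no_types, lifting) mult.assoc mult.left_commute right_diff_distrib times_divide_eq_right)
  show ?thesis unfolding hol_at_def
    by (rule exI[of _ "\<lambda>u. (S u * g z - f z * T u) / (g z * g z)"], rule conjI)
       (rule has_derivative_divide'[OF S(1) T(1) assms(3)], simp only: S(2) T(2) eq, simp)
qed

lemma hol_at_power: "hol_at f z \<Longrightarrow> hol_at (\<lambda>w. f w ^ k) z"
  by (induction k) (auto intro!: hol_at_mult hol_at_const)

lemma hol_at_sel_affine_pt: "hol_at (\<lambda>w. sel s (affine_pt t (w $ k))) z"
  by (cases s; cases t) (auto simp: sel_def affine_pt_def intro: hol_at_const hol_at_nth)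

lemma fst_eq_sel: "fst = sel True" and snd_eq_sel: "snd = sel False"
  by (auto simp: sel_def fun_eq_iff)

lemma holomorphic_map_onI:
  assumes "\<And>z k. z \<in> S \<Longrightarrow> hol_at (\<lambda>w. f w $ k) z"
  shows "holomorphic_map_on S (f :: complex ^ 2 \<Rightarrow> complex ^ 2)"
  unfolding holomorphic_map_on_def
proof
  fix z assume z: "z \<in> S"
  obtain T where T: "\<And>k. ((\<lambda>w. f w $ k) has_derivative T k) (at z)"
      "\<And>k c u. T k (c *s u) = c * T k u"
    using assms[OF z] unfolding hol_at_def by metis
  have "(f has_derivative (\<lambda>u. \<chi> k. T k u)) (at z)"
    by (subst has_derivative_componentwise_within)
       (auto simp: Basis_vec_def inner_axis intro!: has_derivative_inner_left T)
  then show "\<exists>T. (f has_derivative T) (at z) \<and> (\<forall>c u. T (c *s u) = c *s T u)"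
    by (intro exI[of _ "\<lambda>u. \<chi> k. T k u"]) (auto simp: T(2) vec_eq_iff)
qed

definition rx :: "bool \<times> bool \<Rightarrow> complex ^ 2 \<Rightarrow> complex \<times> complex" where
  "rx i z = affine_pt (fst i) (z $ 1)"
definition rv :: "bool \<times> bool \<Rightarrow> complex ^ 2 \<Rightarrow> complex \<times> complex" where
  "rv i z = affine_pt (snd i) (z $ 2)"

lemma hpt_eq: "hpt n i z = bundle_line n 0 (rx i z) (rv i z)"
  by (simp add: hpt_def rx_def rv_def)

lemma rx_rv_simps: "sel (fst i) (rx i z) = 1" "sel (snd i) (rv i z) = 1"
  by (auto simp: rx_def rv_def)

lemma continuous_sel_r:
  "continuous_on S (\<lambda>z. sel s (rx i z))" "continuous_on S (\<lambda>z. sel s (rv i z))"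
  unfolding rx_def rv_def sel_def affine_pt_def
  by (cases s; cases "fst i"; cases "snd i"; auto intro!: continuous_intros)+

lemma hpt_eq_hpt_iff:
  "hpt n i z = hpt n j w \<longleftrightarrow>
     sel (fst j) (rx i z) \<noteq> 0 \<and> sel (snd j) (rv i z) \<noteq> 0 \<and> w = hco n j (rx i z) (rv i z)"
  unfolding hpt_eq[of n i z] by (rule hpt_in_iff)

lemma inj_hpt: "inj (hpt n i)"
proof (rule injI)
  fix z w assume *: "hpt n i z = hpt n i w"
  have "z = hco n i (rx i z) (rv i z)" using hpt_eq_hpt_iff[of n i z i z] by simp
  with * show "z = w" using hpt_eq_hpt_iff[of n i z i w] by simp
qed

lemma coords_in_patch:
  "coords_in (hirzebruch_atlas n) i (patch (hirzebruch_atlas n) j) =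
     {z. sel (fst j) (rx i z) \<noteq> 0 \<and> sel (snd j) (rv i z) \<noteq> 0}"
  unfolding coords_in_def patch_def using hpt_eq_hpt_iff[of n i _ j] by (auto simp: image_iff)

lemma open_coords_in_patch:
  "open (coords_in (hirzebruch_atlas n) i (patch (hirzebruch_atlas n) j))"
  unfolding coords_in_patch
  by (intro open_Collect_conj open_Collect_neq continuous_sel_r continuous_on_const)

lemma coord_change_eq:
  assumes "z \<in> coords_in (hirzebruch_atlas n) i (patch (hirzebruch_atlas n) j)"
  shows "coord_change (hirzebruch_atlas n) i j z = hco n j (rx i z) (rv i z)"
proof -
  have "hpt n i z = hpt n j (hco n j (rx i z) (rv i z))"
    using assms unfolding coords_in_patch hpt_eq_hpt_iff by simp
  then show ?thesis by (simp add: coord_change_def inj_hpt)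
qed

lemma hol_at_hco:
  assumes "sel (fst j) (rx i z) \<noteq> 0" "sel (snd j) (rv i z) \<noteq> 0"
  shows "hol_at (\<lambda>w. hco n j (rx i w) (rv i w) $ k) z"
proof -
  have "hol_at (\<lambda>w. hco n j (rx i w) (rv i w) $ 1) z"
    using assms unfolding hco_def vector_2 rx_def rv_def
    by (intro hol_at_divide hol_at_sel_affine_pt) auto
  moreover have "hol_at (\<lambda>w. hco n j (rx i w) (rv i w) $ 2) z"
    using assms unfolding hco_def vector_2 rx_def rv_def fst_eq_sel snd_eq_sel
    by (cases "snd j")
       (simp_all, (intro hol_at_divide hol_at_mult hol_at_power hol_at_sel_affine_pt; simp)+)
  ultimately show ?thesis using exhaust_2[of k] by auto
qed

lemma holomorphic_coord_change:
  "holomorphic_map_on (coords_in (hirzebruch_atlas n) i (patch (hirzebruch_atlas n) j))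
     (coord_change (hirzebruch_atlas n) i j)"
proof (rule holomorphic_map_onI)
  fix z k
  let ?S = "coords_in (hirzebruch_atlas n) i (patch (hirzebruch_atlas n) j)"
  assume z: "z \<in> ?S"
  have h: "hol_at (\<lambda>w. hco n j (rx i w) (rv i w) $ k) z"
    using z unfolding coords_in_patch by (intro hol_at_hco) auto
  have ev: "\<forall>w\<in>?S. hco n j (rx i w) (rv i w) $ k = coord_change (hirzebruch_atlas n) i j w $ k"
    by (simp add: coord_change_eq)
  show "hol_at (\<lambda>w. coord_change (hirzebruch_atlas n) i j w $ k) z"
    using h unfolding hol_at_def
    by (metis (no_types, lifting) has_derivative_transform_within_open[OF _ open_coords_in_patch z] ev)
qed

lemma Union_patch: "(\<Union>i. patch (hirzebruch_atlas n) i) = hirzebruch n"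
proof (intro equalityI subsetI)
  fix p assume "p \<in> (\<Union>i. patch (hirzebruch_atlas n) i)"
  then obtain i z where p: "p = bundle_line n 0 (rx i z) (rv i z)"
    by (auto simp: patch_def hpt_eq)
  have "rx i z \<noteq> 0" "rv i z \<noteq> 0" by (auto simp: rx_def rv_def affine_pt_def prod_eq_iff)
  with p show "p \<in> hirzebruch n" unfolding hirzebruch_def projectivized_sum_def by blast
next
  fix p assume "p \<in> hirzebruch n"
  then obtain x v where p: "p = bundle_line n 0 x v" "x \<noteq> 0" "v \<noteq> 0"
    unfolding hirzebruch_def projectivized_sum_def by blast
  let ?i = "(fst x \<noteq> 0, fst v \<noteq> 0)"
  have "sel (fst ?i) x \<noteq> 0" "sel (snd ?i) v \<noteq> 0"
    using p by (auto simp: sel_def prod_eq_iff)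
  from hpt_hco[OF this, of n] p show "p \<in> (\<Union>i. patch (hirzebruch_atlas n) i)"
    by (auto simp: patch_def intro!: exI image_eqI)
qed

subsection \<open>Topology\<close>

lemma openin_manifold_topology: "openin (manifold_topology M A) V \<longleftrightarrow> manifold_open M A V"
proof -
  have Int: "coords_in A i (V \<inter> W) = coords_in A i V \<inter> coords_in A i W" for i V W
    by (auto simp: coords_in_def)
  have Un: "coords_in A i (\<Union>K) = (\<Union>V\<in>K. coords_in A i V)" for i K
    by (auto simp: coords_in_def)
  have "istopology (manifold_open M A)"
    unfolding istopology_def manifold_open_def by (auto simp: Int Un)
  then show ?thesis by (simp add: manifold_topology_def topology_inverse')
qed

lemma manifold_open_image:
  assumes "open B"
  shows "manifold_open (hirzebruch n) (hirzebruch_atlas n) (hpt n i ` B)"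
  unfolding manifold_open_def
proof (intro conjI allI)
  show "hpt n i ` B \<subseteq> hirzebruch n"
    using Union_patch[of n] by (auto simp: patch_def)
  fix j
  let ?S = "coords_in (hirzebruch_atlas n) j (patch (hirzebruch_atlas n) i)"
  have eq: "coords_in (hirzebruch_atlas n) j (hpt n i ` B) =
      {z \<in> ?S. coord_change (hirzebruch_atlas n) j i z \<in> B}"
  proof (intro equalityI subsetI)
    fix z assume "z \<in> coords_in (hirzebruch_atlas n) j (hpt n i ` B)"
    then obtain w where w: "w \<in> B" "hpt n j z = hpt n i w" unfolding coords_in_def by auto
    have "z \<in> ?S" using w(2) unfolding coords_in_def patch_def by simp
    moreover have "coord_change (hirzebruch_atlas n) j i z = w"
      using w(2) by (simp add: coord_change_def inj_hpt)
    ultimately show "z \<in> {z \<in> ?S. coord_change (hirzebruch_atlas n) j i z \<in> B}"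
      using w(1) by simp
  next
    fix z assume z: "z \<in> {z \<in> ?S. coord_change (hirzebruch_atlas n) j i z \<in> B}"
    then obtain w where w: "hpt n j z = hpt n i w"
      unfolding coords_in_def patch_def by auto
    then have "coord_change (hirzebruch_atlas n) j i z = w"
      by (simp add: coord_change_def inj_hpt)
    with z w show "z \<in> coords_in (hirzebruch_atlas n) j (hpt n i ` B)"
      unfolding coords_in_def by simp
  qed
  have "continuous_on ?S (coord_change (hirzebruch_atlas n) j i)"
  proof (rule continuous_at_imp_continuous_on, rule)
    fix z assume "z \<in> ?S"
    then obtain T where "(coord_change (hirzebruch_atlas n) j i has_derivative T) (at z)"
      using holomorphic_coord_change[of n j i] unfolding holomorphic_map_on_def by blast
    then show "isCont (coord_change (hirzebruch_atlas n) j i) z"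
      by (rule has_derivative_continuous)
  qed
  from continuous_open_preimage[OF this open_coords_in_patch assms]
  show "open (coords_in (hirzebruch_atlas n) j (hpt n i ` B))"
    unfolding eq by (simp only: vimage_def Int_def mem_Collect_eq)
qed

definition norm2 :: "complex \<times> complex \<Rightarrow> real" where
  "norm2 x = (cmod (fst x))\<^sup>2 + (cmod (snd x))\<^sup>2"

definition base_diff :: "complex \<times> complex \<Rightarrow> complex \<times> complex \<Rightarrow> real" where
  "base_diff x v = (cmod (fst x))\<^sup>2 - (cmod (snd x))\<^sup>2"

definition fibre_diff :: "nat \<Rightarrow> complex \<times> complex \<Rightarrow> complex \<times> complex \<Rightarrow> real" where
  "fibre_diff n x v = (cmod (fst v))\<^sup>2 - norm2 x ^ n * (cmod (snd v))\<^sup>2"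

lemma diff_scale:
  assumes "s \<noteq> 0" "r \<noteq> 0"
  shows "0 < base_diff (s * fst x, s * snd x) v' \<longleftrightarrow> 0 < base_diff x v"
    "base_diff (s * fst x, s * snd x) v' < 0 \<longleftrightarrow> base_diff x v < 0"
    "0 < fibre_diff n (s * fst x, s * snd x) (r * s ^ n * fst v, r * s ^ 0 * snd v) \<longleftrightarrow>
       0 < fibre_diff n x v"
    "fibre_diff n (s * fst x, s * snd x) (r * s ^ n * fst v, r * s ^ 0 * snd v) < 0 \<longleftrightarrow>
       fibre_diff n x v < 0"
proof -
  have b: "base_diff (s * fst x, s * snd x) v' = (cmod s)\<^sup>2 * base_diff x v"
    by (simp add: base_diff_def norm_mult power_mult_distrib algebra_simps)
  have "norm2 (s * fst x, s * snd x) = (cmod s)\<^sup>2 * norm2 x"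
    by (simp add: norm2_def norm_mult power_mult_distrib algebra_simps)
  then have f: "fibre_diff n (s * fst x, s * snd x) (r * s ^ n * fst v, r * s ^ 0 * snd v) =
      ((cmod r)\<^sup>2 * ((cmod s)\<^sup>2) ^ n) * fibre_diff n x v"
    by (simp add: fibre_diff_def norm_mult norm_power power_mult_distrib algebra_simps
        flip: power_mult)
  have p: "0 < (cmod s)\<^sup>2" "0 < (cmod r)\<^sup>2 * ((cmod s)\<^sup>2) ^ n" using assms by auto
  show "0 < base_diff (s * fst x, s * snd x) v' \<longleftrightarrow> 0 < base_diff x v"
    "base_diff (s * fst x, s * snd x) v' < 0 \<longleftrightarrow> base_diff x v < 0"
    "0 < fibre_diff n (s * fst x, s * snd x) (r * s ^ n * fst v, r * s ^ 0 * snd v) \<longleftrightarrow>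
       0 < fibre_diff n x v"
    "fibre_diff n (s * fst x, s * snd x) (r * s ^ n * fst v, r * s ^ 0 * snd v) < 0 \<longleftrightarrow>
       fibre_diff n x v < 0"
    unfolding b f using p by (simp_all only: zero_less_mult_iff mult_less_0_iff) auto
qed

text \<open>Sets of points described by a scaling-invariant condition on homogeneous coordinates.\<close>

definition hset :: "nat \<Rightarrow> (complex \<times> complex \<Rightarrow> complex \<times> complex \<Rightarrow> bool)
    \<Rightarrow> ((complex \<times> complex) \<times> (complex \<times> complex)) set set set" where
  "hset n P = {bundle_line n 0 x v | x v. x \<noteq> 0 \<and> v \<noteq> 0 \<and> P x v}"

lemma mem_hset:
  assumes "\<And>s r x v. s \<noteq> 0 \<Longrightarrow> r \<noteq> 0 \<Longrightarrow>
      P (s * fst x, s * snd x) (r * s ^ n * fst v, r * s ^ 0 * snd v) = P x v"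
    and "x \<noteq> 0" "v \<noteq> 0"
  shows "bundle_line n 0 x v \<in> hset n P \<longleftrightarrow> P x v"
proof
  assume "bundle_line n 0 x v \<in> hset n P"
  then obtain x' v' where "bundle_line n 0 x v = bundle_line n 0 x' v'" "P x' v'"
    unfolding hset_def by blast
  then show "P x v" using assms(1) unfolding bundle_line_eq_iff by blast
next
  assume "P x v" then show "bundle_line n 0 x v \<in> hset n P"
    using assms(2,3) unfolding hset_def by blast
qed

lemma rx_rv_nz: "rx i z \<noteq> 0" "rv i z \<noteq> 0"
  by (auto simp: rx_def rv_def affine_pt_def prod_eq_iff)

lemma manifold_open_hset:
  assumes "\<And>s r x v. s \<noteq> 0 \<Longrightarrow> r \<noteq> 0 \<Longrightarrow>
      P (s * fst x, s * snd x) (r * s ^ n * fst v, r * s ^ 0 * snd v) = P x v"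
    and "\<And>i. open {z. P (rx i z) (rv i z)}"
  shows "manifold_open (hirzebruch n) (hirzebruch_atlas n) (hset n P)"
  unfolding manifold_open_def
proof (intro conjI allI)
  show "hset n P \<subseteq> hirzebruch n"
    by (auto simp: hset_def hirzebruch_def projectivized_sum_def)
  fix i
  have "coords_in (hirzebruch_atlas n) i (hset n P) = {z. P (rx i z) (rv i z)}"
    by (auto simp: coords_in_def hpt_eq mem_hset[OF assms(1)] rx_rv_nz)
  then show "open (coords_in (hirzebruch_atlas n) i (hset n P))" using assms(2) by simp
qed

lemma continuous_diff:
  "continuous_on UNIV (\<lambda>z. base_diff (rx i z) (rv i z))"
  "continuous_on UNIV (\<lambda>z. fibre_diff n (rx i z) (rv i z))"
  unfolding base_diff_def fibre_diff_def norm2_def fst_eq_sel snd_eq_sel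
  by (intro continuous_intros continuous_sel_r)+

lemma Hausdorff_hirzebruch:
  "Hausdorff_space (manifold_topology (hirzebruch n) (hirzebruch_atlas n))"
  (is "Hausdorff_space ?X")
proof -
  let ?O = "manifold_open (hirzebruch n) (hirzebruch_atlas n)"
  note scale = diff_scale
  have O1: "?O (hset n (\<lambda>x v. 0 < base_diff x v))"
    by (rule manifold_open_hset; (intro scale open_Collect_less continuous_diff continuous_on_const)?)
  have O2: "?O (hset n (\<lambda>x v. base_diff x v < 0))"
    by (rule manifold_open_hset; (intro scale open_Collect_less continuous_diff continuous_on_const)?)
  have O3: "?O (hset n (\<lambda>x v. 0 < fibre_diff n x v))"
    by (rule manifold_open_hset; (intro scale open_Collect_less continuous_diff continuous_on_const)?)
  have O4: "?O (hset n (\<lambda>x v. fibre_diff n x v < 0))"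
    by (rule manifold_open_hset; (intro scale open_Collect_less continuous_diff continuous_on_const)?)
  have sep: "\<exists>U V. ?O U \<and> ?O V \<and> bundle_line n 0 x v \<in> U \<and> bundle_line n 0 x' v' \<in> V \<and> disjnt U V"
    if nz: "x \<noteq> 0" "v \<noteq> 0" "x' \<noteq> 0" "v' \<noteq> 0"
      and FG: "0 < F x v" "F x' v' < 0"
      and inv: "\<And>s r x v. s \<noteq> 0 \<Longrightarrow> r \<noteq> 0 \<Longrightarrow>
         (0 < F (s * fst x, s * snd x) (r * s ^ n * fst v, r * s ^ 0 * snd v)) = (0 < F x v)"
        "\<And>s r x v. s \<noteq> 0 \<Longrightarrow> r \<noteq> 0 \<Longrightarrow>
         (F (s * fst x, s * snd x) (r * s ^ n * fst v, r * s ^ 0 * snd v) < 0) = (F x v < 0)"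
      and op: "?O (hset n (\<lambda>x v. 0 < F x v))" "?O (hset n (\<lambda>x v. F x v < 0))"
    for x v x' v' and F :: "complex \<times> complex \<Rightarrow> complex \<times> complex \<Rightarrow> real"
  proof -
    have "disjnt (hset n (\<lambda>x v. 0 < F x v)) (hset n (\<lambda>x v. F x v < 0))"
      unfolding disjnt_iff
    proof (intro allI notI; elim conjE)
      fix p assume p: "p \<in> hset n (\<lambda>x v. 0 < F x v)" "p \<in> hset n (\<lambda>x v. F x v < 0)"
      then obtain y w where "p = bundle_line n 0 y w" "y \<noteq> 0" "w \<noteq> 0" unfolding hset_def by blast
      with p show False
        using mem_hset[of "\<lambda>x v. 0 < F x v" n y w] mem_hset[of "\<lambda>x v. F x v < 0" n y w] inv by force
    qed
    moreover have "bundle_line n 0 x v \<in> hset n (\<lambda>x v. 0 < F x v)"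
      "bundle_line n 0 x' v' \<in> hset n (\<lambda>x v. F x v < 0)"
      using nz FG unfolding hset_def by blast+
    ultimately show ?thesis using op by blast
  qed
  have sepB: "\<exists>U V. ?O U \<and> ?O V \<and> bundle_line n 0 x v \<in> U \<and> bundle_line n 0 x' v' \<in> V \<and> disjnt U V"
    if "x \<noteq> 0" "v \<noteq> 0" "x' \<noteq> 0" "v' \<noteq> 0" "0 < base_diff x v" "base_diff x' v' < 0" for x v x' v'
    by (rule sep[where F = base_diff]; (rule that scale O1 O2; assumption)?; (rule that scale O1 O2)?)
  have sepF: "\<exists>U V. ?O U \<and> ?O V \<and> bundle_line n 0 x v \<in> U \<and> bundle_line n 0 x' v' \<in> V \<and> disjnt U V"
    if "x \<noteq> 0" "v \<noteq> 0" "x' \<noteq> 0" "v' \<noteq> 0" "0 < fibre_diff n x v" "fibre_diff n x' v' < 0"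
    for x v x' v'
    by (rule sep[where F = "fibre_diff n"]; (rule that scale O3 O4; assumption)?; (rule that scale O3 O4)?)
  have main: "\<exists>U V. ?O U \<and> ?O V \<and> p \<in> U \<and> q \<in> V \<and> disjnt U V"
    if pq: "p \<in> hirzebruch n" "q \<in> hirzebruch n" "p \<noteq> q" for p q
  proof -
    obtain x v x' v' where p: "p = bundle_line n 0 x v" and q: "q = bundle_line n 0 x' v'"
      and nz: "x \<noteq> 0" "v \<noteq> 0" "x' \<noteq> 0" "v' \<noteq> 0"
      using pq unfolding hirzebruch_def projectivized_sum_def by blast
    have sym: ?thesis if "\<exists>U V. ?O U \<and> ?O V \<and> q \<in> U \<and> p \<in> V \<and> disjnt U V"
      using that disjnt_sym by blast
    consider (common) a b where "sel a x \<noteq> 0" "sel a x' \<noteq> 0" "sel b v \<noteq> 0" "sel b v' \<noteq> 0"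
      | (base1) "fst x = 0" "snd x' = 0" | (base2) "snd x = 0" "fst x' = 0"
      | (fib1) "fst v = 0" "snd v' = 0" | (fib2) "snd v = 0" "fst v' = 0"
    proof -
      have "(\<exists>a. sel a x \<noteq> 0 \<and> sel a x' \<noteq> 0) \<or> (fst x = 0 \<and> snd x' = 0) \<or> (snd x = 0 \<and> fst x' = 0)"
        using nz by (auto simp: sel_def prod_eq_iff split: if_splits)
      moreover have "(\<exists>a. sel a v \<noteq> 0 \<and> sel a v' \<noteq> 0) \<or> (fst v = 0 \<and> snd v' = 0) \<or> (snd v = 0 \<and> fst v' = 0)"
        using nz by (auto simp: sel_def prod_eq_iff split: if_splits)
      ultimately show ?thesis using that by blast
    qed
    then show ?thesis
    proof cases
      case (common a b)
      let ?i = "(a, b)"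
      obtain z w where z: "p = hpt n ?i z" "q = hpt n ?i w"
        using hpt_hco[of ?i x v n] hpt_hco[of ?i x' v' n] common p q by auto
      with pq have "z \<noteq> w" by auto
      then obtain B C where BC: "open B" "open C" "z \<in> B" "w \<in> C" "B \<inter> C = {}"
        using hausdorff by metis
      have "disjnt (hpt n ?i ` B) (hpt n ?i ` C)"
        using BC(5) inj_hpt[of n ?i] unfolding disjnt_def by (metis image_Int image_empty)
      then show ?thesis using manifold_open_image BC z by blast
    next
      case base1
      then show ?thesis using nz sepB[of x' v' x v] p q
        by (intro sym) (auto simp: base_diff_def prod_eq_iff)
    next
      case base2
      then show ?thesis using nz sepB[of x v x' v'] p q
        by (auto simp: base_diff_def prod_eq_iff)
    next
      case fib1
      have "0 < norm2 x" using nz by (auto simp: norm2_def prod_eq_iff add_pos_nonneg add_nonneg_pos)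
      then show ?thesis using nz sepF[of x' v' x v] p q fib1
        by (intro sym) (auto simp: fibre_diff_def prod_eq_iff)
    next
      case fib2
      have "0 < norm2 x'" using nz by (auto simp: norm2_def prod_eq_iff add_pos_nonneg add_nonneg_pos)
      then show ?thesis using nz sepF[of x v x' v'] p q fib2
        by (auto simp: fibre_diff_def prod_eq_iff)
    qed
  qed
  have "topspace ?X \<subseteq> hirzebruch n"
    unfolding topspace_def openin_manifold_topology by (auto simp: manifold_open_def)
  then show ?thesis
    unfolding Hausdorff_space_def openin_manifold_topology using main by blast
qed

lemma second_countable_hirzebruch:
  "second_countable (manifold_topology (hirzebruch n) (hirzebruch_atlas n))"
proof -
  obtain \<B> :: "(complex ^ 2) set set" where B: "countable \<B>" "topological_basis \<B>"
    using ex_countable_basis by blast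
  let ?C = "(\<Union>i. (\<lambda>W. hpt n i ` W) ` \<B>)"
  show ?thesis unfolding second_countable_def openin_manifold_topology
  proof (intro exI[of _ ?C] conjI allI impI ballI; (elim conjE)?)
    show "countable ?C" using B(1) by auto
    show "manifold_open (hirzebruch n) (hirzebruch_atlas n) V" if "V \<in> ?C" for V
      using that manifold_open_image topological_basis_open[OF B(2)] by blast
    fix U p assume U: "manifold_open (hirzebruch n) (hirzebruch_atlas n) U" and p: "p \<in> U"
    then have "p \<in> hirzebruch n" by (auto simp: manifold_open_def)
    then obtain i z where z: "p = hpt n i z"
      unfolding Union_patch[symmetric] by (auto simp: patch_def)
    have "open (coords_in (hirzebruch_atlas n) i U)" "z \<in> coords_in (hirzebruch_atlas n) i U"
      using U p z unfolding manifold_open_def by (blast, simp add: coords_in_def)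
    then obtain W where "W \<in> \<B>" "z \<in> W" "W \<subseteq> coords_in (hirzebruch_atlas n) i U"
      using topological_basisE[OF B(2)] by metis
    then show "\<exists>V\<in>?C. p \<in> V \<and> V \<subseteq> U"
      using z by (intro bexI[of _ "hpt n i ` W"] UN_I[of i] imageI) (auto simp: coords_in_def)
  qed
qed

theorem complex_manifold_hirzebruch: "complex_manifold (hirzebruch n) (hirzebruch_atlas n)"
  unfolding complex_manifold_def atlas_simps
  by (intro conjI allI open_UNIV inj_hpt Union_patch open_coords_in_patch
      holomorphic_coord_change Hausdorff_hirzebruch second_countable_hirzebruch)

end

theory Submission
  imports Defs
begin

text \<open>
  Let \<open>x\<close> and \<open>v\<close> be homogeneous coordinates of the base and of the fibre. The two functions
  \<open>\<bar>x\<bar>\<^sup>2\<close> and \<open>\<bar>v\<^sub>0\<bar>\<^sup>2 + \<bar>x\<bar>\<^sup>2\<^sup>n \<bar>v\<^sub>1\<bar>\<^sup>2\<close> are multiplied by \<open>\<bar>s\<bar>\<^sup>2\<close> and by \<open>\<bar>r s\<^sup>n\<bar>\<^sup>2\<close> under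
  rescaling, so the complex Hessian of
  \<open>log \<bar>x\<bar>\<^sup>2 + t log (\<bar>v\<^sub>0\<bar>\<^sup>2 + \<bar>x\<bar>\<^sup>2\<^sup>n \<bar>v\<^sub>1\<bar>\<^sup>2)\<close> is a global form; for \<open>t > 0\<close> it is positive. These are
  Hitchin's metrics. In each of the four standard charts the potential is
  \<open>a log (1 + \<bar>z\<^sub>1\<bar>\<^sup>2) + t log (1 + \<bar>z\<^sub>2\<bar>\<^sup>2 (1 + \<bar>z\<^sub>1\<bar>\<^sup>2)\<^sup>e)\<close> up to pluriharmonic terms, with \<open>e = \<plusminus>n\<close>, so a
  single computation with parameters \<open>a\<close>, \<open>t\<close>, \<open>e\<close> serves all charts.

  Let \<open>X\<close> and \<open>Y\<close> be the squared lengths of the horizontal and vertical parts of a tangent vector, and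
  let \<open>p \<in> [0, 1]\<close> be the normalized moment coordinate of the circle action on the fibre. By symmetry the
  curvature is a quadratic form in \<open>X\<close> and \<open>Y\<close> whose coefficients depend on \<open>p\<close> only
  (\<open>curv_G_sum\<close>, \<open>hol_sec_curv_G\<close>). For the \<open>t\<close> chosen below, its maximum on \<open>X + Y = 1\<close> is reached in vertical directions, where
  the fibre is a round sphere, and is proportional to \<open>1 / t\<close> (\<open>quartic_le\<close>). Its minimum is reached on
  the section \<open>p = 0\<close>, where the mixed term is most negative (\<open>quartic_ge\<close>). The quotient is
  \<open>t (1 - n\<^sup>2 t) / (1 + (2 n + 1) t)\<close>, which is largest for \<open>t = 1 / (n (2 n + 1))\<close>; its value there is
  \<open>1 / (2 n + 1)\<^sup>2\<close>, and this \<open>t\<close> is rational.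

  Rationality of the class uses that \<open>x\<^sub>i\<close> and \<open>v\<^sub>0\<close>, \<open>v\<^sub>1 x\<^sub>i\<^sup>n\<close> are local non-vanishing sections of line
  bundles. Dividing the two norms by them gives honest local potentials, hence primitives
  \<open>(1/2) Im \<partial>\<phi>\<close> of the Kaehler form. Two primitives differ by half the differential of arguments of
  quotients of sections. Around a triple overlap the chosen arguments add up to multiples of \<open>2 \<pi>\<close>, so
  dividing the metric by \<open>\<pi>\<close> makes the Cech cocycle rational. The arguments need single-valued branches on all
  overlaps, which the standard charts do not admit; the cover therefore consists of
  disc bundles around the coordinate axes and of slit charts (\<open>near_or_slit\<close>).
\<close>

section \<open>Wirtinger derivatives\<close>

text \<open>
  \<open>A\<close> is the form \<open>\<partial>f\<close> and \<open>B\<close> the conjugate-linear part of the differential at \<open>z\<close>, both as functions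
  of a tangent vector. Keeping the vector as an argument instead of working with the coordinate derivatives allows computations in one
  arbitrary direction, from which the coordinate derivatives are read off at the axis vectors.
\<close>

definition wirtinger ::
    "(complex ^ 'm::finite \<Rightarrow> complex) \<Rightarrow> (complex ^ 'm \<Rightarrow> complex) \<Rightarrow> (complex ^ 'm \<Rightarrow> complex)
       \<Rightarrow> complex ^ 'm \<Rightarrow> bool" where
  "wirtinger f A B z \<longleftrightarrow> (f has_derivative (\<lambda>u. A u + B u)) (at z) \<and>
     (\<forall>r u. A (r *s u) = r * A u) \<and> (\<forall>r u. B (r *s u) = cnj r * B u)"

lemma wirtinger_cong:
  assumes "wirtinger f A B z" "\<And>u. A u = A' u" "\<And>u. B u = B' u"
  shows "wirtinger f A' B' z"
proof -
  have "A = A'" "B = B'" using assms by auto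
  with assms show ?thesis by simp
qed

lemma wirtinger_const: "wirtinger (\<lambda>_. k) (\<lambda>_. 0) (\<lambda>_. 0) z"
  by (simp add: wirtinger_def)

lemma wirtinger_nth: "wirtinger (\<lambda>w. w $ i) (\<lambda>u. u $ i) (\<lambda>_. 0) z"
  by (auto simp: wirtinger_def intro: bounded_linear.has_derivative[OF bounded_linear_vec_nth])

lemma wirtinger_cnj:
  assumes "wirtinger f A B z"
  shows "wirtinger (\<lambda>w. cnj (f w)) (\<lambda>u. cnj (B u)) (\<lambda>u. cnj (A u)) z"
  using assms has_derivative_cnj[of f "\<lambda>u. A u + B u" "at z"]
  by (auto simp: wirtinger_def add.commute)

lemma wirtinger_add:
  assumes "wirtinger f A B z" "wirtinger g A' B' z"
  shows "wirtinger (\<lambda>w. f w + g w) (\<lambda>u. A u + A' u) (\<lambda>u. B u + B' u) z"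
  using assms has_derivative_add[of f "\<lambda>u. A u + B u" "at z" g "\<lambda>u. A' u + B' u"]
  by (auto simp: wirtinger_def algebra_simps)

lemma wirtinger_minus:
  assumes "wirtinger f A B z"
  shows "wirtinger (\<lambda>w. - f w) (\<lambda>u. - A u) (\<lambda>u. - B u) z"
  using assms has_derivative_minus[of f "\<lambda>u. A u + B u" "at z"]
  by (auto simp: wirtinger_def algebra_simps)

lemma wirtinger_diff:
  assumes "wirtinger f A B z" "wirtinger g A' B' z"
  shows "wirtinger (\<lambda>w. f w - g w) (\<lambda>u. A u - A' u) (\<lambda>u. B u - B' u) z"
  using wirtinger_add[OF assms(1) wirtinger_minus[OF assms(2)]] by simp

lemma wirtinger_mult:
  assumes "wirtinger f A B z" "wirtinger g A' B' z"
  shows "wirtinger (\<lambda>w. f w * g w) (\<lambda>u. A u * g z + f z * A' u) (\<lambda>u. B u * g z + f z * B' u) z"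
  using assms has_derivative_mult[of f "\<lambda>u. A u + B u" z UNIV g "\<lambda>u. A' u + B' u"]
  by (auto simp: wirtinger_def algebra_simps)

text \<open>Composition with a holomorphic function of one variable.\<close>

lemma wirtinger_compose_holomorphic:
  assumes "wirtinger f A B z" "(F has_field_derivative D) (at (f z))"
  shows "wirtinger (\<lambda>w. F (f w)) (\<lambda>u. D * A u) (\<lambda>u. D * B u) z"
proof -
  have "(F has_derivative (*) D) (at (f z))" using assms(2) by (simp add: has_field_derivative_def)
  then have "((\<lambda>w. F (f w)) has_derivative (\<lambda>u. D * (A u + B u))) (at z)"
    using assms(1) by (intro has_derivative_compose[of f _ z UNIV F]) (auto simp: wirtinger_def)
  with assms(1) show ?thesis by (auto simp: wirtinger_def algebra_simps)
qed

lemma wirtinger_inverse: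
  assumes "wirtinger f A B z" "f z \<noteq> 0"
  shows "wirtinger (\<lambda>w. inverse (f w)) (\<lambda>u. - (inverse (f z))\<^sup>2 * A u) (\<lambda>u. - (inverse (f z))\<^sup>2 * B u) z"
  using wirtinger_compose_holomorphic[OF assms(1) DERIV_inverse[OF assms(2)]]
  by (simp add: power2_eq_square)

lemma wirtinger_power_int:
  assumes "wirtinger f A B z" "f z \<noteq> 0"
  shows "wirtinger (\<lambda>w. f w powi e) (\<lambda>u. of_int e * f z powi e / f z * A u)
           (\<lambda>u. of_int e * f z powi e / f z * B u) z"
proof -
  have "((\<lambda>x. x powi e) has_field_derivative of_int e * f z powi e / f z) (at (f z))"
    using assms(2) by (auto intro!: derivative_eq_intros simp: power_int_diff)
  from wirtinger_compose_holomorphic[OF assms(1) this] show ?thesis .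
qed

lemmas wirtinger_intros =
  wirtinger_const wirtinger_nth wirtinger_cnj wirtinger_add wirtinger_minus wirtinger_diff wirtinger_mult

lemma wirtinger_deriv_at:
  assumes "wirtinger f A B z"
  shows "deriv_at f z = (\<lambda>u. A u + B u)"
  using assms frechet_derivative_at unfolding wirtinger_def by metis

lemma deriv_at_Im_wirtinger:
  assumes "wirtinger f A B z"
  shows "deriv_at (\<lambda>z. Im (f z)) z = (\<lambda>u. Im (A u + B u))"
  by (rule frechet_derivative_at[symmetric], rule bounded_linear.has_derivative[OF bounded_linear_Im])
    (use assms in \<open>simp add: wirtinger_def\<close>)

lemma
  assumes "wirtinger f A B z"
  shows dz_eq_wirtinger: "dz k f z = A (axis k 1)"
    and dzbar_eq_wirtinger: "dzbar k f z = B (axis k 1)"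
proof -
  have i: "axis k \<i> = \<i> *s (axis k 1 :: complex ^ 'a)" by (simp add: vec_eq_iff axis_def)
  have "A (axis k \<i>) = \<i> * A (axis k 1)" "B (axis k \<i>) = - \<i> * B (axis k 1)"
    unfolding i using assms by (auto simp: wirtinger_def)
  then show "dz k f z = A (axis k 1)" "dzbar k f z = B (axis k 1)"
    by (simp_all add: dz_def dzbar_def wirtinger_deriv_at[OF assms] field_simps)
qed

lemma wirtinger_sum:
  assumes "\<And>i. i \<in> I \<Longrightarrow> wirtinger (f i) (A i) (B i) z" "finite I"
  shows "wirtinger (\<lambda>w. \<Sum>i\<in>I. f i w) (\<lambda>u. \<Sum>i\<in>I. A i u) (\<lambda>u. \<Sum>i\<in>I. B i u) z"
  using assms(2,1) by (induction I rule: finite_induct) (simp_all add: wirtinger_const wirtinger_add)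

lemma eq_if_sum_diff_eq:
  fixes x y x' y' :: complex
  assumes "x + y = x' + y'" "x - y = x' - y'"
  shows "x = x'" "y = y'"
  using assms by (auto simp: complex_eq_iff)

text \<open>
  Rotating the direction by \<open>\<i>\<close> changes the sign of the second part relative to the first; this separates
  the two parts.
\<close>

lemma wirtinger_rotate:
  assumes "wirtinger f A B z"
  shows "A (\<i> *s u) + B (\<i> *s u) = \<i> * (A u - B u)"
  using assms by (simp add: wirtinger_def right_diff_distrib)

lemma wirtinger_unique:
  assumes "wirtinger f A B z" "wirtinger f A' B' z"
  shows "A u = A' u" "B u = B' u"
proof -
  have "(\<lambda>u. A u + B u) = (\<lambda>u. A' u + B' u)"
    using assms has_derivative_unique unfolding wirtinger_def by blast
  then have 1: "A v + B v = A' v + B' v" for v by metis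
  from 1[of "\<i> *s u"] have "A u - B u = A' u - B' u"
    unfolding wirtinger_rotate[OF assms(1)] wirtinger_rotate[OF assms(2)] by simp
  with 1[of u] show "A u = A' u" "B u = B' u" by (rule eq_if_sum_diff_eq)+
qed

lemma wirtinger_add_arg:
  assumes "wirtinger f A B z"
  shows "A (u + v) = A u + A v" "B (u + v) = B u + B v"
proof -
  have "linear (\<lambda>u. A u + B u)"
    using assms has_derivative_linear unfolding wirtinger_def by blast
  then have 1: "A (u + v) + B (u + v) = (A u + B u) + (A v + B v)" for u v by (rule linear_add)
  have i: "\<i> *s u + \<i> *s v = \<i> *s (u + v)" by (simp add: vec.scale_right_distrib)
  have "\<i> * (A (u + v) - B (u + v)) = \<i> * (A u - B u) + \<i> * (A v - B v)"
    using 1[of "\<i> *s u" "\<i> *s v"] unfolding i wirtinger_rotate[OF assms] .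
  then have "\<i> * (A (u + v) - B (u + v)) = \<i> * ((A u + A v) - (B u + B v))"
    by (simp add: algebra_simps)
  then have "A (u + v) - B (u + v) = (A u + A v) - (B u + B v)" by simp
  moreover have "A (u + v) + B (u + v) = (A u + A v) + (B u + B v)" using 1[of u v] by simp
  ultimately show "A (u + v) = A u + A v" "B (u + v) = B u + B v"
    by (blast intro: eq_if_sum_diff_eq)+
qed

text \<open>
  Passes from the components of a derivative, in which the curvature tensor is defined, back to the
  derivative in a direction.
\<close>

lemma wirtinger_axis_sum:
  assumes "wirtinger f A B z"
  shows "(\<Sum>k\<in>UNIV. u $ k * A (axis k 1)) = A u" "(\<Sum>k\<in>UNIV. cnj (u $ k) * B (axis k 1)) = B u"
proof -
  have 0: "A 0 = 0" "B 0 = 0"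
    using wirtinger_add_arg[OF assms, of 0 0] by auto
  have *: "A (\<Sum>k\<in>K. u $ k *s axis k 1) = (\<Sum>k\<in>K. u $ k * A (axis k 1)) \<and>
      B (\<Sum>k\<in>K. u $ k *s axis k 1) = (\<Sum>k\<in>K. cnj (u $ k) * B (axis k 1))" if "finite K" for K
    using that assms
    by (induction K rule: finite_induct) (auto simp: 0 wirtinger_add_arg[OF assms] wirtinger_def)
  then show "(\<Sum>k\<in>UNIV. u $ k * A (axis k 1)) = A u" "(\<Sum>k\<in>UNIV. cnj (u $ k) * B (axis k 1)) = B u"
    using *[of UNIV] by (simp_all add: basis_expansion)
qed

section \<open>Closure properties of smooth functions\<close>

text \<open>
  The iterated derivative condition is stable under algebraic operations by induction on the order: the
  derivative of a product, an inverse or a logarithm is built from the functions and their derivatives, all of which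
  satisfy the condition of the preceding order.
\<close>

lemma Ck_on_cong:
  assumes "open S" "\<And>x. x \<in> S \<Longrightarrow> f x = g x" "Ck_on k S f"
  shows "Ck_on k S g"
  using assms(2,3)
proof (induction k arbitrary: f g)
  case 0
  then show ?case using continuous_on_eq[of S f g] by simp
next
  case (Suc k)
  have d: "(g has_derivative deriv_at f x) (at x)" if "x \<in> S" for x
  proof (rule has_derivative_transform_within_open[OF _ assms(1) that])
    show "(f has_derivative deriv_at f x) (at x)"
      using Suc.prems(2) that by (auto simp: frechet_derivative_works)
  qed (rule Suc.prems(1))
  have "deriv_at f x v = deriv_at g x v" if "x \<in> S" for x v
    using frechet_derivative_at[OF d[OF that]] by simp
  then have "Ck_on k S (\<lambda>x. deriv_at g x v)" for v
    using Suc.IH[of "\<lambda>x. deriv_at f x v" "\<lambda>x. deriv_at g x v"] Suc.prems(2) by auto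
  moreover have "g differentiable (at x)" if "x \<in> S" for x
    using d[OF that] unfolding differentiable_def by blast
  ultimately show ?case by simp
qed

lemma Ck_on_SucI:
  assumes "open S" "\<And>x. x \<in> S \<Longrightarrow> (f has_derivative D x) (at x)"
    "\<And>v. Ck_on k S (\<lambda>x. D x v)"
  shows "Ck_on (Suc k) S f"
proof -
  have "Ck_on k S (\<lambda>x. deriv_at f x v)" for v
  proof (rule Ck_on_cong[OF assms(1) _ assms(3)])
    show "D x v = deriv_at f x v" if "x \<in> S" for x
      using frechet_derivative_at[OF assms(2)[OF that]] by simp
  qed
  then show ?thesis using assms(2) by (auto simp: differentiable_def)
qed

lemma Ck_on_SucD:
  assumes "Ck_on (Suc k) S f"
  shows "x \<in> S \<Longrightarrow> (f has_derivative deriv_at f x) (at x)" "Ck_on k S (\<lambda>x. deriv_at f x v)"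
  using assms by (auto simp: frechet_derivative_works)

lemma Ck_on_Suc_imp_Ck_on: "Ck_on (Suc k) S f \<Longrightarrow> Ck_on k S f"
proof (induction k arbitrary: f)
  case 0
  then show ?case
    by (auto intro!: continuous_at_imp_continuous_on differentiable_imp_continuous_within)
next
  case (Suc k)
  have d: "(\<forall>x\<in>S. f differentiable (at x)) \<and> (\<forall>v. Ck_on (Suc k) S (\<lambda>x. deriv_at f x v))"
    using Suc.prems by (subst (asm) Ck_on.simps(2))
  then show ?case using Suc.IH by (subst Ck_on.simps(2)) blast
qed

lemma Ck_on_const: "Ck_on k S (\<lambda>_. c)"
  by (induction k arbitrary: c) auto

lemma Ck_on_linear_compose:
  assumes "open S" "bounded_linear L" "Ck_on k S f"
  shows "Ck_on k S (\<lambda>x. L (f x))"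
  using assms(3)
proof (induction k arbitrary: f)
  case 0
  then show ?case using bounded_linear.continuous_on[OF assms(2)] by simp
next
  case (Suc k)
  show ?case
    by (rule Ck_on_SucI[OF assms(1) bounded_linear.has_derivative[OF assms(2) Ck_on_SucD(1)[OF Suc.prems]]])
      (auto intro: Suc.IH Ck_on_SucD(2)[OF Suc.prems])
qed

lemma Ck_on_ident: "Ck_on k S (\<lambda>x. x)"
  by (cases k) (simp_all add: Ck_on_const)

lemma Ck_on_add:
  assumes "open S" "Ck_on k S f" "Ck_on k S g"
  shows "Ck_on k S (\<lambda>x. f x + g x)"
  using assms(2,3)
proof (induction k arbitrary: f g)
  case 0
  then show ?case by (simp add: continuous_on_add)
next
  case (Suc k)
  show ?case
    by (rule Ck_on_SucI[OF assms(1) has_derivative_add[OF Suc.prems[THEN Ck_on_SucD(1)]]])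
      (auto intro: Suc.IH Ck_on_SucD(2)[OF Suc.prems(1)] Ck_on_SucD(2)[OF Suc.prems(2)])
qed

lemma Ck_on_mult:
  fixes f g :: "'a::real_normed_vector \<Rightarrow> 'b::real_normed_algebra"
  assumes "open S" "Ck_on k S f" "Ck_on k S g"
  shows "Ck_on k S (\<lambda>x. f x * g x)"
  using assms(2,3)
proof (induction k arbitrary: f g)
  case 0
  then show ?case by (simp add: continuous_on_mult)
next
  case (Suc k)
  show ?case
    by (rule Ck_on_SucI[OF assms(1) has_derivative_mult[OF Suc.prems[THEN Ck_on_SucD(1)]]])
      (auto intro!: Ck_on_add[OF assms(1)] Suc.IH Ck_on_Suc_imp_Ck_on[OF Suc.prems(1)]
         Ck_on_Suc_imp_Ck_on[OF Suc.prems(2)] Ck_on_SucD(2)[OF Suc.prems(1)]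
         Ck_on_SucD(2)[OF Suc.prems(2)])
qed

lemma Ck_on_inverse:
  fixes f :: "'a::real_normed_vector \<Rightarrow> 'b::real_normed_field"
  assumes "open S" "Ck_on k S f" "\<And>x. x \<in> S \<Longrightarrow> f x \<noteq> 0"
  shows "Ck_on k S (\<lambda>x. inverse (f x))"
  using assms(2)
proof (induction k)
  case 0
  then show ?case using assms(3) by (simp add: continuous_on_inverse)
next
  case (Suc k)
  have "Ck_on k S (\<lambda>x. - (inverse (f x) * deriv_at f x v * inverse (f x)))" for v
    by (intro Ck_on_linear_compose[OF assms(1) bounded_linear_minus[OF bounded_linear_ident]]
        Ck_on_mult assms(1) Suc.IH Ck_on_Suc_imp_Ck_on[OF Suc.prems] Ck_on_SucD(2)[OF Suc.prems])
  then show ?case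
    by (intro Ck_on_SucI[OF assms(1) Deriv.has_derivative_inverse[OF assms(3) Ck_on_SucD(1)[OF Suc.prems]]])
qed

lemma Ck_on_Ln:
  assumes "open S" "Ck_on k S f" "\<And>x. x \<in> S \<Longrightarrow> f x \<notin> \<real>\<^sub>\<le>\<^sub>0"
  shows "Ck_on k S (\<lambda>x. Ln (f x))"
proof (cases k)
  case 0
  then show ?thesis using assms by (auto intro!: continuous_intros)
next
  case (Suc j)
  note f = assms(2)[unfolded Suc]
  have nz: "f x \<noteq> 0" if "x \<in> S" for x using assms(3)[OF that] by auto
  have "((\<lambda>x. Ln (f x)) has_derivative (\<lambda>v. inverse (f x) * deriv_at f x v)) (at x)" if "x \<in> S" for x
    using has_derivative_compose[OF Ck_on_SucD(1)[OF f that]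
       has_field_derivative_Ln[OF assms(3)[OF that], unfolded has_field_derivative_def]] .
  then show ?thesis unfolding Suc
    by (rule Ck_on_SucI[OF assms(1)])
      (auto intro!: Ck_on_mult Ck_on_inverse assms(1) nz Ck_on_Suc_imp_Ck_on[OF f] Ck_on_SucD(2)[OF f])
qed

lemma smooth_on_const: "smooth_on S (\<lambda>_. c)"
  by (simp add: smooth_on_def Ck_on_const)

lemma smooth_on_linear_compose:
  assumes "open S" "bounded_linear L" "smooth_on S f"
  shows "smooth_on S (\<lambda>x. L (f x))"
  using assms by (simp add: smooth_on_def Ck_on_linear_compose)

lemma smooth_on_nth: "open S \<Longrightarrow> smooth_on S (\<lambda>x :: complex ^ 'm::finite. x $ i)"
  unfolding smooth_on_def by (intro allI Ck_on_linear_compose[OF _ bounded_linear_vec_nth] Ck_on_ident)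

lemmas smooth_on_cnj = smooth_on_linear_compose[OF _ bounded_linear_cnj]
lemmas smooth_on_Re = smooth_on_linear_compose[OF _ bounded_linear_Re]
lemmas smooth_on_Im = smooth_on_linear_compose[OF _ bounded_linear_Im]
lemmas smooth_on_minus = smooth_on_linear_compose[OF _ bounded_linear_minus[OF bounded_linear_ident]]

lemma smooth_on_add:
  assumes "open S" "smooth_on S f" "smooth_on S g"
  shows "smooth_on S (\<lambda>x. f x + g x)"
  using assms by (simp add: smooth_on_def Ck_on_add)

lemma smooth_on_mult:
  fixes f g :: "'a::real_normed_vector \<Rightarrow> 'b::real_normed_algebra"
  assumes "open S" "smooth_on S f" "smooth_on S g"
  shows "smooth_on S (\<lambda>x. f x * g x)"
  using assms by (simp add: smooth_on_def Ck_on_mult)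

lemma smooth_on_diff:
  assumes "open S" "smooth_on S f" "smooth_on S g"
  shows "smooth_on S (\<lambda>x. f x - g x)"
  using smooth_on_add[OF assms(1,2) smooth_on_minus[OF assms(1,3)]] by simp

lemma smooth_on_inverse:
  fixes f :: "'a::real_normed_vector \<Rightarrow> 'b::real_normed_field"
  assumes "open S" "smooth_on S f" "\<And>x. x \<in> S \<Longrightarrow> f x \<noteq> 0"
  shows "smooth_on S (\<lambda>x. inverse (f x))"
  using assms by (simp add: smooth_on_def Ck_on_inverse)

lemma smooth_on_power:
  fixes f :: "'a::real_normed_vector \<Rightarrow> 'b::real_normed_field"
  assumes "open S" "smooth_on S f"
  shows "smooth_on S (\<lambda>x. f x ^ j)"
  by (induction j) (auto intro: smooth_on_const smooth_on_mult assms)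

lemma smooth_on_power_int:
  fixes f :: "'a::real_normed_vector \<Rightarrow> 'b::real_normed_field"
  assumes "open S" "smooth_on S f" "\<And>x. x \<in> S \<Longrightarrow> f x \<noteq> 0"
  shows "smooth_on S (\<lambda>x. f x powi e)"
  unfolding power_int_def
  by (cases "0 \<le> e") (simp_all add: smooth_on_power smooth_on_inverse assms)

lemma smooth_on_Ln:
  assumes "open S" "smooth_on S f" "\<And>x. x \<in> S \<Longrightarrow> f x \<notin> \<real>\<^sub>\<le>\<^sub>0"
  shows "smooth_on S (\<lambda>x. Ln (f x))"
  using assms by (simp add: smooth_on_def Ck_on_Ln)

lemmas smooth_on_intros = smooth_on_const smooth_on_nth smooth_on_cnj smooth_on_Re smooth_on_Im
  smooth_on_minus smooth_on_add smooth_on_mult smooth_on_diff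

section \<open>Kaehler metrics from a potential on a twisted product of affine lines\<close>

definition fs :: "complex ^ 2 \<Rightarrow> complex" where
  "fs z = inverse (1 + z $ 1 * cnj (z $ 1))"

lemma one_plus_norm_eq: "1 + w * cnj w = complex_of_real (1 + (cmod w)\<^sup>2)"
  unfolding of_real_add of_real_1 complex_norm_square ..

lemma one_plus_norm_nz: "1 + w * cnj w \<noteq> (0::complex)"
  unfolding one_plus_norm_eq of_real_eq_0_iff by (metis add_pos_nonneg less_irrefl zero_le_power2 zero_less_one)

lemma fs_of_real: "fs z = of_real (1 / (1 + (cmod (z $ 1))\<^sup>2))"
  unfolding fs_def one_plus_norm_eq by (simp add: divide_inverse)

lemma cnj_fs [simp]: "cnj (fs z) = fs z"
  by (simp add: fs_def mult.commute)

lemma fs_nz [simp]: "fs z \<noteq> 0"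
  using one_plus_norm_nz by (simp add: fs_def)

lemma fs_rel: "fs z * (z $ 1 * cnj (z $ 1)) = 1 - fs z"
  using one_plus_norm_nz[of "z $ 1"] by (simp add: fs_def field_simps)

text \<open>
  The potential is \<open>a log (1 + \<bar>z\<^sub>1\<bar>\<^sup>2) + s log (1 + U)\<close> with \<open>U = \<bar>z\<^sub>2\<bar>\<^sup>2 h\<close> and \<open>h = (1 + \<bar>z\<^sub>1\<bar>\<^sup>2)\<^sup>e\<close>; it is the
  Calabi ansatz for the line bundle with Hermitian metric \<open>h\<close>. The positivity conditions on \<open>a\<close> and \<open>a + s e\<close> say that the
  base directions have positive length at \<open>U = 0\<close> and in the limit \<open>U \<rightarrow> \<infinity>\<close>.
\<close>

locale calabi =
  fixes a s :: real and e :: int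
  assumes a_pos: "0 < a" and s_pos: "0 < s" and a_s_pos: "0 < a + s * e"
begin

definition h :: "complex ^ 2 \<Rightarrow> complex" where
  "h z = (1 + z $ 1 * cnj (z $ 1)) powi e"

text \<open>
  With \<open>q = 1 / (1 + U)\<close>, the number \<open>1 - q\<close> is the moment coordinate of the circle action on the fibres.
  All derivatives below are polynomials in the coordinates, \<open>fs\<close>, \<open>h\<close> and \<open>q\<close>, and the only relations
  needed are \<open>fs_rel\<close> and \<open>q_rel\<close>.
\<close>

definition q :: "complex ^ 2 \<Rightarrow> complex" where
  "q z = inverse (1 + z $ 2 * cnj (z $ 2) * h z)"

text \<open>
  \<open>\<beta>\<close> is the coefficient of the Fubini-Study metric in the horizontal part of the metric, and \<open>\<gamma>\<close> is the squared length of
  the vertical coordinate vector.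
\<close>

definition \<beta> :: "complex ^ 2 \<Rightarrow> complex" where
  "\<beta> z = of_real a + of_real s * of_int e * (1 - q z)"

definition \<gamma> :: "complex ^ 2 \<Rightarrow> complex" where
  "\<gamma> z = of_real s * h z * (q z * q z)"

text \<open>
  The connection coefficient of the Chern connection of \<open>h\<close>: the form \<open>\<theta> = dz\<^sub>2 + con dz\<^sub>1\<close> is \<open>z\<^sub>2 \<partial> log U\<close>, and its
  kernel consists of the horizontal vectors. The metric is diagonal with respect to \<open>dz\<^sub>1\<close> and \<open>\<theta>\<close>.
\<close>

definition con :: "complex ^ 2 \<Rightarrow> complex" where
  "con z = of_int e * (fs z * (cnj (z $ 1) * z $ 2))"

definition \<theta> :: "complex ^ 2 \<Rightarrow> complex ^ 2 \<Rightarrow> complex" where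
  "\<theta> z u = u $ 2 + con z * u $ 1"

definition g :: "complex ^ 2 \<Rightarrow> complex ^ 2 \<Rightarrow> complex ^ 2 \<Rightarrow> complex" where
  "g z u v = \<beta> z * (fs z * fs z) * (u $ 1 * cnj (v $ 1)) + \<gamma> z * (\<theta> z u * cnj (\<theta> z v))"

text \<open>
  The derivative \<open>\<partial>\<^sub>u g(v, w)\<close> for constant vector fields. Its symmetry in \<open>u\<close> and \<open>v\<close> is the Kaehler condition.
\<close>

definition dg :: "complex ^ 2 \<Rightarrow> complex ^ 2 \<Rightarrow> complex ^ 2 \<Rightarrow> complex ^ 2 \<Rightarrow> complex" where
  "dg z u v w =
     of_int e * \<gamma> z * cnj (z $ 2) * (fs z * fs z) * cnj (w $ 1) * (v $ 1 * \<theta> z u + u $ 1 * \<theta> z v)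
     - 2 * \<beta> z * (fs z * fs z * fs z) * cnj (z $ 1) * (u $ 1 * v $ 1 * cnj (w $ 1))
     + \<gamma> z * cnj (\<theta> z w) *
        (of_int e * cnj (z $ 1) * fs z * (u $ 1 * \<theta> z v + v $ 1 * \<theta> z u)
         - 2 * q z * cnj (z $ 2) * h z * (\<theta> z u * \<theta> z v)
         - (of_int e + 1) * fs z * cnj (z $ 1) * con z * (u $ 1 * v $ 1))"

text \<open>
  The form \<open>\<partial>\<phi>\<close> of the potential \<open>\<phi>\<close>, so that its conjugate-linear derivative is the metric (\<open>wirtinger_\<tau>\<close>).
\<close>

definition \<tau> :: "complex ^ 2 \<Rightarrow> complex ^ 2 \<Rightarrow> complex" where
  "\<tau> z u = of_real a * fs z * cnj (z $ 1) * u $ 1 + of_real s * q z * cnj (z $ 2) * h z * \<theta> z u"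

lemma h_of_real: "h z = of_real ((1 + (cmod (z $ 1))\<^sup>2) powi e)"
  unfolding h_def one_plus_norm_eq by (rule of_real_power_int[symmetric])

lemma h_pos: "0 < (1 + (cmod (z $ 1))\<^sup>2) powi e"
  by (intro zero_less_power_int add_pos_nonneg) auto

lemma h_nz [simp]: "h z \<noteq> 0"
  using h_pos[of z] unfolding h_of_real by (metis less_irrefl of_real_eq_0_iff)

lemma cnj_h [simp]: "cnj (h z) = h z"
  unfolding h_of_real by simp

lemma q_denom: "1 + z $ 2 * cnj (z $ 2) * h z =
    of_real (1 + (cmod (z $ 2))\<^sup>2 * (1 + (cmod (z $ 1))\<^sup>2) powi e)"
  unfolding h_of_real of_real_add of_real_1 of_real_mult complex_norm_square ..

lemma q_denom_pos: "0 < 1 + (cmod (z $ 2))\<^sup>2 * (1 + (cmod (z $ 1))\<^sup>2) powi e"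
  using h_pos[of z] by (intro add_pos_nonneg mult_nonneg_nonneg) auto

lemma q_denom_nz: "1 + z $ 2 * cnj (z $ 2) * h z \<noteq> 0"
  using q_denom_pos[of z] unfolding q_denom by (metis less_irrefl of_real_eq_0_iff)

lemma q_of_real: "q z = of_real (1 / (1 + (cmod (z $ 2))\<^sup>2 * (1 + (cmod (z $ 1))\<^sup>2) powi e))"
  unfolding q_def q_denom by (simp add: divide_inverse)

lemma cnj_q [simp]: "cnj (q z) = q z"
  unfolding q_of_real by simp

lemma q_nz [simp]: "q z \<noteq> 0"
  using q_denom_nz by (simp add: q_def)

lemma q_rel: "q z * (z $ 2 * cnj (z $ 2) * h z) = 1 - q z"
  using q_denom_nz[of z] by (simp add: q_def field_simps)

lemma cnj_coeffs [simp]: "cnj (\<beta> z) = \<beta> z" "cnj (\<gamma> z) = \<gamma> z"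
  by (simp_all add: \<beta>_def \<gamma>_def)

lemma wirtinger_fs:
  "wirtinger fs (\<lambda>u. - (cnj (z $ 1) * (fs z * fs z) * u $ 1)) (\<lambda>u. - (z $ 1 * (fs z * fs z) * cnj (u $ 1))) z"
  unfolding fs_def
  by (rule wirtinger_cong, rule wirtinger_inverse, (rule wirtinger_intros)+, rule one_plus_norm_nz)
    (simp_all add: power2_eq_square algebra_simps)

lemma wirtinger_h:
  "wirtinger h (\<lambda>u. of_int e * (cnj (z $ 1) * fs z * h z * u $ 1))
     (\<lambda>u. of_int e * (z $ 1 * fs z * h z * cnj (u $ 1))) z"
  unfolding h_def fs_def
  by (rule wirtinger_cong, rule wirtinger_power_int, (rule wirtinger_intros)+, rule one_plus_norm_nz)
    (simp_all add: divide_inverse algebra_simps)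

lemma wirtinger_q:
  "wirtinger q (\<lambda>u. - (q z * q z * cnj (z $ 2) * h z * \<theta> z u))
     (\<lambda>u. - (q z * q z * z $ 2 * h z * cnj (\<theta> z u))) z"
  unfolding q_def
  by (rule wirtinger_cong, rule wirtinger_inverse, (rule wirtinger_intros wirtinger_h)+, rule q_denom_nz)
    (simp_all add: \<theta>_def con_def power2_eq_square algebra_simps)

lemma wirtinger_\<beta>:
  "wirtinger \<beta> (\<lambda>u. of_int e * \<gamma> z * cnj (z $ 2) * \<theta> z u)
     (\<lambda>u. of_int e * \<gamma> z * z $ 2 * cnj (\<theta> z u)) z"
  unfolding \<beta>_def
  by (rule wirtinger_cong, (rule wirtinger_intros wirtinger_q)+)
    (simp_all add: \<gamma>_def algebra_simps)

lemma wirtinger_\<gamma>: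
  "wirtinger \<gamma> (\<lambda>u. \<gamma> z * (of_int e * cnj (z $ 1) * fs z * u $ 1 - 2 * q z * cnj (z $ 2) * h z * \<theta> z u))
     (\<lambda>u. \<gamma> z * (of_int e * z $ 1 * fs z * cnj (u $ 1) - 2 * q z * z $ 2 * h z * cnj (\<theta> z u))) z"
  unfolding \<gamma>_def
  by (rule wirtinger_cong, (rule wirtinger_intros wirtinger_q wirtinger_h)+)
    (simp_all add: algebra_simps)

lemma wirtinger_con:
  "wirtinger con (\<lambda>u. of_int e * fs z * cnj (z $ 1) * \<theta> z u - (of_int e + 1) * fs z * cnj (z $ 1) * con z * u $ 1)
     (\<lambda>u. of_int e * z $ 2 * (fs z * fs z) * cnj (u $ 1)) z"
  unfolding con_def
  apply (rule wirtinger_cong, (rule wirtinger_intros wirtinger_fs)+)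
   apply (simp add: \<theta>_def con_def algebra_simps)
  subgoal for u using fs_rel[of z] by (simp, intro disjI2, algebra)
  done

lemma wirtinger_\<theta>:
  "wirtinger (\<lambda>z. \<theta> z v)
     (\<lambda>u. v $ 1 * (of_int e * fs z * cnj (z $ 1) * \<theta> z u - (of_int e + 1) * fs z * cnj (z $ 1) * con z * u $ 1))
     (\<lambda>u. v $ 1 * (of_int e * z $ 2 * (fs z * fs z) * cnj (u $ 1))) z"
  unfolding \<theta>_def[abs_def]
  by (rule wirtinger_cong, (rule wirtinger_intros wirtinger_con)+) (simp_all add: \<theta>_def algebra_simps)

lemmas wirtinger_coeffs = wirtinger_fs wirtinger_h wirtinger_q wirtinger_\<beta> wirtinger_\<gamma> wirtinger_\<theta> wirtinger_con

lemma cnj_g: "cnj (g z u v) = g z v u"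
  by (simp add: g_def algebra_simps)

lemma dg_commute: "dg z u v w = dg z v u w"
  by (simp add: dg_def algebra_simps)

lemma wirtinger_g: "wirtinger (\<lambda>z. g z v w) (\<lambda>u. dg z u v w) (\<lambda>u. cnj (dg z u w v)) z"
  unfolding g_def[abs_def]
  apply (rule wirtinger_cong, (rule wirtinger_intros wirtinger_coeffs)+)
   apply (simp add: dg_def algebra_simps)
  apply (simp add: dg_def algebra_simps)
  done

text \<open>
  The complex-linear part of the derivative of \<open>\<tau>\<close>: the second derivative \<open>\<partial>\<^sub>v \<partial>\<^sub>u \<phi>\<close>. By its symmetry it drops out of the exterior derivative of \<open>\<tau>\<close>.
\<close>

definition d\<tau> :: "complex ^ 2 \<Rightarrow> complex ^ 2 \<Rightarrow> complex ^ 2 \<Rightarrow> complex" where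
  "d\<tau> z v u = - (of_real a * (fs z * fs z) * (cnj (z $ 1))\<^sup>2 * (u $ 1 * v $ 1))
     + of_real s * cnj (z $ 2) * q z * h z *
        (of_int e * cnj (z $ 1) * fs z * (v $ 1 * \<theta> z u + u $ 1 * \<theta> z v)
         - q z * cnj (z $ 2) * h z * (\<theta> z u * \<theta> z v)
         - (of_int e + 1) * fs z * cnj (z $ 1) * con z * (u $ 1 * v $ 1))"

lemma d\<tau>_commute: "d\<tau> z u v = d\<tau> z v u"
  by (simp add: d\<tau>_def algebra_simps)

lemma wirtinger_\<tau>: "wirtinger (\<lambda>z. \<tau> z u) (\<lambda>v. d\<tau> z v u) (\<lambda>v. g z u v) z"
  unfolding \<tau>_def[abs_def]
  apply (rule wirtinger_cong, (rule wirtinger_intros wirtinger_coeffs)+)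
   apply (simp add: d\<tau>_def power2_eq_square algebra_simps)
  subgoal for v
  proof -
    have "cnj (v $ 2) = cnj (\<theta> z v) - of_int e * (fs z * (z $ 1 * cnj (z $ 2))) * cnj (v $ 1)"
      by (simp add: \<theta>_def con_def)
    then show ?thesis
      using fs_rel[of z] q_rel[of z] unfolding g_def \<beta>_def \<gamma>_def by simp algebra
  qed
  done

text \<open>
  The value of \<open>\<Sum> R\<^sub>i\<^sub>j\<^sub>k\<^sub>l u\<^sub>i u\<^sub>j u\<^sub>k u\<^sub>l\<close> (second and fourth factor conjugated), written in the horizontal and
  vertical components of \<open>u\<close>. Only their squared moduli occur, because a rotation about a point of the base
  changes the phase of the horizontal component alone.
\<close>

definition curv_quartic :: "complex ^ 2 \<Rightarrow> complex ^ 2 \<Rightarrow> complex" where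
  "curv_quartic z u = (2 * \<beta> z - 2 * (of_int e)\<^sup>2 * of_real s * q z * (1 - q z)) * (fs z * fs z * (u $ 1 * cnj (u $ 1)))\<^sup>2
     + 4 * (of_int e * (1 - 2 * q z) + (of_int e)\<^sup>2 * of_real s * q z * (1 - q z) / \<beta> z) *
         (fs z * fs z * (u $ 1 * cnj (u $ 1))) * (\<gamma> z * (\<theta> z u * cnj (\<theta> z u)))
     + 2 / of_real s * (\<gamma> z * (\<theta> z u * cnj (\<theta> z u)))\<^sup>2"

end

section \<open>The curvature tensor\<close>

lemma matrix_inv_unique:
  fixes M N :: "'a::semiring_1 ^ 'n::finite ^ 'n"
  assumes "M ** N = mat 1" "N ** M = mat 1"
  shows "matrix_inv M = N"
proof -
  have "M ** matrix_inv M = mat 1 \<and> matrix_inv M ** M = mat 1"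
    unfolding matrix_inv_def by (rule someI[of _ N]) (use assms in simp)
  then have "matrix_inv M = matrix_inv M ** (M ** N)" using assms by simp
  also have "\<dots> = N" using \<open>M ** matrix_inv M = mat 1 \<and> _\<close> by (simp add: matrix_mul_assoc)
  finally show ?thesis .
qed

text \<open>
  The polynomial identity behind the curvature formula. The letters stand for the quantities of the locale
  \<open>calabi\<close>: \<open>t, w\<close> for the coordinates, \<open>x\<close> for \<open>u\<^sub>1\<close>, \<open>y\<close> for \<open>\<theta>(u)\<close>, primes for complex conjugates. The
  left-hand side is \<open>dg u u u\<close> differentiated by the Leibniz rule in the conjugate direction. The division by
  \<open>b\<close> occurs in one monomial only, on both sides, and is cancelled first; the rest is a polynomial identity modulo
  the two relations for \<open>P\<close> and \<open>q\<close>.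
\<close>

lemma curvature_identity:
  fixes t t' w w' x x' y y' P q h e s b g c c' :: complex
  assumes P: "P * (t * t') = 1 - P" and q: "q * (w * w' * h) = 1 - q" and b: "b \<noteq> 0" "s \<noteq> 0" "P \<noteq> 0"
    and g: "g = s * h * (q * q)" and c: "c = e * (P * (t' * w))" "c' = e * (P * (t * w'))"
  defines "W \<equiv> 2 * e * t' * P * x * y - 2 * q * w' * h * y\<^sup>2 - (e + 1) * P * t' * c * x\<^sup>2"
    and "W' \<equiv> 2 * e * t * P * x' * y' - 2 * q * w * h * y'\<^sup>2 - (e + 1) * P * t * c' * x'\<^sup>2"
    and "Y \<equiv> 2 * e * g * w' * y - 2 * b * P * t' * x"
    and "Y' \<equiv> 2 * e * g * w * y' - 2 * b * P * t * x'"
    and "H \<equiv> (2 * b - 2 * e\<^sup>2 * s * q * (1 - q)) * (P * P * (x * x'))\<^sup>2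
     + 4 * (e * (1 - 2 * q) + e\<^sup>2 * s * q * (1 - q) / b) * (P * P * (x * x')) * (g * (y * y'))
     + 2 / s * (g * (y * y'))\<^sup>2"
    and "dw' \<equiv> y' - c' * x'" and "dy \<equiv> x * (e * w * (P * P) * x')"
    and "dy' \<equiv> x' * (e * P * t * y' - (e + 1) * P * t * c' * x')"
    and "dg \<equiv> g * (e * t * P * x' - 2 * q * w * h * y')"
    and "dP \<equiv> - (t * (P * P) * x')" and "db \<equiv> e * g * w * y'"
  shows "2 * e * (dg * w' * (P * P) + g * dw' * (P * P) + g * w' * (2 * P * dP)) * x' * x * y
       + 2 * e * g * w' * (P * P) * x' * x * dy
       - 2 * (db * (P * P * P) * t' + b * (3 * P * P * dP) * t' + b * (P * P * P) * x') * x * x * x'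
       + (dg * y' + g * dy') * W
       + g * y' * (2 * e * x * (x' * P * y + t' * dP * y + t' * P * dy)
            - 2 * y * (- (q * q * w * h * y') * w' * h * y + q * dw' * h * y
                 + q * w' * (e * (t * P * h * x')) * y + q * w' * h * 2 * dy)
            - (e + 1) * x * x * (dP * t' * c + P * x' * c + P * t' * (e * w * (P * P) * x')))
      = g * W * W' + inverse (b * (P * P)) * (P\<^sup>2 * x * Y) * (P\<^sup>2 * x' * Y') - H"
proof -
  have 1: "inverse (b * (P * P)) * (P\<^sup>2 * x * Y) * (P\<^sup>2 * x' * Y') =
     P\<^sup>2 * x * x' * (4 * e\<^sup>2 * g * (s * q * (1 - q)) * y * y' / b
        - 4 * e * g * w' * y * P * t * x' - 4 * e * g * w * y' * P * t' * x + 4 * b * P * (1 - P) * x * x')"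
  proof -
    have e1: "g * g * w * w' = g * (s * q * (1 - q))" using q g by algebra
    have e2: "inverse (b * (P * P)) * (P\<^sup>2 * x * Y) * (P\<^sup>2 * x' * Y') = P\<^sup>2 * x * x' * (Y * Y' / b)"
      using b by (simp add: field_simps power2_eq_square)
    have "Y * Y' = 4 * e\<^sup>2 * (g * g * w * w') * y * y' 
        + b * (- (4 * e * g * w' * y * P * t * x') - 4 * e * g * w * y' * P * t' * x) + 4 * b\<^sup>2 * P * (P * (t * t')) * x * x'"
      unfolding Y_def Y'_def by algebra
    then have "Y * Y' / b = 4 * e\<^sup>2 * g * (s * q * (1 - q)) * y * y' / b
        - 4 * e * g * w' * y * P * t * x' - 4 * e * g * w * y' * P * t' * x + 4 * b * P * (1 - P) * x * x'"
      unfolding e1 P using b by (simp add: field_simps power2_eq_square)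
    then show ?thesis unfolding e2 by simp
  qed
  have 2: "H = (2 * b - 2 * e\<^sup>2 * s * q * (1 - q)) * (P * P * (x * x'))\<^sup>2
     + 4 * (e * (1 - 2 * q)) * (P * P * (x * x')) * (g * (y * y'))
     + P\<^sup>2 * x * x' * (4 * e\<^sup>2 * g * (s * q * (1 - q)) * y * y' / b)
     + 2 * s * h\<^sup>2 * q^4 * (y * y')\<^sup>2"
    unfolding H_def g using b by (simp add: field_simps power2_eq_square power4_eq_xxxx)
  define K where "K = 4 * e\<^sup>2 * g * (s * q * (1 - q)) * y * y' / b"
  show ?thesis
    unfolding 1 2 K_def[symmetric]
    unfolding W_def W'_def dw'_def dy_def dy'_def dg_def dP_def db_def c g
    using P q by algebra
qed

context calabi begin

definition G :: "complex ^ 2 \<Rightarrow> complex ^ 2 ^ 2" where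
  "G z = (\<chi> i j. g z (axis i 1) (axis j 1))"

text \<open>
  The inverse of the Gram matrix, from the factorization of \<open>G\<close> into a unipotent matrix with entry \<open>con\<close> and the diagonal
  matrix of \<open>\<beta> fs\<^sup>2\<close> and \<open>\<gamma>\<close>.
\<close>

definition G_inv :: "complex ^ 2 \<Rightarrow> complex ^ 2 ^ 2" where
  "G_inv z = (let d = inverse (\<beta> z * (fs z * fs z)) in
     vector [vector [d, - (con z * d)], vector [- (cnj (con z) * d), inverse (\<gamma> z) + con z * cnj (con z) * d]])"

lemma \<gamma>_pos: "\<exists>r>0. \<gamma> z = of_real r"
proof -
  have "0 < s * (1 + (cmod (z $ 1))\<^sup>2) powi e *
      (1 / (1 + (cmod (z $ 2))\<^sup>2 * (1 + (cmod (z $ 1))\<^sup>2) powi e))\<^sup>2"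
    using s_pos h_pos[of z] q_denom_pos[of z] by (intro mult_pos_pos zero_less_power divide_pos_pos) auto
  then show ?thesis
    by (intro exI conjI) (assumption, simp add: \<gamma>_def h_of_real q_of_real power2_eq_square)
qed

lemma q_range: "\<exists>r. 0 < r \<and> r \<le> 1 \<and> q z = of_real r"
proof -
  have "(1::real) \<le> 1 + (cmod (z $ 2))\<^sup>2 * (1 + (cmod (z $ 1))\<^sup>2) powi e"
    using h_pos[of z] by (simp add: less_imp_le)
  then show ?thesis using q_denom_pos[of z]
    by (intro exI[of _ "1 / (1 + (cmod (z $ 2))\<^sup>2 * (1 + (cmod (z $ 1))\<^sup>2) powi e)"] conjI q_of_real)
      (auto simp: divide_le_eq)
qed

lemma \<beta>_pos: "\<exists>r>0. \<beta> z = of_real r"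
proof -
  obtain r where r: "0 < r" "r \<le> 1" "q z = of_real r" using q_range by blast
  have "0 < r * a + (1 - r) * (a + s * e)"
    using r a_pos a_s_pos by (intro add_pos_nonneg mult_pos_pos mult_nonneg_nonneg) auto
  then show ?thesis
    by (intro exI conjI) (assumption, simp add: \<beta>_def r algebra_simps)
qed

lemma coeffs_nz [simp]: "\<gamma> z \<noteq> 0" "\<beta> z \<noteq> 0"
  using \<gamma>_pos[of z] \<beta>_pos[of z] by auto

lemma axis_nth_2 [simp]: "(axis 1 x :: complex ^ 2) $ 1 = x" "(axis 1 x :: complex ^ 2) $ 2 = 0"
  "(axis 2 x :: complex ^ 2) $ 1 = 0" "(axis 2 x :: complex ^ 2) $ 2 = x"
  by (simp_all add: axis_def)

lemma \<theta>_axis [simp]: "\<theta> z (axis 1 1) = con z" "\<theta> z (axis 2 1) = 1"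
  by (simp_all add: \<theta>_def)

lemma matrix_inv_G: "matrix_inv (G z) = G_inv z"
proof (rule matrix_inv_unique)
  define c d b where "c = con z" and "d = cnj (con z)" and "b = \<beta> z * (fs z * fs z)"
  have "b \<noteq> 0" by (simp add: b_def)
  then show "G z ** G_inv z = mat 1" "G_inv z ** G z = mat 1"
    by (simp_all add: vec_eq_iff forall_2 matrix_matrix_mult_def sum_2 G_def G_inv_def Let_def g_def mat_def
        c_def[symmetric] d_def[symmetric] b_def[symmetric] field_simps)
qed

lemma sesq_G: "sesq (G z) u v = g z u v"
  by (simp add: sesq_def sum_2 G_def g_def \<theta>_def algebra_simps)

lemma dz_G: "dz k (\<lambda>w. G w $ i $ j) z = dg z (axis k 1) (axis i 1) (axis j 1)"
  and dzbar_G: "dzbar l (\<lambda>w. G w $ i $ j) z = cnj (dg z (axis l 1) (axis j 1) (axis i 1))"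
  using dz_eq_wirtinger[OF wirtinger_g, of k] dzbar_eq_wirtinger[OF wirtinger_g, of l]
  by (simp_all add: G_def)

lemma wirtinger_dg_ex: "\<exists>A B. wirtinger (\<lambda>z. dg z u v w) A B z"
  unfolding dg_def by (rule exI, rule exI, (rule wirtinger_intros wirtinger_coeffs)+)

lemma dg_sum:
  "dg z u v w = (\<Sum>l\<in>UNIV. \<Sum>j\<in>UNIV. \<Sum>i\<in>UNIV. u $ l * (v $ j * (cnj (w $ i) *
      dg z (axis l 1) (axis j 1) (axis i 1))))"
  by (simp add: sum_2 dg_def \<theta>_def algebra_simps)

text \<open>
  The derivative \<open>dg u u\<close> as a functional of its last argument is determined by its value on the vertical axis vector, which is
  \<open>\<gamma> vert_dg\<close>, and by its value on the horizontal lift of the first one, which is \<open>fs\<^sup>2 u\<^sub>1 hor_dg\<close>.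
\<close>

definition vert_dg :: "complex ^ 2 \<Rightarrow> complex ^ 2 \<Rightarrow> complex" where
  "vert_dg z u = 2 * of_int e * cnj (z $ 1) * fs z * u $ 1 * \<theta> z u - 2 * q z * cnj (z $ 2) * h z * (\<theta> z u)\<^sup>2
             - (of_int e + 1) * fs z * cnj (z $ 1) * con z * (u $ 1)\<^sup>2"

definition hor_dg :: "complex ^ 2 \<Rightarrow> complex ^ 2 \<Rightarrow> complex" where
  "hor_dg z u = 2 * of_int e * \<gamma> z * cnj (z $ 2) * \<theta> z u - 2 * \<beta> z * fs z * cnj (z $ 1) * u $ 1"

lemma wirtinger_dg_diag:
  "\<exists>A B. wirtinger (\<lambda>z. dg z u u u) A B z \<and>
     B u = \<gamma> z * vert_dg z u * cnj (vert_dg z u)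
       + inverse (\<beta> z * (fs z * fs z)) * ((fs z)\<^sup>2 * u $ 1 * hor_dg z u) * cnj ((fs z)\<^sup>2 * u $ 1 * hor_dg z u)
       - curv_quartic z u"
proof -
  have u2: "cnj (u $ 2) = cnj (\<theta> z u) - cnj (con z) * cnj (u $ 1)"
    by (simp add: \<theta>_def)
  note * = curvature_identity[where P = "fs z" and t = "z $ 1" and t' = "cnj (z $ 1)" and q = "q z"
       and w = "z $ 2" and w' = "cnj (z $ 2)" and h = "h z" and b = "\<beta> z" and s = "of_real s"
       and g = "\<gamma> z" and c = "con z" and e = "of_int e" and c' = "cnj (con z)" and x = "u $ 1"
       and x' = "cnj (u $ 1)" and y = "\<theta> z u" and y' = "cnj (\<theta> z u)",
       OF fs_rel q_rel coeffs_nz(2)]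
  show ?thesis
    apply (rule exI, rule exI, rule conjI, unfold dg_def, (rule wirtinger_intros wirtinger_coeffs)+)
    apply (rule trans[OF _ trans[OF *]])
    apply (simp add: u2 power2_eq_square algebra_simps)
    using s_pos
    apply (simp_all add: \<gamma>_def con_def vert_dg_def hor_dg_def curv_quartic_def)
    done
qed

lemma matrix_inv_G_quadratic:
  "(\<Sum>p\<in>UNIV. \<Sum>r\<in>UNIV. matrix_inv (G z) $ p $ r * dg z u u (axis p 1) * cnj (dg z u u (axis r 1))) =
     \<gamma> z * vert_dg z u * cnj (vert_dg z u)
       + inverse (\<beta> z * (fs z * fs z)) * ((fs z)\<^sup>2 * u $ 1 * hor_dg z u) * cnj ((fs z)\<^sup>2 * u $ 1 * hor_dg z u)"
proof -
  have d2: "dg z u u (axis 2 1) = \<gamma> z * vert_dg z u"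
    by (simp add: dg_def vert_dg_def power2_eq_square algebra_simps)
  have "dg z u u (axis 1 1) = cnj (con z) * (\<gamma> z * vert_dg z u) + (fs z)\<^sup>2 * u $ 1 * hor_dg z u"
    by (simp add: dg_def vert_dg_def hor_dg_def power2_eq_square algebra_simps)
  moreover have "inverse (\<gamma> z) * \<gamma> z = 1" by simp
  ultimately show ?thesis
    by (simp add: sum_2 matrix_inv_G G_inv_def Let_def d2 algebra_simps)
qed

text \<open>
  Contracting the second derivatives of the metric components amounts to differentiating \<open>dg u u u\<close> in the
  conjugate direction \<open>u\<close>, because \<open>dg\<close> is linear in each argument, up to conjugation in the last; the terms with the
  inverse matrix then cancel those of \<open>wirtinger_dg_diag\<close>.
\<close>

lemma curv_G_sum:
  "(\<Sum>i\<in>UNIV. \<Sum>j\<in>UNIV. \<Sum>k\<in>UNIV. \<Sum>l\<in>UNIV.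
      curv G i j k l z * u $ i * cnj (u $ j) * u $ k * cnj (u $ l)) = curv_quartic z u"
proof -
  have "\<exists>A B. wirtinger (\<lambda>z. dg z u v w) A B z" for u v w by (rule wirtinger_dg_ex)
  then obtain A B where AB: "\<And>u v w. wirtinger (\<lambda>z. dg z u v w) (A u v w) (B u v w) z" by metis
  let ?e = "\<lambda>k. axis k (1::complex) :: complex ^ 2"
  have c: "curv G i j k l z = - cnj (B (?e l) (?e j) (?e i) (?e k))
     + (\<Sum>p\<in>UNIV. \<Sum>r\<in>UNIV. matrix_inv (G z) $ p $ r * dg z (?e k) (?e i) (?e p) * cnj (dg z (?e l) (?e j) (?e r)))"
    for i j k l
    unfolding curv_def dz_G dzbar_G
    by (subst dz_eq_wirtinger[OF wirtinger_cnj[OF AB]]) simp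
  obtain A' B' where B': "wirtinger (\<lambda>z. dg z u u u) A' B' z"
    "B' u = (\<Sum>p\<in>UNIV. \<Sum>r\<in>UNIV. matrix_inv (G z) $ p $ r * dg z u u (axis p 1) * cnj (dg z u u (axis r 1))) - curv_quartic z u"
    using wirtinger_dg_diag[of u z] unfolding matrix_inv_G_quadratic by blast
  have "wirtinger (\<lambda>z. \<Sum>l\<in>UNIV. \<Sum>j\<in>UNIV. \<Sum>i\<in>UNIV. u $ l * (u $ j * (cnj (u $ i) * dg z (?e l) (?e j) (?e i))))
     (\<lambda>x. \<Sum>l\<in>UNIV. \<Sum>j\<in>UNIV. \<Sum>i\<in>UNIV. u $ l * (u $ j * (cnj (u $ i) * A (?e l) (?e j) (?e i) x)))
     (\<lambda>x. \<Sum>l\<in>UNIV. \<Sum>j\<in>UNIV. \<Sum>i\<in>UNIV. u $ l * (u $ j * (cnj (u $ i) * B (?e l) (?e j) (?e i) x))) z"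
    by (rule wirtinger_cong, (rule wirtinger_sum finite wirtinger_mult wirtinger_const AB)+) simp_all
  then have "B' x = (\<Sum>l\<in>UNIV. \<Sum>j\<in>UNIV. \<Sum>i\<in>UNIV. u $ l * (u $ j * (cnj (u $ i) * B (?e l) (?e j) (?e i) x)))" for x
    using wirtinger_unique(2)[OF B'(1)] unfolding dg_sum[of _ u u u, symmetric] by blast
  then have "(\<Sum>k\<in>UNIV. cnj (u $ k) * (\<Sum>l\<in>UNIV. \<Sum>j\<in>UNIV. \<Sum>i\<in>UNIV. u $ l * (u $ j * (cnj (u $ i) * B (?e l) (?e j) (?e i) (?e k))))) = B' u"
    using wirtinger_axis_sum(2)[OF B'(1), of u] by simp
  from arg_cong[OF this, of cnj]
  have 1: "(\<Sum>i\<in>UNIV. \<Sum>j\<in>UNIV. \<Sum>k\<in>UNIV. \<Sum>l\<in>UNIV.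
      - cnj (B (?e l) (?e j) (?e i) (?e k)) * u $ i * cnj (u $ j) * u $ k * cnj (u $ l)) = - cnj (B' u)"
    by (simp add: sum_2 algebra_simps)
  have dgu: "dg z u u w = (\<Sum>k\<in>UNIV. \<Sum>i\<in>UNIV. u $ k * u $ i * dg z (?e k) (?e i) w)" for w
    by (simp add: sum_2 dg_def \<theta>_def algebra_simps)
  have 2: "(\<Sum>i\<in>UNIV. \<Sum>j\<in>UNIV. \<Sum>k\<in>UNIV. \<Sum>l\<in>UNIV.
      (\<Sum>p\<in>UNIV. \<Sum>r\<in>UNIV. matrix_inv (G z) $ p $ r * dg z (?e k) (?e i) (?e p) * cnj (dg z (?e l) (?e j) (?e r)))
        * u $ i * cnj (u $ j) * u $ k * cnj (u $ l)) =
     (\<Sum>p\<in>UNIV. \<Sum>r\<in>UNIV. matrix_inv (G z) $ p $ r * dg z u u (axis p 1) * cnj (dg z u u (axis r 1)))"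
    unfolding dgu by (simp add: sum_2 algebra_simps)
  have "cnj (curv_quartic z u) = curv_quartic z u"
    by (simp add: curv_quartic_def algebra_simps)
  moreover have "cnj (\<Sum>p\<in>UNIV. \<Sum>r\<in>UNIV. matrix_inv (G z) $ p $ r * dg z u u (axis p 1) * cnj (dg z u u (axis r 1))) =
    (\<Sum>p\<in>UNIV. \<Sum>r\<in>UNIV. matrix_inv (G z) $ p $ r * dg z u u (axis p 1) * cnj (dg z u u (axis r 1)))"
    unfolding matrix_inv_G_quadratic by (simp add: algebra_simps)
  ultimately show ?thesis
    unfolding c distrib_right sum.distrib 1 2 B'(2) by simp
qed

end

section \<open>The pinching estimate\<close>

text \<open>
  The curvature as a function of the squared lengths \<open>X\<close>, \<open>Y\<close> of the horizontal and vertical components. Here \<open>b\<close> is the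
  weight \<open>\<beta>\<close> of the base metric, \<open>p\<close> the moment coordinate, and \<open>n\<close> the degree of the bundle.
\<close>

definition quartic :: "real \<Rightarrow> real \<Rightarrow> real \<Rightarrow> real \<Rightarrow> real \<Rightarrow> real \<Rightarrow> real" where
  "quartic s n b p X Y =
     (2 / b - 2 * n\<^sup>2 * s * p * (1 - p) / b\<^sup>2) * X\<^sup>2
     + 4 * (n * (2 * p - 1) / b + n\<^sup>2 * s * p * (1 - p) / b\<^sup>2) * X * Y + 2 / s * Y\<^sup>2"

text \<open>
  At \<open>p = 0\<close> the difference of the two sides is a multiple of \<open>(X - 2 n Y)\<^sup>2\<close>. In general it is a multiple of a
  quadratic form in \<open>X\<close> and \<open>W = 2 n Y\<close> with coefficients \<open>A\<close>, \<open>B\<close>, \<open>E\<close>, which is positive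
  semidefinite because \<open>E > 0\<close> and its determinant is non-negative for \<open>0 \<le> p \<le> 1\<close>.
\<close>

lemma quartic_ge:
  fixes n k p c X Y :: real
  assumes n: "1 \<le> n" and k: "k = 2 * n + 1" and p: "0 \<le> p" "p \<le> 1" and c: "0 < c"
  shows "2 * n / (k * c) * (X + Y)\<^sup>2 \<le> quartic (c / (n * k)) n (c * (k + p) / k) p X Y"
proof -
  define W where "W = 2 * n * Y"
  define E where "E = (k + p)\<^sup>2"
  define A where "A = E - k * p * (k - (k - 2) * p)"
  define B where "B = - E + k * p * (2 * k + p)"
  have kp: "0 < k" "0 < k + p" "0 < E" using n k p by (auto simp: E_def)
  have "A * E - B\<^sup>2 = k\<^sup>2 * p * (3 * k\<^sup>2 * (1 - p) + 6 * k * p + 3 * p\<^sup>2 - 2 * k * p\<^sup>2)"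
    unfolding A_def B_def E_def by algebra
  also have "\<dots> \<ge> 0"
  proof -
    have "k * p * p \<le> k * p * 1" using kp p by (intro mult_left_mono) auto
    moreover have "2 * k * p\<^sup>2 = 2 * (k * p * p)" by (simp add: power2_eq_square)
    moreover have "0 \<le> k * p" "0 \<le> 3 * k\<^sup>2 * (1 - p)" "0 \<le> 3 * p\<^sup>2" using kp p by auto
    ultimately have "0 \<le> 3 * k\<^sup>2 * (1 - p) + 6 * k * p + 3 * p\<^sup>2 - 2 * k * p\<^sup>2" by linarith
    then show ?thesis using p by simp
  qed
  finally have "0 \<le> (E * W + B * X)\<^sup>2 + (A * E - B\<^sup>2) * X\<^sup>2" by simp
  also have "\<dots> = E * (A * X\<^sup>2 + 2 * B * X * W + E * W\<^sup>2)" by algebra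
  finally have pos: "0 \<le> A * X\<^sup>2 + 2 * B * X * W + E * W\<^sup>2" using kp by (simp add: zero_le_mult_iff)
  have n': "n = (k - 1) / 2" using k by simp
  have "quartic (c / (n * k)) n (c * (k + p) / k) p X Y - 2 * n / (k * c) * (X + Y)\<^sup>2 =
      (k + 1) / (c * k * E) * (A * X\<^sup>2 + 2 * B * X * W + E * W\<^sup>2)"
  proof -
    have "n * k \<noteq> 0" "k + p \<noteq> 0" "k \<noteq> 0" "c \<noteq> 0" "n \<noteq> 0" using n kp c by auto
    moreover have "c\<^sup>2 * (k + p)\<^sup>2 \<noteq> 0" using kp c by auto
    ultimately show ?thesis
      unfolding quartic_def E_def A_def B_def W_def
      apply (simp add: divide_simps power_mult_distrib power_divide)
      unfolding k by algebra
  qed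
  also have "\<dots> \<ge> 0" using pos kp c by (intro mult_nonneg_nonneg divide_nonneg_pos mult_pos_pos) auto
  finally show ?thesis by simp
qed

text \<open>
  Each coefficient is at most the corresponding coefficient of \<open>(2 / s) (X + Y)\<^sup>2\<close>, where \<open>s = c / (n k)\<close>.
\<close>

lemma quartic_le:
  fixes n k p c X Y :: real
  assumes n: "1 \<le> n" and k: "k = 2 * n + 1" and p: "0 \<le> p" "p \<le> 1" and c: "0 < c"
    and XY: "0 \<le> X" "0 \<le> Y"
  shows "quartic (c / (n * k)) n (c * (k + p) / k) p X Y \<le> 2 * n * k / c * (X + Y)\<^sup>2"
proof -
  define E where "E = (k + p)\<^sup>2"
  have kp: "0 < k" "0 < k + p" "0 < E" "0 < n" using n k p by (auto simp: E_def)
  have 1: "2 / (c * (k + p) / k) - 2 * n\<^sup>2 * (c / (n * k)) * p * (1 - p) / (c * (k + p) / k)\<^sup>2 \<le> 2 * n * k / c"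
  proof -
    have "2 / (c * (k + p) / k) \<le> 2 / c"
      using kp c p by (simp add: divide_simps)
    also have "\<dots> \<le> 2 * n * k / c"
    proof -
      have "1 * 1 \<le> n * k" using n k by (intro mult_mono) auto
      then show ?thesis using c by (simp add: divide_right_mono)
    qed
    moreover have "0 \<le> 2 * n\<^sup>2 * (c / (n * k)) * p * (1 - p) / (c * (k + p) / k)\<^sup>2"
      using p c kp by auto
    ultimately show ?thesis by linarith
  qed
  have 2: "n * (2 * p - 1) / (c * (k + p) / k) + n\<^sup>2 * (c / (n * k)) * p * (1 - p) / (c * (k + p) / k)\<^sup>2 \<le> n * k / c"
  proof -
    have "n * (2 * p - 1) / (c * (k + p) / k) \<le> n * 1 / (c * (k + p) / k)"
      using kp p c by (intro divide_right_mono mult_left_mono) auto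
    also have "\<dots> \<le> n / c" using kp c p by (simp add: divide_simps)
    finally have A: "n * (2 * p - 1) / (c * (k + p) / k) \<le> n / c" .
    have "n\<^sup>2 * (c / (n * k)) * p * (1 - p) / (c * (k + p) / k)\<^sup>2 = n * (k / E) * (p * (1 - p)) / c"
    proof -
      have sq: "(c * (k + p) / k)\<^sup>2 = c\<^sup>2 * E / k\<^sup>2"
        by (simp add: E_def power_divide power_mult_distrib)
      show ?thesis unfolding sq using kp c by (simp add: divide_simps power2_eq_square)
    qed
    also have "\<dots> \<le> n * 1 * 1 / c"
    proof -
      have "k * 1 \<le> (k + p) * (k + p)" using kp p k n by (intro mult_mono) auto
      then have "k / E \<le> 1" using kp by (simp add: E_def power2_eq_square)
      moreover have "p * (1 - p) \<le> 1 * 1" using p by (intro mult_mono) auto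
      ultimately show ?thesis using kp c p
        by (intro divide_right_mono mult_mono) auto
    qed
    finally have B: "n\<^sup>2 * (c / (n * k)) * p * (1 - p) / (c * (k + p) / k)\<^sup>2 \<le> n * 1 * 1 / c" .
    have "n * (2 * p - 1) / (c * (k + p) / k) + n\<^sup>2 * (c / (n * k)) * p * (1 - p) / (c * (k + p) / k)\<^sup>2
        \<le> n / c + n * 1 * 1 / c" by (rule add_mono[OF A B])
    also have "\<dots> = n * 2 / c" by simp
    also have "\<dots> \<le> n * k / c" using c kp k n by (intro divide_right_mono mult_left_mono) auto
    finally show ?thesis .
  qed
  have "quartic (c / (n * k)) n (c * (k + p) / k) p X Y \<le>
     2 * n * k / c * X\<^sup>2 + 4 * (n * k / c) * X * Y + 2 / (c / (n * k)) * Y\<^sup>2"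
    unfolding quartic_def using 1 2 XY
    by (intro add_mono mult_right_mono mult_left_mono) auto
  also have "\<dots> = 2 * n * k / c * (X + Y)\<^sup>2"
    using c by (simp add: field_simps power2_eq_square)
  finally show ?thesis .
qed

lemma quartic_eq_minimum:
  fixes n k c :: real
  assumes n: "1 \<le> n" and k: "k = 2 * n + 1" and c: "0 < c"
  shows "quartic (c / (n * k)) n c 0 (2 * n) 1 = 2 * n / (k * c) * (2 * n + 1)\<^sup>2"
proof -
  have "k \<noteq> 0" "n \<noteq> 0" "c \<noteq> 0" using assms by auto
  then show ?thesis unfolding quartic_def
    by (simp add: divide_simps) (simp add: k power2_eq_square algebra_simps)
qed

context calabi begin

text \<open>
  The vectors enter only through \<open>X\<close> and \<open>Y\<close>, the point only through \<open>r = q z\<close>.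
\<close>

lemma hol_sec_curv_G:
  assumes "u \<noteq> 0"
  obtains X Y r where "0 \<le> X" "0 \<le> Y" "0 < X + Y" "0 < r" "r \<le> 1"
    "hol_sec_curv G z u = 2 * quartic s (of_int e) (a + s * e * (1 - r)) (1 - r) X Y / (X + Y)\<^sup>2"
    "q z = of_real r" "of_real X = \<beta> z * (fs z * fs z) * (u $ 1 * cnj (u $ 1))"
    "of_real Y = \<gamma> z * (\<theta> z u * cnj (\<theta> z u))"
proof -
  obtain r where r: "0 < r" "r \<le> 1" "q z = of_real r" using q_range by blast
  obtain b where b: "0 < b" "\<beta> z = of_real b" using \<beta>_pos by blast
  obtain c where c: "0 < c" "\<gamma> z = of_real c" using \<gamma>_pos by blast
  obtain f where f: "0 < f" "fs z = of_real f"
    using fs_of_real[of z] one_plus_norm_nz[of "z $ 1"] by (metis add_pos_nonneg zero_le_power2 zero_less_divide_1_iff zero_less_one)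
  have b': "b = a + s * e * (1 - r)"
  proof -
    have "complex_of_real b = of_real (a + s * e * (1 - r))" using b(2) by (simp add: \<beta>_def r)
    then show ?thesis by (simp only: of_real_eq_iff)
  qed
  define X where "X = b * (f * f) * (cmod (u $ 1))\<^sup>2"
  define Y where "Y = c * (cmod (\<theta> z u))\<^sup>2"
  have X: "of_real X = \<beta> z * (fs z * fs z) * (u $ 1 * cnj (u $ 1))"
    unfolding X_def b f by (simp only: of_real_mult complex_norm_square)
  have Y: "of_real Y = \<gamma> z * (\<theta> z u * cnj (\<theta> z u))"
    unfolding Y_def c by (simp only: of_real_mult complex_norm_square)
  have nn: "0 \<le> X" "0 \<le> Y" using b c f by (auto simp: X_def Y_def)
  have pos: "0 < X + Y"
  proof (cases "u $ 1 = 0")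
    case True
    with assms have "\<theta> z u \<noteq> 0" by (auto simp: \<theta>_def vec_eq_iff forall_2)
    then have "0 < Y" using c by (simp add: Y_def)
    with nn show ?thesis by simp
  next
    case False
    then have "0 < X" using b f by (simp add: X_def)
    with nn show ?thesis by simp
  qed
  have den: "(\<Sum>i\<in>UNIV. \<Sum>j\<in>UNIV. \<Sum>k\<in>UNIV. \<Sum>l\<in>UNIV.
               G z $ i $ j * G z $ k $ l * u $ i * cnj (u $ j) * u $ k * cnj (u $ l)) = of_real ((X + Y)\<^sup>2)"
  proof -
    have "(\<Sum>i\<in>UNIV. \<Sum>j\<in>UNIV. \<Sum>k\<in>UNIV. \<Sum>l\<in>UNIV.
               G z $ i $ j * G z $ k $ l * u $ i * cnj (u $ j) * u $ k * cnj (u $ l)) = sesq (G z) u u * sesq (G z) u u"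
      by (simp add: sum_2 sesq_def algebra_simps)
    also have "\<dots> = of_real ((X + Y)\<^sup>2)"
      unfolding sesq_G g_def power2_eq_square of_real_mult of_real_add X Y by (rule refl)
    finally show ?thesis .
  qed
  have "curv_quartic z u = of_real (quartic s (of_int e) b (1 - r) X Y)"
  proof -
    have Xb: "fs z * fs z * (u $ 1 * cnj (u $ 1)) = of_real (X / b)"
      using X b by (simp add: field_simps)
    have "curv_quartic z u = of_real ((2 * b - 2 * (of_int e)\<^sup>2 * s * r * (1 - r)) * (X / b)\<^sup>2
     + 4 * (of_int e * (1 - 2 * r) + (of_int e)\<^sup>2 * s * r * (1 - r) / b) * (X / b) * Y + 2 / s * Y\<^sup>2)"
      unfolding curv_quartic_def Xb Y[symmetric] b(2) r(3) by simp
    also have "(2 * b - 2 * (of_int e)\<^sup>2 * s * r * (1 - r)) * (X / b)\<^sup>2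
     + 4 * (of_int e * (1 - 2 * r) + (of_int e)\<^sup>2 * s * r * (1 - r) / b) * (X / b) * Y + 2 / s * Y\<^sup>2
      = quartic s (of_int e) b (1 - r) X Y"
      using b(1) s_pos unfolding quartic_def by (simp add: field_simps power2_eq_square)
    finally show ?thesis .
  qed
  then have "hol_sec_curv G z u = Re (of_real (2 * quartic s (of_int e) b (1 - r) X Y / (X + Y)\<^sup>2))"
    unfolding hol_sec_curv_def curv_G_sum den by (simp only: of_real_mult of_real_divide of_real_numeral)
  then have "hol_sec_curv G z u = 2 * quartic s (of_int e) (a + s * e * (1 - r)) (1 - r) X Y / (X + Y)\<^sup>2"
    unfolding b' Re_complex_of_real .
  from that[OF nn pos r(1,2) this r(3) X Y] show ?thesis .
qed

end

section \<open>Changes of coordinates\<close>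

text \<open>
  A change between the standard charts is a composition of at most two steps: \<open>base_flip\<close> exchanges the affine
  charts of the base, where the fibre coordinate is multiplied by the transition function of the bundle, and
  \<open>fibre_flip\<close> exchanges those of the fibre. The latter replaces the bundle by its dual, hence \<open>e\<close> by \<open>- e\<close>, and
  \<open>a\<close> by \<open>a + s e\<close>.
\<close>

definition base_flip :: "int \<Rightarrow> complex ^ 2 \<Rightarrow> complex ^ 2" where
  "base_flip e z = vector [inverse (z $ 1), z $ 2 * z $ 1 powi e]"

definition base_flip_deriv :: "int \<Rightarrow> complex ^ 2 \<Rightarrow> complex ^ 2 \<Rightarrow> complex ^ 2" where
  "base_flip_deriv e z u = vector [- u $ 1 / (z $ 1)\<^sup>2, z $ 1 powi e * (u $ 2 + of_int e * z $ 2 * u $ 1 / z $ 1)]"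

definition fibre_flip :: "complex ^ 2 \<Rightarrow> complex ^ 2" where
  "fibre_flip z = vector [z $ 1, inverse (z $ 2)]"

definition fibre_flip_deriv :: "complex ^ 2 \<Rightarrow> complex ^ 2 \<Rightarrow> complex ^ 2" where
  "fibre_flip_deriv z u = vector [u $ 1, - u $ 2 / (z $ 2)\<^sup>2]"

context calabi begin

lemma fibre_flip_calabi: "calabi (a + s * e) s (- e)"
  using a_pos s_pos a_s_pos by unfold_locales auto

context
  fixes z :: "complex ^ 2"
  assumes z1: "z $ 1 \<noteq> 0"
begin

lemma fs_base_flip: "fs (base_flip e z) = z $ 1 * cnj (z $ 1) * fs z"
  using z1 one_plus_norm_nz[of "z $ 1"] by (simp add: fs_def base_flip_def field_simps)

lemma h_base_flip: "z $ 1 powi e * cnj (z $ 1 powi e) * h (base_flip e z) = h z"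
proof -
  have "z $ 1 powi e * cnj (z $ 1 powi e) * h (base_flip e z) =
      (z $ 1 * cnj (z $ 1) * (1 + inverse (z $ 1) * cnj (inverse (z $ 1)))) powi e"
    by (simp add: h_def base_flip_def power_int_mult_distrib)
  also have "z $ 1 * cnj (z $ 1) * (1 + inverse (z $ 1) * cnj (inverse (z $ 1))) = 1 + z $ 1 * cnj (z $ 1)"
    using z1 by (simp add: field_simps)
  finally show ?thesis by (simp add: h_def)
qed

lemma q_base_flip: "q (base_flip e z) = q z"
proof -
  have "base_flip e z $ 2 * cnj (base_flip e z $ 2) * h (base_flip e z) = z $ 2 * cnj (z $ 2) * h z"
    unfolding h_base_flip[symmetric] by (simp add: base_flip_def)
  then show ?thesis by (simp add: q_def)
qed

lemma con_base_flip:
  "con (base_flip e z) * (base_flip_deriv e z u $ 1) =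
     z $ 1 powi e * (con z * u $ 1 - of_int e * z $ 2 * u $ 1 / z $ 1)"
proof -
  have "fs z = 1 - fs z * (z $ 1 * cnj (z $ 1))" using fs_rel[of z] by simp
  then show ?thesis using z1
    unfolding con_def fs_base_flip
    by (simp add: base_flip_def base_flip_deriv_def field_simps power2_eq_square) algebra
qed

lemma \<theta>_base_flip: "\<theta> (base_flip e z) (base_flip_deriv e z u) = z $ 1 powi e * \<theta> z u"
  unfolding \<theta>_def con_base_flip by (simp add: base_flip_deriv_def algebra_simps)

lemma g_base_flip: "g (base_flip e z) (base_flip_deriv e z u) (base_flip_deriv e z v) = g z u v"
proof -
  have "\<beta> (base_flip e z) = \<beta> z" by (simp add: \<beta>_def q_base_flip)
  moreover have "z $ 1 powi e * cnj (z $ 1 powi e) * \<gamma> (base_flip e z) = \<gamma> z"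
    unfolding \<gamma>_def q_base_flip h_base_flip[symmetric] by simp
  moreover have "fs (base_flip e z) * fs (base_flip e z) * (base_flip_deriv e z u $ 1 * cnj (base_flip_deriv e z v $ 1)) =
     fs z * fs z * (u $ 1 * cnj (v $ 1))"
    using z1 by (simp add: fs_base_flip base_flip_deriv_def field_simps power2_eq_square)
  ultimately show ?thesis
    unfolding g_def \<theta>_base_flip by (simp add: mult_ac)
qed

text \<open>
  The potential changes by \<open>a log \<bar>z\<^sub>1\<bar>\<^sup>2\<close>, whose \<open>\<partial>\<close>-derivative is \<open>a dz\<^sub>1 / z\<^sub>1\<close>.
\<close>

lemma \<tau>_base_flip: "\<tau> z u = \<tau> (base_flip e z) (base_flip_deriv e z u) + of_real a * (u $ 1 / z $ 1)"
proof -
  have 1: "q (base_flip e z) * cnj (base_flip e z $ 2) * h (base_flip e z) * \<theta> (base_flip e z) (base_flip_deriv e z u)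
     = q z * cnj (z $ 2) * h z * \<theta> z u"
    unfolding h_base_flip[symmetric] \<theta>_base_flip q_base_flip by (simp add: base_flip_def)
  have e1: "fs (base_flip e z) * cnj (base_flip e z $ 1) * base_flip_deriv e z u $ 1 = - fs z * (u $ 1 / z $ 1)"
    using z1 unfolding fs_base_flip by (simp add: base_flip_def base_flip_deriv_def field_simps power2_eq_square)
  have e2: "fs z * cnj (z $ 1) * u $ 1 = (1 - fs z) * (u $ 1 / z $ 1)"
    unfolding fs_rel[symmetric] using z1 by simp
  have 2: "fs z * cnj (z $ 1) * u $ 1 =
      fs (base_flip e z) * cnj (base_flip e z $ 1) * base_flip_deriv e z u $ 1 + u $ 1 / z $ 1"
    unfolding e1 e2 by (simp add: left_diff_distrib diff_divide_distrib)
  have \<tau>: "\<tau> z u = of_real a * (fs z * cnj (z $ 1) * u $ 1) + of_real s * (q z * cnj (z $ 2) * h z * \<theta> z u)" for z u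
    by (simp add: \<tau>_def)
  show ?thesis unfolding \<tau> 1 2 by (simp add: distrib_left)
qed

end

context
  fixes z :: "complex ^ 2"
  assumes z2: "z $ 2 \<noteq> 0"
begin

interpretation F: calabi "a + s * e" s "- e" by (rule fibre_flip_calabi)

lemma h_fibre_flip: "F.h (fibre_flip z) = inverse (h z)"
  by (simp add: F.h_def h_def fibre_flip_def power_int_minus)

lemma fs_fibre_flip: "fs (fibre_flip z) = fs z"
  by (simp add: fs_def fibre_flip_def)

lemma q_fibre_flip: "F.q (fibre_flip z) = z $ 2 * cnj (z $ 2) * h z * q z"
proof -
  have "F.q (fibre_flip z) = inverse (1 + inverse (z $ 2 * cnj (z $ 2) * h z))"
    by (simp add: F.q_def h_fibre_flip) (simp add: fibre_flip_def)
  then show ?thesis using z2 q_denom_nz[of z] by (simp add: q_def field_simps)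
qed

lemma \<theta>_fibre_flip: "F.\<theta> (fibre_flip z) (fibre_flip_deriv z u) = - \<theta> z u / (z $ 2)\<^sup>2"
  unfolding F.\<theta>_def \<theta>_def F.con_def con_def fs_fibre_flip using z2
  by (simp add: fibre_flip_def fibre_flip_deriv_def field_simps power2_eq_square)

lemma g_fibre_flip: "F.g (fibre_flip z) (fibre_flip_deriv z u) (fibre_flip_deriv z v) = g z u v"
proof -
  have "F.q (fibre_flip z) = 1 - q z" using q_rel[of z] by (simp add: q_fibre_flip mult_ac)
  then have "F.\<beta> (fibre_flip z) = of_real (a + s * e) + of_real s * of_int (- e) * (1 - (1 - q z))"
    by (simp only: F.\<beta>_def)
  then have "F.\<beta> (fibre_flip z) = \<beta> z" by (simp add: \<beta>_def algebra_simps)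
  moreover have "F.\<gamma> (fibre_flip z) = \<gamma> z * (z $ 2)\<^sup>2 * (cnj (z $ 2))\<^sup>2"
    unfolding F.\<gamma>_def \<gamma>_def q_fibre_flip h_fibre_flip by (simp add: field_simps power2_eq_square)
  ultimately show ?thesis
    unfolding g_def F.g_def \<theta>_fibre_flip fs_fibre_flip using z2
    by (simp add: fibre_flip_deriv_def field_simps)
qed

text \<open>
  Here the potential changes by \<open>s log \<bar>z\<^sub>2\<bar>\<^sup>2\<close>.
\<close>

lemma \<tau>_fibre_flip: "\<tau> z u = F.\<tau> (fibre_flip z) (fibre_flip_deriv z u) + of_real s * (u $ 2 / z $ 2)"
proof -
  have 1: "F.q (fibre_flip z) * cnj (fibre_flip z $ 2) * F.h (fibre_flip z) * F.\<theta> (fibre_flip z) (fibre_flip_deriv z u)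
     = - q z * \<theta> z u / z $ 2"
    unfolding q_fibre_flip h_fibre_flip \<theta>_fibre_flip using z2
    by (simp add: fibre_flip_def field_simps power2_eq_square)
  have 2: "q z * cnj (z $ 2) * h z * \<theta> z u = (1 - q z) * \<theta> z u / z $ 2"
    unfolding q_rel[symmetric] using z2 by simp
  have 3: "\<theta> z u / z $ 2 = u $ 2 / z $ 2 + of_int e * (fs z * cnj (z $ 1) * u $ 1)"
    using z2 by (simp add: \<theta>_def con_def field_simps)
  have "F.\<tau> (fibre_flip z) (fibre_flip_deriv z u) = of_real (a + s * e) * (fs z * cnj (z $ 1) * u $ 1)
      - of_real s * (q z * (\<theta> z u / z $ 2))"
  proof -
    have "F.\<tau> (fibre_flip z) (fibre_flip_deriv z u) = of_real (a + s * e) * (fs z * cnj (z $ 1) * u $ 1)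
      + of_real s * (F.q (fibre_flip z) * cnj (fibre_flip z $ 2) * F.h (fibre_flip z) * F.\<theta> (fibre_flip z) (fibre_flip_deriv z u))"
      by (simp add: F.\<tau>_def fs_fibre_flip) (simp add: fibre_flip_def fibre_flip_deriv_def)
    then show ?thesis unfolding 1 by simp
  qed
  moreover have "\<tau> z u = of_real a * (fs z * cnj (z $ 1) * u $ 1) + of_real s * ((1 - q z) * (\<theta> z u / z $ 2))"
  proof -
    have "\<tau> z u = of_real a * (fs z * cnj (z $ 1) * u $ 1) + of_real s * (q z * cnj (z $ 2) * h z * \<theta> z u)"
      by (simp add: \<tau>_def)
    then show ?thesis unfolding 2 by simp
  qed
  moreover have "complex_of_real (a + s * e) = of_real a + of_real s * of_int e" by simp
  ultimately show ?thesis using 3 by algebra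
qed

end

end

section \<open>The metric on the Hirzebruch surface\<close>

text \<open>
  The weights of the two logarithms in the global potential are \<open>1 / \<pi>\<close> and \<open>fibre_weight n\<close>. In the charts with
  \<open>v\<^sub>1 = 1\<close> the second logarithm is \<open>log ((1 + \<bar>z\<^sub>1\<bar>\<^sup>2)\<^sup>n + \<bar>z\<^sub>2\<bar>\<^sup>2)\<close>; splitting off the first summand adds
  \<open>n fibre_weight n\<close> to the weight of the base and makes the exponent negative.
\<close>

definition fibre_weight :: "nat \<Rightarrow> real" where "fibre_weight n = 1 / (pi * (real n * (2 * real n + 1)))"
definition base_weight :: "nat \<Rightarrow> bool \<times> bool \<Rightarrow> real" where
  "base_weight n i = (if snd i then 1 / pi else 1 / pi + real n * fibre_weight n)"
definition twist :: "nat \<Rightarrow> bool \<times> bool \<Rightarrow> int" where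
  "twist n i = (if snd i then int n else - int n)"

abbreviation "chart_g n i \<equiv> calabi.g (base_weight n i) (fibre_weight n) (twist n i)"
abbreviation "chart_\<tau> n i \<equiv> calabi.\<tau> (base_weight n i) (fibre_weight n) (twist n i)"

definition hirzebruch_metric :: "nat \<Rightarrow> bool \<times> bool \<Rightarrow> complex ^ 2 \<Rightarrow> complex ^ 2 ^ 2" where
  "hirzebruch_metric n i = calabi.G (base_weight n i) (fibre_weight n) (twist n i)"

lemma calabi_hirzebruch:
  assumes "1 \<le> n"
  shows "calabi (base_weight n i) (fibre_weight n) (twist n i)"
proof
  have "0 < fibre_weight n" using assms by (simp add: fibre_weight_def)
  then show "0 < base_weight n i" "0 < fibre_weight n" "0 < base_weight n i + fibre_weight n * twist n i"
    by (auto simp: base_weight_def twist_def add_pos_nonneg)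
qed

definition chart_change :: "nat \<Rightarrow> bool \<times> bool \<Rightarrow> bool \<times> bool \<Rightarrow> complex ^ 2 \<Rightarrow> complex ^ 2" where
  "chart_change n i j z =
    (let y = (if fst i = fst j then z else base_flip (twist n i) z)
     in if snd i = snd j then y else fibre_flip y)"

definition chart_change_deriv ::
    "nat \<Rightarrow> bool \<times> bool \<Rightarrow> bool \<times> bool \<Rightarrow> complex ^ 2 \<Rightarrow> complex ^ 2 \<Rightarrow> complex ^ 2" where
  "chart_change_deriv n i j z u =
    (let y = (if fst i = fst j then z else base_flip (twist n i) z);
         v = (if fst i = fst j then u else base_flip_deriv (twist n i) z u)
     in if snd i = snd j then v else fibre_flip_deriv y v)"

lemma coords_in_patch_iff:
  "z \<in> coords_in (hirzebruch_atlas n) i (patch (hirzebruch_atlas n) j) \<longleftrightarrow>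
     (fst i = fst j \<or> z $ 1 \<noteq> 0) \<and> (snd i = snd j \<or> z $ 2 \<noteq> 0)"
  unfolding coords_in_patch
  by (cases "fst i"; cases "fst j"; cases "snd i"; cases "snd j")
    (auto simp: sel_def rx_def rv_def affine_pt_def)

lemma coord_change_eq_chart_change:
  assumes "z \<in> coords_in (hirzebruch_atlas n) i (patch (hirzebruch_atlas n) j)"
  shows "coord_change (hirzebruch_atlas n) i j z = chart_change n i j z"
  using assms unfolding coord_change_eq[OF assms] coords_in_patch_iff
  by (cases "fst i"; cases "fst j"; cases "snd i"; cases "snd j")
    (auto simp: hco_def chart_change_def base_flip_def fibre_flip_def sel_def rx_def rv_def affine_pt_def
       twist_def vec_eq_iff forall_2 power_int_minus field_simps)

lemma wirtinger_base_flip: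
  assumes "z $ 1 \<noteq> 0"
  shows "wirtinger (\<lambda>z. base_flip e z $ k) (\<lambda>u. base_flip_deriv e z u $ k) (\<lambda>_. 0) z"
proof -
  have "wirtinger (\<lambda>z. base_flip e z $ 1) (\<lambda>u. base_flip_deriv e z u $ 1) (\<lambda>_. 0) z"
    unfolding base_flip_def base_flip_deriv_def vector_2
    by (rule wirtinger_cong, rule wirtinger_inverse, rule wirtinger_nth, rule assms)
      (simp_all add: field_simps)
  moreover have "wirtinger (\<lambda>z. base_flip e z $ 2) (\<lambda>u. base_flip_deriv e z u $ 2) (\<lambda>_. 0) z"
    unfolding base_flip_def base_flip_deriv_def vector_2
    by (rule wirtinger_cong, rule wirtinger_mult, rule wirtinger_nth, rule wirtinger_power_int,
        rule wirtinger_nth, rule assms) (simp_all add: field_simps)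
  ultimately show ?thesis using exhaust_2[of k] by auto
qed

lemma wirtinger_fibre_flip:
  assumes "wirtinger (\<lambda>z. f z $ 1) (\<lambda>u. D u $ 1) (\<lambda>_. 0) z" "wirtinger (\<lambda>z. f z $ 2) (\<lambda>u. D u $ 2) (\<lambda>_. 0) z"
    and "f z $ 2 \<noteq> 0"
  shows "wirtinger (\<lambda>z. fibre_flip (f z) $ k) (\<lambda>u. fibre_flip_deriv (f z) (D u) $ k) (\<lambda>_. 0) z"
proof -
  have "wirtinger (\<lambda>z. fibre_flip (f z) $ 1) (\<lambda>u. fibre_flip_deriv (f z) (D u) $ 1) (\<lambda>_. 0) z"
    unfolding fibre_flip_def fibre_flip_deriv_def vector_2 by (rule assms)
  moreover have "wirtinger (\<lambda>z. fibre_flip (f z) $ 2) (\<lambda>u. fibre_flip_deriv (f z) (D u) $ 2) (\<lambda>_. 0) z"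
    unfolding fibre_flip_def fibre_flip_deriv_def vector_2
    by (rule wirtinger_cong, rule wirtinger_inverse, rule assms, rule assms)
      (simp_all add: field_simps)
  ultimately show ?thesis using exhaust_2[of k] by auto
qed

lemma wirtinger_chart_change:
  assumes "z \<in> coords_in (hirzebruch_atlas n) i (patch (hirzebruch_atlas n) j)"
  shows "wirtinger (\<lambda>z. chart_change n i j z $ k) (\<lambda>u. chart_change_deriv n i j z u $ k) (\<lambda>_. 0) z"
proof -
  have 1: "wirtinger (\<lambda>z. (if fst i = fst j then z else base_flip (twist n i) z) $ k)
     (\<lambda>u. (if fst i = fst j then u else base_flip_deriv (twist n i) z u) $ k) (\<lambda>_. 0) z" for k
    using assms wirtinger_base_flip wirtinger_nth
    by (cases "fst i = fst j") (auto simp: coords_in_patch_iff)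
  show ?thesis
  proof (cases "snd i = snd j")
    case True
    then show ?thesis using 1 by (simp add: chart_change_def chart_change_deriv_def Let_def)
  next
    case False
    with assms have "(if fst i = fst j then z else base_flip (twist n i) z) $ 2 \<noteq> 0"
      by (auto simp: coords_in_patch_iff base_flip_def)
    from wirtinger_fibre_flip[OF 1 1 this] False show ?thesis
      by (simp add: chart_change_def chart_change_deriv_def Let_def)
  qed
qed

lemma has_derivative_vec:
  fixes f :: "'a::real_normed_vector \<Rightarrow> complex ^ 'm::finite"
  assumes "\<And>k. ((\<lambda>w. f w $ k) has_derivative (\<lambda>u. D u $ k)) (at z)"
  shows "(f has_derivative D) (at z)"
  by (subst has_derivative_componentwise_within)
    (auto simp: Basis_vec_def inner_axis intro!: has_derivative_inner_left assms)

lemma has_derivative_coord_change: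
  assumes "z \<in> coords_in (hirzebruch_atlas n) i (patch (hirzebruch_atlas n) j)"
  shows "(coord_change (hirzebruch_atlas n) i j has_derivative chart_change_deriv n i j z) (at z)"
proof (rule has_derivative_transform_within_open[OF _ open_coords_in_patch assms])
  show "(chart_change n i j has_derivative chart_change_deriv n i j z) (at z)"
    using wirtinger_chart_change[OF assms] by (intro has_derivative_vec) (simp add: wirtinger_def)
qed (simp add: coord_change_eq_chart_change)

lemmas deriv_at_coord_change = frechet_derivative_at[OF has_derivative_coord_change, symmetric]

lemma chart_params_same: "snd i = snd j \<Longrightarrow> base_weight n i = base_weight n j \<and> twist n i = twist n j"
  by (simp add: base_weight_def twist_def)

lemma chart_params_flip: "snd i \<noteq> snd j \<Longrightarrow> base_weight n j = base_weight n i + fibre_weight n * twist n i \<and> twist n j = - twist n i"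
  by (auto simp: base_weight_def twist_def)

lemma metric_chart_change:
  assumes "1 \<le> n" "z \<in> coords_in (hirzebruch_atlas n) i (patch (hirzebruch_atlas n) j)"
  shows "chart_g n j (chart_change n i j z) (chart_change_deriv n i j z u) (chart_change_deriv n i j z v) = chart_g n i z u v"
proof -
  interpret calabi "base_weight n i" "fibre_weight n" "twist n i" by (rule calabi_hirzebruch[OF assms(1)])
  define y where "y = (if fst i = fst j then z else base_flip (twist n i) z)"
  define D where "D u = (if fst i = fst j then u else base_flip_deriv (twist n i) z u)" for u
  have 1: "g y (D u) (D v) = g z u v"
    using assms(2) g_base_flip unfolding y_def D_def coords_in_patch_iff by auto
  show ?thesis
  proof (cases "snd i = snd j")
    case True
    then show ?thesis using 1 chart_params_same[OF True]
      by (simp add: chart_change_def chart_change_deriv_def Let_def y_def[symmetric] D_def[symmetric])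
  next
    case False
    with assms(2) have "y $ 2 \<noteq> 0" by (auto simp: coords_in_patch_iff base_flip_def y_def)
    from g_fibre_flip[OF this] False 1 chart_params_flip[OF False] show ?thesis
      by (simp add: chart_change_def chart_change_deriv_def Let_def y_def[symmetric] D_def[symmetric])
  qed
qed

lemma sesq_hirzebruch_metric: "1 \<le> n \<Longrightarrow> sesq (hirzebruch_metric n i z) u v = chart_g n i z u v"
  unfolding hirzebruch_metric_def by (rule calabi.sesq_G[OF calabi_hirzebruch])

context calabi begin

lemma smooth_fs: "open S \<Longrightarrow> smooth_on S fs"
  unfolding fs_def by (rule smooth_on_inverse) (auto intro!: smooth_on_intros simp: one_plus_norm_nz)

lemma smooth_h: "open S \<Longrightarrow> smooth_on S h"
  unfolding h_def by (rule smooth_on_power_int) (auto intro!: smooth_on_intros simp: one_plus_norm_nz)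

lemma smooth_q: "open S \<Longrightarrow> smooth_on S q"
  unfolding q_def by (rule smooth_on_inverse) (auto intro!: smooth_on_intros smooth_h simp: q_denom_nz)

lemma smooth_\<theta>: "open S \<Longrightarrow> smooth_on S (\<lambda>z. \<theta> z u)"
  unfolding \<theta>_def con_def by (intro smooth_on_intros smooth_fs)

lemma smooth_g: "open S \<Longrightarrow> smooth_on S (\<lambda>z. g z u v)"
  unfolding g_def \<beta>_def \<gamma>_def by (intro smooth_on_intros smooth_fs smooth_h smooth_q smooth_\<theta>)

lemma smooth_\<tau>: "open S \<Longrightarrow> smooth_on S (\<lambda>z. \<tau> z u)"
  unfolding \<tau>_def by (intro smooth_on_intros smooth_fs smooth_h smooth_q smooth_\<theta>)

lemma g_pos:
  assumes "u \<noteq> 0"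
  shows "0 < Re (g z u u)"
proof -
  obtain X Y where XY: "0 < X + Y" "of_real X = \<beta> z * (fs z * fs z) * (u $ 1 * cnj (u $ 1))"
    "of_real Y = \<gamma> z * (\<theta> z u * cnj (\<theta> z u))"
    by (rule hol_sec_curv_G[OF assms])
  have "g z u u = of_real (X + Y)" unfolding of_real_add XY(2,3) g_def ..
  with XY(1) show ?thesis by simp
qed

lemma assoc_form_G: "assoc_form G z u v = - Im (g z u v)"
proof -
  have "(\<Sum>a\<in>UNIV. \<Sum>b\<in>UNIV. G z $ a $ b * (u $ a * cnj (v $ b) - v $ a * cnj (u $ b))) =
      sesq (G z) u v - sesq (G z) v u"
    by (simp add: sesq_def sum_2 algebra_simps)
  also have "\<dots> = g z u v - cnj (g z u v)" by (simp add: sesq_G cnj_g)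
  finally show ?thesis by (simp add: assoc_form_def)
qed

lemma deriv_at_assoc_form: "deriv_at (\<lambda>z. assoc_form G z v w) z u = - Im (dg z u v w + cnj (dg z u w v))"
  unfolding assoc_form_G using deriv_at_Im_wirtinger[OF wirtinger_minus[OF wirtinger_g[of v w z]]] by simp

text \<open>
  The six derivatives form three pairs of complex conjugates by the symmetry of \<open>dg\<close>.
\<close>

lemma ext_deriv2_assoc_form: "ext_deriv2 (assoc_form G) z u v w = 0"
  unfolding ext_deriv2_def deriv_at_assoc_form
  using dg_commute[of z u v w] dg_commute[of z u w v] dg_commute[of z v w u] by simp

end

theorem hermitian_hirzebruch_metric:
  assumes n: "1 \<le> n"
  shows "hermitian_metric (hirzebruch n) (hirzebruch_atlas n) (hirzebruch_metric n)"
proof -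
  note cal = calabi_hirzebruch[OF n]
  have G: "hirzebruch_metric n i z $ a $ b = chart_g n i z (axis a 1) (axis b 1)" for i z a b
    by (simp add: hirzebruch_metric_def calabi.G_def[OF cal])
  show ?thesis unfolding hermitian_metric_def
  proof (intro conjI allI ballI impI)
    show "complex_manifold (hirzebruch n) (hirzebruch_atlas n)" by (rule complex_manifold_hirzebruch)
    show "hirzebruch_metric n i z $ b $ a = cnj (hirzebruch_metric n i z $ a $ b)" for i z a b
      by (simp add: G calabi.cnj_g[OF cal])
    show "0 < Re (sesq (hirzebruch_metric n i z) \<xi> \<xi>)" if "\<xi> \<noteq> 0" for i z \<xi>
      unfolding sesq_hirzebruch_metric[OF n] by (rule calabi.g_pos[OF cal that])
    show "smooth_on (fst (hirzebruch_atlas n i)) (\<lambda>z. hirzebruch_metric n i z $ a $ b)" for i a b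
      unfolding G by (rule calabi.smooth_g[OF cal]) simp
    show "sesq (hirzebruch_metric n i z) u v =
        sesq (hirzebruch_metric n j (coord_change (hirzebruch_atlas n) i j z))
          (deriv_at (coord_change (hirzebruch_atlas n) i j) z u)
          (deriv_at (coord_change (hirzebruch_atlas n) i j) z v)"
      if "z \<in> coords_in (hirzebruch_atlas n) i (patch (hirzebruch_atlas n) j)" for i j z u v
      unfolding sesq_hirzebruch_metric[OF n] deriv_at_coord_change[OF that]
        coord_change_eq_chart_change[OF that] by (rule metric_chart_change[OF n that, symmetric])
  qed
qed

theorem kaehler_hirzebruch_metric:
  assumes "1 \<le> n"
  shows "kaehler_metric (hirzebruch n) (hirzebruch_atlas n) (hirzebruch_metric n)"
  unfolding kaehler_metric_def hirzebruch_metric_def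
  using hermitian_hirzebruch_metric[OF assms] calabi.ext_deriv2_assoc_form[OF calabi_hirzebruch[OF assms]]
  by (auto simp: hirzebruch_metric_def[abs_def])

section \<open>Extremal values of the curvature\<close>

text \<open>
  In the charts with negative exponent the moment coordinate runs in the opposite direction, so all charts yield the same
  function of \<open>p\<close>.
\<close>

lemma quartic_flip: "quartic s (- n) b (1 - p) X Y = quartic s n b p X Y"
  by (simp add: quartic_def algebra_simps)

lemma hol_sec_curv_hirzebruch:
  assumes n: "1 \<le> n" and u: "u \<noteq> 0"
  obtains X Y p where "0 \<le> X" "0 \<le> Y" "0 < X + Y" "0 \<le> p" "p \<le> 1"
    "hol_sec_curv (hirzebruch_metric n i) z u =
       2 * quartic (1 / pi / (real n * (2 * real n + 1))) (real n) (1 / pi * ((2 * real n + 1) + p) / (2 * real n + 1)) p X Y / (X + Y)\<^sup>2"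
proof -
  have s: "fibre_weight n = 1 / pi / (real n * (2 * real n + 1))" by (simp add: fibre_weight_def)
  obtain X Y r where XY: "0 \<le> X" "0 \<le> Y" "0 < X + Y" "0 < r" "r \<le> 1"
    and K: "hol_sec_curv (hirzebruch_metric n i) z u =
      2 * quartic (fibre_weight n) (of_int (twist n i)) (base_weight n i + fibre_weight n * twist n i * (1 - r)) (1 - r) X Y / (X + Y)\<^sup>2"
    unfolding hirzebruch_metric_def by (rule calabi.hol_sec_curv_G[OF calabi_hirzebruch[OF n] u])
  define p where "p = (if snd i then 1 - r else r)"
  have "real n * (2 * real n + 1) \<noteq> 0" using n by auto
  then have "base_weight n i + fibre_weight n * twist n i * (1 - r) = 1 / pi * ((2 * real n + 1) + p) / (2 * real n + 1)"
    unfolding base_weight_def twist_def fibre_weight_def p_def by (simp add: divide_simps) (simp add: algebra_simps)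
  with K have "hol_sec_curv (hirzebruch_metric n i) z u =
       2 * quartic (1 / pi / (real n * (2 * real n + 1))) (real n) (1 / pi * ((2 * real n + 1) + p) / (2 * real n + 1)) p X Y / (X + Y)\<^sup>2"
    using quartic_flip[of _ "real n" _ r] by (auto simp: s twist_def p_def split: if_splits)
  moreover have "0 \<le> p" "p \<le> 1" using XY by (auto simp: p_def)
  ultimately show ?thesis using that XY by blast
qed

lemma hol_sec_curv_hirzebruch_bounds:
  assumes n: "1 \<le> n" and u: "u \<noteq> 0"
  shows "4 * pi * real n / (2 * real n + 1) \<le> hol_sec_curv (hirzebruch_metric n i) z u"
    and "hol_sec_curv (hirzebruch_metric n i) z u \<le> 4 * pi * real n * (2 * real n + 1)"
proof -
  define k where "k = 2 * real n + 1"
  have n': "1 \<le> real n" using n by simp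
  obtain X Y p where XY: "0 \<le> X" "0 \<le> Y" "0 < X + Y" "0 \<le> p" "p \<le> 1"
    and K: "hol_sec_curv (hirzebruch_metric n i) z u =
       2 * quartic (1 / pi / (real n * k)) (real n) (1 / pi * (k + p) / k) p X Y / (X + Y)\<^sup>2"
    unfolding k_def by (rule hol_sec_curv_hirzebruch[OF n u])
  have pos: "0 < (X + Y)\<^sup>2" using XY by simp
  have "2 * (2 * real n / (k * (1 / pi))) \<le> hol_sec_curv (hirzebruch_metric n i) z u"
    unfolding K using quartic_ge[OF n' k_def XY(4,5), of "1 / pi" X Y]
    by (subst pos_le_divide_eq[OF pos]) simp
  then show "4 * pi * real n / (2 * real n + 1) \<le> hol_sec_curv (hirzebruch_metric n i) z u"
    by (simp add: k_def mult_ac)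
  have "hol_sec_curv (hirzebruch_metric n i) z u \<le> 2 * (2 * real n * k / (1 / pi))"
    unfolding K using quartic_le[OF n' k_def XY(4,5) _ XY(1,2), of "1 / pi"]
    by (subst pos_divide_le_eq[OF pos]) (simp add: mult_ac)
  then show "hol_sec_curv (hirzebruch_metric n i) z u \<le> 4 * pi * real n * (2 * real n + 1)"
    by (simp add: k_def mult_ac)
qed

lemma hol_sec_curv_hirzebruch_at_0:
  assumes n: "1 \<le> n" and u: "u \<noteq> 0"
  defines "x \<equiv> 1 / pi * (cmod (u $ 1))\<^sup>2" and "y \<equiv> fibre_weight n * (cmod (u $ 2))\<^sup>2"
  shows "hol_sec_curv (hirzebruch_metric n (True, True)) 0 u =
     2 * quartic (fibre_weight n) (real n) (1 / pi) 0 x y / (x + y)\<^sup>2"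
proof -
  interpret calabi "1 / pi" "fibre_weight n" "int n" 
    using calabi_hirzebruch[OF n, of "(True, True)"] by (simp add: base_weight_def twist_def)
  obtain X' Y' r where XY: "q 0 = of_real r" "of_real X' = \<beta> 0 * (fs 0 * fs 0) * (u $ 1 * cnj (u $ 1))"
    "of_real Y' = \<gamma> 0 * (\<theta> 0 u * cnj (\<theta> 0 u))"
    and K: "hol_sec_curv G 0 u = 2 * quartic (fibre_weight n) (of_int (int n)) (1 / pi + fibre_weight n * int n * (1 - r)) (1 - r) X' Y' / (X' + Y')\<^sup>2"
    by (rule hol_sec_curv_G[OF u])
  have z: "q 0 = 1" "h 0 = 1" "fs 0 = 1" "\<theta> 0 u = u $ 2" "\<beta> 0 = of_real (1 / pi)" "\<gamma> 0 = of_real (fibre_weight n)"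
    by (simp_all add: q_def h_def fs_def \<theta>_def con_def \<beta>_def \<gamma>_def)
  have "complex_of_real r = of_real 1" using XY(1) z by simp
  then have r: "r = 1" by (simp only: of_real_eq_iff)
  have "complex_of_real X' = of_real x" "complex_of_real Y' = of_real y"
    unfolding XY z x_def y_def of_real_mult complex_norm_square by simp_all
  then have "X' = x" "Y' = y" by (simp_all only: of_real_eq_iff)
  with K r show ?thesis by (simp add: hirzebruch_metric_def base_weight_def twist_def)
qed

text \<open>
  Both extremal values occur at the origin of one chart, where \<open>p = 0\<close>: the minimum for \<open>X = 2 n Y\<close>, the maximum for a vertical
  vector.
\<close>

lemma hol_sec_curv_hirzebruch_attained:
  assumes n: "1 \<le> n"
  shows "\<exists>u. u \<noteq> 0 \<and> hol_sec_curv (hirzebruch_metric n (True, True)) 0 u = 4 * pi * real n / (2 * real n + 1)"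
    and "\<exists>u. u \<noteq> 0 \<and> hol_sec_curv (hirzebruch_metric n (True, True)) 0 u = 4 * pi * real n * (2 * real n + 1)"
proof -
  define k where "k = 2 * real n + 1"
  have k: "0 < k" "real n \<noteq> 0" "0 < real n" using n by (auto simp: k_def)
  have s: "fibre_weight n = 1 / pi / (real n * k)" by (simp add: fibre_weight_def k_def)
  have s0: "0 < fibre_weight n" using k by (simp add: s)
  define u :: "complex ^ 2" where "u = vector [of_real (sqrt (2 * n * pi)), of_real (sqrt (1 / fibre_weight n))]"
  have u: "u \<noteq> 0" using k by (auto simp: u_def vec_eq_iff forall_2)
  have X: "1 / pi * (cmod (u $ 1))\<^sup>2 = 2 * real n" "fibre_weight n * (cmod (u $ 2))\<^sup>2 = 1"
    using k s0 by (simp_all add: u_def)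
  have "hol_sec_curv (hirzebruch_metric n (True, True)) 0 u = 4 * pi * real n / (2 * real n + 1)"
  proof -
    have "quartic (fibre_weight n) (real n) (1 / pi) 0 (2 * real n) 1 = 2 * real n / (k * (1 / pi)) * (2 * real n + 1)\<^sup>2"
      unfolding s using quartic_eq_minimum[OF _ k_def, of "1 / pi"] n by simp
    then show ?thesis
      unfolding hol_sec_curv_hirzebruch_at_0[OF n u] X using k by (simp add: k_def)
  qed
  with u show "\<exists>u. u \<noteq> 0 \<and> hol_sec_curv (hirzebruch_metric n (True, True)) 0 u = 4 * pi * real n / (2 * real n + 1)"
    by blast
  define v :: "complex ^ 2" where "v = vector [0, 1]"
  have v: "v \<noteq> 0" by (auto simp: v_def vec_eq_iff forall_2)
  have "hol_sec_curv (hirzebruch_metric n (True, True)) 0 v = 4 * pi * real n * (2 * real n + 1)"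
    unfolding hol_sec_curv_hirzebruch_at_0[OF n v] quartic_def using s0 k
    by (simp add: v_def) (simp add: s k_def power2_eq_square field_simps)
  with v show "\<exists>u. u \<noteq> 0 \<and> hol_sec_curv (hirzebruch_metric n (True, True)) 0 u = 4 * pi * real n * (2 * real n + 1)"
    by blast
qed

theorem pinched_hirzebruch_metric:
  assumes n: "1 \<le> n"
  shows "pinched (hirzebruch_atlas n) (hirzebruch_metric n) (1 / (1 + 2 * real n)\<^sup>2)"
proof -
  let ?V = "hol_sec_curv_values (hirzebruch_atlas n) (hirzebruch_metric n)"
  have bounds: "4 * pi * real n / (2 * real n + 1) \<le> K" "K \<le> 4 * pi * real n * (2 * real n + 1)" if "K \<in> ?V" for K
    using that hol_sec_curv_hirzebruch_bounds[OF n] unfolding hol_sec_curv_values_def by auto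
  have att: "4 * pi * real n / (2 * real n + 1) \<in> ?V" "4 * pi * real n * (2 * real n + 1) \<in> ?V"
    using hol_sec_curv_hirzebruch_attained[OF n] unfolding hol_sec_curv_values_def atlas_simps
    by (smt (verit) UNIV_I mem_Collect_eq)+
  have "Inf ?V = 4 * pi * real n / (2 * real n + 1)" using att bounds by (intro cInf_eq_minimum)
  moreover have "Sup ?V = 4 * pi * real n * (2 * real n + 1)" using att bounds by (intro cSup_eq_maximum)
  moreover have "0 < 4 * pi * real n / (2 * real n + 1)" using n by simp
  then have "positive_hol_sec_curv (hirzebruch_atlas n) (hirzebruch_metric n)"
    unfolding positive_hol_sec_curv_def using bounds by force
  moreover have "bdd_above ?V" using bounds by (meson bdd_aboveI)
  moreover have "1 / (1 + 2 * real n)\<^sup>2 \<le> 1"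
    using one_le_power[of "1 + 2 * real n" 2] by simp
  moreover have "4 * pi * real n / (2 * real n + 1) / (4 * pi * real n * (2 * real n + 1)) = 1 / (1 + 2 * real n)\<^sup>2"
  proof -
    have "x / k / (x * k) = 1 / k\<^sup>2" if "x \<noteq> 0" for x k :: real
      using that by (simp add: power2_eq_square)
    from this[of "4 * pi * real n" "2 * real n + 1"] n show ?thesis by (simp add: add.commute)
  qed
  ultimately show ?thesis unfolding pinched_def by simp
qed

section \<open>Local sections and their logarithmic derivatives\<close>

text \<open>
  The sections indexed by a chart are those normalized to \<open>1\<close> in it. Quotients of such sections are functions of
  the point alone, and this makes their multiplicative cocycle property immediate.
\<close>

definition base_sec :: "bool \<times> bool \<Rightarrow> complex \<times> complex \<Rightarrow> complex \<times> complex \<Rightarrow> complex" where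
  "base_sec i x v = sel (fst i) x"

definition fibre_sec :: "nat \<Rightarrow> bool \<times> bool \<Rightarrow> complex \<times> complex \<Rightarrow> complex \<times> complex \<Rightarrow> complex" where
  "fibre_sec n i x v = (if snd i then fst v else snd v * sel (fst i) x ^ n)"

text \<open>
  An arbitrary choice of homogeneous coordinates; the quotients below do not depend on it.
\<close>

definition hom_rep :: "nat \<Rightarrow> ((complex \<times> complex) \<times> (complex \<times> complex)) set set
    \<Rightarrow> (complex \<times> complex) \<times> (complex \<times> complex)" where
  "hom_rep n p = (SOME y. p = bundle_line n 0 (fst y) (snd y))"

definition base_ratio where
  "base_ratio n i j p =
     base_sec i (fst (hom_rep n p)) (snd (hom_rep n p)) / base_sec j (fst (hom_rep n p)) (snd (hom_rep n p))"

definition fibre_ratio where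
  "fibre_ratio n i j p =
     fibre_sec n i (fst (hom_rep n p)) (snd (hom_rep n p)) / fibre_sec n j (fst (hom_rep n p)) (snd (hom_rep n p))"

text \<open>
  The sections of chart \<open>i\<close> as functions of the coordinates of chart \<open>k\<close>; they are monomials.
\<close>

definition bsec :: "bool \<times> bool \<Rightarrow> bool \<times> bool \<Rightarrow> complex ^ 2 \<Rightarrow> complex" where
  "bsec i k z = (if fst i = fst k then 1 else z $ 1)"

definition fsec :: "nat \<Rightarrow> bool \<times> bool \<Rightarrow> bool \<times> bool \<Rightarrow> complex ^ 2 \<Rightarrow> complex" where
  "fsec n i k z = (if snd i = snd k then 1 else z $ 2) * (if snd i then 1 else bsec i k z ^ n)"

lemma base_sec_chart: "base_sec i (rx k z) (rv k z) = bsec i k z"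
  by (cases "fst i"; cases "fst k") (auto simp: base_sec_def bsec_def rx_def sel_def affine_pt_def)

lemma fibre_sec_chart: "fibre_sec n i (rx k z) (rv k z) = fsec n i k z"
  by (cases "fst i"; cases "fst k"; cases "snd i"; cases "snd k")
    (auto simp: fibre_sec_def fsec_def bsec_def rx_def rv_def affine_pt_def sel_def)

lemma hom_rep_hpt:
  obtains s r where "s \<noteq> 0" "r \<noteq> 0"
    "\<And>i. base_sec i (fst (hom_rep n (hpt n k z))) (snd (hom_rep n (hpt n k z))) = s * bsec i k z"
    "\<And>i. fibre_sec n i (fst (hom_rep n (hpt n k z))) (snd (hom_rep n (hpt n k z))) = r * fsec n i k z"
proof -
  have "hpt n k z = bundle_line n 0 (fst (hom_rep n (hpt n k z))) (snd (hom_rep n (hpt n k z)))"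
    unfolding hom_rep_def by (rule someI[of _ "(rx k z, rv k z)"]) (simp add: hpt_eq)
  then obtain s r where sr: "s \<noteq> 0" "r \<noteq> 0"
    "fst (hom_rep n (hpt n k z)) = (s * fst (rx k z), s * snd (rx k z))"
    "snd (hom_rep n (hpt n k z)) = (r * s ^ n * fst (rv k z), r * s ^ 0 * snd (rv k z))"
    unfolding hpt_eq bundle_line_eq_iff by blast
  have "base_sec i (fst (hom_rep n (hpt n k z))) (snd (hom_rep n (hpt n k z))) = s * bsec i k z" for i
    unfolding sr base_sec_chart[symmetric] by (simp add: base_sec_def sel_def)
  moreover have "fibre_sec n i (fst (hom_rep n (hpt n k z))) (snd (hom_rep n (hpt n k z))) =
      (r * s ^ n) * fsec n i k z" for i
    unfolding sr fibre_sec_chart[symmetric] by (simp add: fibre_sec_def sel_def power_mult_distrib)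
  ultimately show ?thesis using that[of s "r * s ^ n"] sr by simp
qed

lemma base_ratio_hpt: "base_ratio n i j (hpt n k z) = bsec i k z / bsec j k z"
  using hom_rep_hpt[of n k z] unfolding base_ratio_def by (metis mult_divide_mult_cancel_left)

lemma fibre_ratio_hpt: "fibre_ratio n i j (hpt n k z) = fsec n i k z / fsec n j k z"
  using hom_rep_hpt[of n k z] unfolding fibre_ratio_def by (metis mult_divide_mult_cancel_left)

lemma sec_nz:
  assumes "z \<in> coords_in (hirzebruch_atlas n) k (patch (hirzebruch_atlas n) i)"
  shows "bsec i k z \<noteq> 0" "fsec n i k z \<noteq> 0"
  using assms by (auto simp: coords_in_patch_iff bsec_def fsec_def)

lemma sec_self [simp]: "bsec i i z = 1" "fsec n i i z = 1"
  by (simp_all add: bsec_def fsec_def)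

lemma base_ratio_cocycle:
  assumes "p \<in> patch (hirzebruch_atlas n) i" "p \<in> patch (hirzebruch_atlas n) j" "p \<in> patch (hirzebruch_atlas n) l"
  shows "base_ratio n i l p = base_ratio n i j p * base_ratio n j l p" "base_ratio n i l p \<noteq> 0"
    "fibre_ratio n i l p = fibre_ratio n i j p * fibre_ratio n j l p" "fibre_ratio n i l p \<noteq> 0"
proof -
  obtain z where z: "p = hpt n l z" using assms(3) by (auto simp: patch_def)
  have "z \<in> coords_in (hirzebruch_atlas n) l (patch (hirzebruch_atlas n) i)"
    "z \<in> coords_in (hirzebruch_atlas n) l (patch (hirzebruch_atlas n) j)"
    using assms z by (auto simp: coords_in_def)
  from sec_nz[OF this(1)] sec_nz[OF this(2)]
  show "base_ratio n i l p = base_ratio n i j p * base_ratio n j l p" "base_ratio n i l p \<noteq> 0"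
    "fibre_ratio n i l p = fibre_ratio n i j p * fibre_ratio n j l p" "fibre_ratio n i l p \<noteq> 0"
    by (simp_all add: z base_ratio_hpt fibre_ratio_hpt)
qed

definition base_dlog :: "bool \<times> bool \<Rightarrow> bool \<times> bool \<Rightarrow> complex ^ 2 \<Rightarrow> complex ^ 2 \<Rightarrow> complex" where
  "base_dlog i k z u = (if fst i = fst k then 0 else u $ 1 / z $ 1)"

definition fibre_dlog :: "nat \<Rightarrow> bool \<times> bool \<Rightarrow> bool \<times> bool \<Rightarrow> complex ^ 2 \<Rightarrow> complex ^ 2 \<Rightarrow> complex" where
  "fibre_dlog n i k z u = (if snd i = snd k then 0 else u $ 2 / z $ 2)
     + (if snd i then 0 else of_nat n * base_dlog i k z u)"

text \<open>
  In terms of the logarithmic derivative the power rule does not mention the exponent \<open>m - 1\<close>.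
\<close>

lemma wirtinger_power:
  assumes "wirtinger f (\<lambda>u. f z * A u) (\<lambda>_. 0) z"
  shows "wirtinger (\<lambda>w. f w ^ m) (\<lambda>u. f z ^ m * (of_nat m * A u)) (\<lambda>_. 0) z"
proof (induction m)
  case 0
  then show ?case by (simp add: wirtinger_const)
next
  case (Suc m)
  show ?case unfolding power_Suc
    by (rule wirtinger_cong, rule wirtinger_mult[OF assms Suc]) (simp_all add: algebra_simps)
qed

lemma wirtinger_bsec:
  assumes "z \<in> coords_in (hirzebruch_atlas n) k (patch (hirzebruch_atlas n) i)"
  shows "wirtinger (bsec i k) (\<lambda>u. bsec i k z * base_dlog i k z u) (\<lambda>_. 0) z"
proof (cases "fst i = fst k")
  case True
  then show ?thesis using wirtinger_const[of 1 z] by (simp add: bsec_def[abs_def] base_dlog_def)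
next
  case False
  with assms show ?thesis using wirtinger_nth[of 1 z]
    by (simp add: bsec_def[abs_def] base_dlog_def coords_in_patch_iff)
qed

lemma wirtinger_fsec:
  assumes "z \<in> coords_in (hirzebruch_atlas n) k (patch (hirzebruch_atlas n) i)"
  shows "wirtinger (fsec n i k) (\<lambda>u. fsec n i k z * fibre_dlog n i k z u) (\<lambda>_. 0) z"
proof -
  have 1: "wirtinger (\<lambda>z. if snd i = snd k then 1 else z $ 2)
     (\<lambda>u. (if snd i = snd k then 1 else z $ 2) * (if snd i = snd k then 0 else u $ 2 / z $ 2)) (\<lambda>_. 0) z"
    using assms wirtinger_const[of 1 z] wirtinger_nth[of 2 z] by (auto simp: coords_in_patch_iff)
  have 2: "wirtinger (\<lambda>z. if snd i then 1 else bsec i k z ^ n)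
     (\<lambda>u. (if snd i then 1 else bsec i k z ^ n) * (if snd i then 0 else of_nat n * base_dlog i k z u)) (\<lambda>_. 0) z"
    using wirtinger_const[of 1 z] wirtinger_power[OF wirtinger_bsec[OF assms], of n] by auto
  show ?thesis unfolding fsec_def[abs_def] fibre_dlog_def
    by (rule wirtinger_cong, rule wirtinger_mult[OF 1 2]) (simp_all add: algebra_simps)
qed

lemma
  assumes "open S"
  shows smooth_bsec: "smooth_on S (bsec i k)" and smooth_fsec: "smooth_on S (fsec n i k)"
proof -
  show *: "smooth_on S (bsec i k)"
    unfolding bsec_def[abs_def] by (cases "fst i = fst k") (simp_all add: smooth_on_const smooth_on_nth assms)
  have "smooth_on S (\<lambda>z. if snd i = snd k then 1 else z $ 2)"
    by (cases "snd i = snd k") (simp_all add: smooth_on_const smooth_on_nth assms)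
  moreover have "smooth_on S (\<lambda>z. if snd i then 1 else bsec i k z ^ n)"
    by (cases "snd i") (simp_all add: smooth_on_const smooth_on_power assms *)
  ultimately show "smooth_on S (fsec n i k)"
    unfolding fsec_def[abs_def] by (rule smooth_on_mult[OF assms])
qed

subsection \<open>Branches of the argument\<close>

definition has_dlog where
  "has_dlog n S R L \<longleftrightarrow> (\<forall>k. smooth_on (coords_in (hirzebruch_atlas n) k S) (\<lambda>z. R (hpt n k z)) \<and>
     (\<forall>z \<in> coords_in (hirzebruch_atlas n) k S. R (hpt n k z) \<noteq> 0 \<and>
        wirtinger (\<lambda>z. R (hpt n k z)) (\<lambda>u. R (hpt n k z) * L k z u) (\<lambda>_. 0) z))"

text \<open>
  \<open>\<alpha>\<close> is a smooth branch of the argument of \<open>R\<close> on \<open>S\<close>, and \<open>L\<close> is the logarithmic derivative of \<open>R\<close> in the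
  various charts.
\<close>

definition arg_branch where
  "arg_branch n S R L \<alpha> \<longleftrightarrow> (\<forall>p\<in>S. cis (\<alpha> p) = sgn (R p :: complex)) \<and>
     smooth_function_on (hirzebruch_atlas n) S \<alpha> \<and>
     (\<forall>k. \<forall>z \<in> coords_in (hirzebruch_atlas n) k S.
        ((\<alpha> \<circ> hpt n k) has_derivative (\<lambda>u. Im (L k z u))) (at z))"

lemma wirtinger_quotient_dlog:
  assumes "wirtinger f (\<lambda>u. f z * A u) (\<lambda>_. 0) z" "wirtinger g (\<lambda>u. g z * B u) (\<lambda>_. 0) z" "g z \<noteq> 0"
  shows "wirtinger (\<lambda>w. f w / g w) (\<lambda>u. f z / g z * (A u - B u)) (\<lambda>_. 0) z"
  unfolding divide_inverse
  by (rule wirtinger_cong, rule wirtinger_mult[OF assms(1) wirtinger_inverse[OF assms(2,3)]])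
    (use assms(3) in \<open>simp_all add: field_simps power2_eq_square\<close>)

lemma has_dlog_ratio:
  assumes "manifold_open (hirzebruch n) (hirzebruch_atlas n) S"
    and "S \<subseteq> patch (hirzebruch_atlas n) i" "S \<subseteq> patch (hirzebruch_atlas n) j"
  shows "has_dlog n S (base_ratio n i j) (\<lambda>k z u. base_dlog i k z u - base_dlog j k z u)"
    and "has_dlog n S (fibre_ratio n i j) (\<lambda>k z u. fibre_dlog n i k z u - fibre_dlog n j k z u)"
proof -
  have op: "open (coords_in (hirzebruch_atlas n) k S)" for k
    using assms(1) unfolding manifold_open_def by blast
  have c: "z \<in> coords_in (hirzebruch_atlas n) k (patch (hirzebruch_atlas n) i)"
    "z \<in> coords_in (hirzebruch_atlas n) k (patch (hirzebruch_atlas n) j)"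
    if "z \<in> coords_in (hirzebruch_atlas n) k S" for k z
    using that assms(2,3) by (auto simp: coords_in_def)
  note nz = sec_nz[OF c(1)] sec_nz[OF c(2)]
  show "has_dlog n S (base_ratio n i j) (\<lambda>k z u. base_dlog i k z u - base_dlog j k z u)"
    unfolding has_dlog_def base_ratio_hpt
    using nz wirtinger_quotient_dlog[OF wirtinger_bsec[OF c(1)] wirtinger_bsec[OF c(2)]]
    by (auto simp: divide_inverse intro!: smooth_on_mult smooth_on_inverse smooth_bsec op)
  show "has_dlog n S (fibre_ratio n i j) (\<lambda>k z u. fibre_dlog n i k z u - fibre_dlog n j k z u)"
    unfolding has_dlog_def fibre_ratio_hpt
    using nz wirtinger_quotient_dlog[OF wirtinger_fsec[OF c(1)] wirtinger_fsec[OF c(2)]]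
    by (auto simp: divide_inverse intro!: smooth_on_mult smooth_on_inverse smooth_fsec op)
qed

text \<open>
  Dividing by \<open>c\<close> turns the forbidden ray into the branch cut of the principal logarithm.
\<close>

lemma arg_branch_slit:
  assumes S: "manifold_open (hirzebruch n) (hirzebruch_atlas n) S" and R: "has_dlog n S R L"
    and c: "c \<noteq> 0" and slit: "\<And>p. p \<in> S \<Longrightarrow> R p / c \<notin> \<real>\<^sub>\<le>\<^sub>0"
  shows "arg_branch n S R L (\<lambda>p. Im (Ln (R p / c)) + Arg c)"
  unfolding arg_branch_def
proof (intro conjI allI ballI)
  have op: "open (coords_in (hirzebruch_atlas n) k S)" for k
    using S unfolding manifold_open_def by blast
  show "cis (Im (Ln (R p / c)) + Arg c) = sgn (R p)" if "p \<in> S" for p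
  proof -
    have nz: "R p / c \<noteq> 0" using slit[OF that] by auto
    have "cis (Im (Ln (R p / c))) * cis (Arg c) = sgn (R p / c) * sgn c"
      using nz c by (simp add: Arg_eq_Im_Ln[symmetric] cis_Arg del: divide_eq_0_iff)
    also have "\<dots> = sgn (R p)" unfolding sgn_mult[symmetric] using c by simp
    finally show ?thesis by (simp add: cis_mult)
  qed
  have sl: "R (hpt n k z) / c \<notin> \<real>\<^sub>\<le>\<^sub>0" if "z \<in> coords_in (hirzebruch_atlas n) k S" for k z
    using slit that by (simp add: coords_in_def)
  have sm: "smooth_on (coords_in (hirzebruch_atlas n) k S) (\<lambda>z. R (hpt n k z))" for k
    using R unfolding has_dlog_def by blast
  show "smooth_function_on (hirzebruch_atlas n) S (\<lambda>p. Im (Ln (R p / c)) + Arg c)"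
    unfolding smooth_function_on_def comp_def atlas_simps
    using sl by (intro allI smooth_on_add smooth_on_const smooth_on_Im smooth_on_Ln op)
      (auto simp: divide_inverse intro!: smooth_on_mult smooth_on_const sm op)
  fix k z assume z: "z \<in> coords_in (hirzebruch_atlas n) k S"
  have w: "wirtinger (\<lambda>z. R (hpt n k z)) (\<lambda>u. R (hpt n k z) * L k z u) (\<lambda>_. 0) z" "R (hpt n k z) \<noteq> 0"
    using R z unfolding has_dlog_def by blast+
  have "wirtinger (\<lambda>z. R (hpt n k z) / c) (\<lambda>u. R (hpt n k z) / c * L k z u) (\<lambda>_. 0) z"
    unfolding divide_inverse
    by (rule wirtinger_cong, rule wirtinger_mult[OF w(1) wirtinger_const]) simp_all
  from wirtinger_compose_holomorphic[OF this has_field_derivative_Ln[OF sl[OF z]]]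
  have "wirtinger (\<lambda>z. Ln (R (hpt n k z) / c)) (L k z) (\<lambda>_. 0) z"
    by (rule wirtinger_cong) (use w c in simp_all)
  then have "((\<lambda>z. Ln (R (hpt n k z) / c)) has_derivative L k z) (at z)" by (simp add: wirtinger_def)
  from has_derivative_add_const[OF bounded_linear.has_derivative[OF bounded_linear_Im this], of "Arg c"]
  show "(((\<lambda>p. Im (Ln (R p / c)) + Arg c) \<circ> hpt n k) has_derivative (\<lambda>u. Im (L k z u))) (at z)"
    unfolding comp_def .
qed

lemma arg_branch_cong:
  assumes "arg_branch n S R L \<alpha>" "\<And>p. p \<in> S \<Longrightarrow> R p = R' p"
    "\<And>k z u. z \<in> coords_in (hirzebruch_atlas n) k S \<Longrightarrow> L k z u = L' k z u"
  shows "arg_branch n S R' L' \<alpha>"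
proof -
  have "L k z = L' k z" if "z \<in> coords_in (hirzebruch_atlas n) k S" for k z
    using assms(3)[OF that] by auto
  with assms(1,2) show ?thesis by (auto simp: arg_branch_def)
qed

lemma arg_branch_one: "arg_branch n S (\<lambda>_. 1) (\<lambda>_ _ _. 0) (\<lambda>_. 0)"
  by (simp add: arg_branch_def smooth_function_on_def comp_def smooth_on_const)

context
  fixes n S
  assumes S: "manifold_open (hirzebruch n) (hirzebruch_atlas n) S"
begin

lemma coords_open: "open (coords_in (hirzebruch_atlas n) k S)"
  using S unfolding manifold_open_def by blast

lemma arg_branch_mult:
  assumes "arg_branch n S R L \<alpha>" "arg_branch n S R' L' \<alpha>'"
  shows "arg_branch n S (\<lambda>p. R p * R' p) (\<lambda>k z u. L k z u + L' k z u) (\<lambda>p. \<alpha> p + \<alpha>' p)"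
proof -
  have "((\<lambda>p. \<alpha> p + \<alpha>' p) \<circ> hpt n k has_derivative (\<lambda>u. Im (L k z u + L' k z u))) (at z)"
    if "z \<in> coords_in (hirzebruch_atlas n) k S" for k z
    using has_derivative_add[of "\<alpha> \<circ> hpt n k" _ "at z" "\<alpha>' \<circ> hpt n k"] assms that
    unfolding arg_branch_def by (simp add: comp_def del: split_paired_All)
  with assms show ?thesis
    by (auto simp: arg_branch_def smooth_function_on_def comp_def sgn_mult simp flip: cis_mult
        intro!: smooth_on_add coords_open)
qed

lemma arg_branch_inverse:
  assumes "arg_branch n S R L \<alpha>"
  shows "arg_branch n S (\<lambda>p. inverse (R p)) (\<lambda>k z u. - L k z u) (\<lambda>p. - \<alpha> p)"
proof -
  have "((\<lambda>p. - \<alpha> p) \<circ> hpt n k has_derivative (\<lambda>u. Im (- L k z u))) (at z)"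
    if "z \<in> coords_in (hirzebruch_atlas n) k S" for k z
    using has_derivative_minus[of "\<alpha> \<circ> hpt n k" _ "at z"] assms that
    unfolding arg_branch_def by (simp add: comp_def del: split_paired_All)
  with assms show ?thesis
    by (auto simp: arg_branch_def smooth_function_on_def comp_def sgn_inverse simp flip: cis_inverse
        intro!: smooth_on_minus coords_open)
qed

lemma arg_branch_power:
  assumes "arg_branch n S R L \<alpha>"
  shows "\<exists>\<alpha>'. arg_branch n S (\<lambda>p. R p ^ m) (\<lambda>k z u. of_nat m * L k z u) \<alpha>'"
proof (induction m)
  case 0
  show ?case using arg_branch_one[of n S] by auto
next
  case (Suc m)
  then obtain \<alpha>' where "arg_branch n S (\<lambda>p. R p ^ m) (\<lambda>k z u. of_nat m * L k z u) \<alpha>'" by blast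
  from arg_branch_cong[OF arg_branch_mult[OF assms this], of "\<lambda>p. R p ^ Suc m" "\<lambda>k z u. of_nat (Suc m) * L k z u"]
  show ?case by (auto simp: algebra_simps)
qed

end

section \<open>Local primitives of the Kaehler form\<close>

context
  fixes n :: nat
  assumes n: "1 \<le> n"
begin

lemma q_chart_change:
  assumes "z \<in> coords_in (hirzebruch_atlas n) k (patch (hirzebruch_atlas n) j)" "snd k \<noteq> snd j"
  shows "calabi.q (twist n j) (chart_change n k j z) = 1 - calabi.q (twist n k) z"
proof -
  interpret calabi "base_weight n k" "fibre_weight n" "twist n k" by (rule calabi_hirzebruch[OF n])
  define y where "y = (if fst k = fst j then z else base_flip (twist n k) z)"
  have y: "y $ 2 \<noteq> 0" "q y = q z"
    using assms q_base_flip by (auto simp: coords_in_patch_iff base_flip_def y_def)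
  have "calabi.q (twist n j) (fibre_flip y) = 1 - q y"
    using q_fibre_flip[OF y(1)] q_rel[of y] chart_params_flip[OF assms(2)] by (simp add: mult_ac)
  then show ?thesis using assms(2) y(2) by (simp add: chart_change_def Let_def y_def[symmetric])
qed

lemma chart_change_dlog:
  assumes "z \<in> coords_in (hirzebruch_atlas n) k (patch (hirzebruch_atlas n) j)"
  shows "fst k = fst j \<Longrightarrow> chart_change_deriv n k j z u $ 1 / chart_change n k j z $ 1 = u $ 1 / z $ 1"
    and "fst k \<noteq> fst j \<Longrightarrow> chart_change_deriv n k j z u $ 1 / chart_change n k j z $ 1 = - (u $ 1 / z $ 1)"
    and "z $ 2 \<noteq> 0 \<Longrightarrow> chart_change_deriv n k j z u $ 2 / chart_change n k j z $ 2 =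
      (if snd k = snd j then 1 else - 1) * (u $ 2 / z $ 2 + of_int (twist n k) * base_dlog j k z u)"
  using assms
  by (auto simp: chart_change_def chart_change_deriv_def Let_def base_flip_def base_flip_deriv_def fibre_flip_def
      fibre_flip_deriv_def base_dlog_def coords_in_patch_iff field_simps power2_eq_square)

lemma dlog_chart_change:
  assumes "z \<in> coords_in (hirzebruch_atlas n) k (patch (hirzebruch_atlas n) j)"
    and "z \<in> coords_in (hirzebruch_atlas n) k (patch (hirzebruch_atlas n) i)"
  shows "base_dlog i k z u = base_dlog j k z u + base_dlog i j (chart_change n k j z) (chart_change_deriv n k j z u)"
    and "fibre_dlog n i k z u = fibre_dlog n j k z u + fibre_dlog n i j (chart_change n k j z) (chart_change_deriv n k j z u)"
proof -
  show 1: "base_dlog i k z u = base_dlog j k z u + base_dlog i j (chart_change n k j z) (chart_change_deriv n k j z u)"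
    using chart_change_dlog(1,2)[OF assms(1), of u] by (auto simp: base_dlog_def)
  show "fibre_dlog n i k z u = fibre_dlog n j k z u + fibre_dlog n i j (chart_change n k j z) (chart_change_deriv n k j z u)"
  proof (cases "snd i = snd k \<and> snd j = snd k")
    case True
    then show ?thesis unfolding fibre_dlog_def 1 by (simp add: algebra_simps)
  next
    case False
    then have z2: "z $ 2 \<noteq> 0" using assms by (auto simp: coords_in_patch_iff)
    show ?thesis unfolding fibre_dlog_def chart_change_dlog(3)[OF assms(1) z2] unfolding 1
      using False by (auto simp: algebra_simps twist_def)
  qed
qed

lemma \<tau>_chart_change:
  assumes "z \<in> coords_in (hirzebruch_atlas n) k (patch (hirzebruch_atlas n) j)"
  shows "chart_\<tau> n k z u = chart_\<tau> n j (chart_change n k j z) (chart_change_deriv n k j z u)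
     + of_real (1 / pi) * base_dlog j k z u + of_real (fibre_weight n) * fibre_dlog n j k z u"
proof -
  interpret calabi "base_weight n k" "fibre_weight n" "twist n k" by (rule calabi_hirzebruch[OF n])
  define y where "y = (if fst k = fst j then z else base_flip (twist n k) z)"
  define v where "v = (if fst k = fst j then u else base_flip_deriv (twist n k) z u)"
  have 1: "\<tau> z u = \<tau> y v + of_real (base_weight n k) * base_dlog j k z u"
    using assms \<tau>_base_flip[of z u] unfolding coords_in_patch_iff
    by (auto simp: y_def v_def base_dlog_def)
  show ?thesis
  proof (cases "snd k = snd j")
    case True
    have "complex_of_real (base_weight n k) * x = of_real (1 / pi) * x + of_real (fibre_weight n) * (if snd j then 0 else of_nat n * x)" for x
      using True by (simp add: base_weight_def algebra_simps)
    then show ?thesis using 1 True chart_params_same[OF True]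
      by (simp add: chart_change_def chart_change_deriv_def Let_def y_def[symmetric] v_def[symmetric] fibre_dlog_def)
  next
    case False
    with assms have y2: "y $ 2 \<noteq> 0" and z: "z $ 2 \<noteq> 0" "fst k = fst j \<or> z $ 1 \<noteq> 0"
      by (auto simp: coords_in_patch_iff base_flip_def y_def)
    have vy: "v $ 2 / y $ 2 = u $ 2 / z $ 2 + of_int (twist n k) * base_dlog j k z u"
      using z by (auto simp: v_def y_def base_flip_def base_flip_deriv_def base_dlog_def field_simps)
    have t: "\<tau> y v = chart_\<tau> n j (fibre_flip y) (fibre_flip_deriv y v) + of_real (fibre_weight n) * (v $ 2 / y $ 2)"
      using \<tau>_fibre_flip[OF y2, of v] chart_params_flip[OF False] by simp
    have m: "complex_of_real (base_weight n k) * x + of_real (fibre_weight n) * (w + of_int (twist n k) * x) =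
       of_real (1 / pi) * x + of_real (fibre_weight n) * (w + (if snd j then 0 else of_nat n * x))" for x w
      using False by (simp add: base_weight_def twist_def algebra_simps)
    have "\<tau> z u = chart_\<tau> n j (fibre_flip y) (fibre_flip_deriv y v) + (of_real (base_weight n k) * base_dlog j k z u
        + of_real (fibre_weight n) * (u $ 2 / z $ 2 + of_int (twist n k) * base_dlog j k z u))"
      unfolding 1 t vy by (simp only: add_ac)
    note this[unfolded m]
    then show ?thesis using False
      by (simp add: chart_change_def chart_change_deriv_def Let_def y_def[symmetric] v_def[symmetric] fibre_dlog_def)
  qed
qed

text \<open>
  \<open>\<partial>\<phi>\<close> in chart \<open>k\<close>, where \<open>\<phi>\<close> is the potential obtained by dividing the norms by the sections of chart \<open>i\<close>. It is regular on the patch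
  of \<open>i\<close> in every chart, and it is the same form in all of them (\<open>prim_chart_change\<close>).
\<close>

definition prim :: "bool \<times> bool \<Rightarrow> bool \<times> bool \<Rightarrow> complex ^ 2 \<Rightarrow> complex ^ 2 \<Rightarrow> complex" where
  "prim i k z u = chart_\<tau> n k z u - of_real (1 / pi) * base_dlog i k z u - of_real (fibre_weight n) * fibre_dlog n i k z u"

lemma prim_chart_change:
  assumes "z \<in> coords_in (hirzebruch_atlas n) k (patch (hirzebruch_atlas n) j)"
    and "z \<in> coords_in (hirzebruch_atlas n) k (patch (hirzebruch_atlas n) i)"
  shows "prim i k z u = prim i j (chart_change n k j z) (chart_change_deriv n k j z u)"
  unfolding prim_def \<tau>_chart_change[OF assms(1)] dlog_chart_change[OF assms] by (simp add: algebra_simps)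

lemma wirtinger_quotient_nth:
  assumes "z $ a \<noteq> 0"
  shows "wirtinger (\<lambda>z. c / z $ a) (\<lambda>u. - c * u $ a / (z $ a)\<^sup>2) (\<lambda>_. 0) z"
  unfolding divide_inverse
  by (rule wirtinger_cong, rule wirtinger_mult[OF wirtinger_const wirtinger_inverse[OF wirtinger_nth assms]])
    (simp_all add: power2_eq_square)

definition base_d2log where
  "base_d2log i k z u v = (if fst i = fst k then 0 else - v $ 1 * u $ 1 / (z $ 1 :: complex)\<^sup>2)"

definition fibre_d2log where
  "fibre_d2log i k z u v = (if snd i = snd k then 0 else - v $ 2 * u $ 2 / (z $ 2 :: complex)\<^sup>2)
     + (if snd i then 0 else of_nat n * base_d2log i k z u v)"

lemma wirtinger_dlog:
  assumes "z \<in> coords_in (hirzebruch_atlas n) k (patch (hirzebruch_atlas n) i)"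
  shows "wirtinger (\<lambda>z. base_dlog i k z v) (\<lambda>u. base_d2log i k z u v) (\<lambda>_. 0) z"
    and "wirtinger (\<lambda>z. fibre_dlog n i k z v) (\<lambda>u. fibre_d2log i k z u v) (\<lambda>_. 0) z"
proof -
  show 1: "wirtinger (\<lambda>z. base_dlog i k z v) (\<lambda>u. base_d2log i k z u v) (\<lambda>_. 0) z"
    using assms wirtinger_const[of 0 z] wirtinger_quotient_nth[of z 1 "v $ 1"]
    unfolding base_dlog_def base_d2log_def coords_in_patch_iff by (cases "fst i = fst k") auto
  have 2: "wirtinger (\<lambda>z. if snd i = snd k then 0 else v $ 2 / z $ 2)
      (\<lambda>u. if snd i = snd k then 0 else - v $ 2 * u $ 2 / (z $ 2)\<^sup>2) (\<lambda>_. 0) z"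
    using assms wirtinger_const[of 0 z] wirtinger_quotient_nth[of z 2 "v $ 2"]
    unfolding coords_in_patch_iff by (cases "snd i = snd k") auto
  have 3: "wirtinger (\<lambda>z. if snd i then 0 else of_nat n * base_dlog i k z v)
      (\<lambda>u. if snd i then 0 else of_nat n * base_d2log i k z u v) (\<lambda>_. 0) z"
    using wirtinger_const[of 0 z] wirtinger_mult[OF wirtinger_const 1, of "of_nat n"] by (cases "snd i") auto
  show "wirtinger (\<lambda>z. fibre_dlog n i k z v) (\<lambda>u. fibre_d2log i k z u v) (\<lambda>_. 0) z"
    unfolding fibre_dlog_def fibre_d2log_def using wirtinger_add[OF 2 3] by simp
qed

lemma smooth_dlog:
  assumes op: "open S" and S: "\<And>z. z \<in> S \<Longrightarrow> z \<in> coords_in (hirzebruch_atlas n) k (patch (hirzebruch_atlas n) i)"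
  shows "smooth_on S (\<lambda>z. base_dlog i k z u)" "smooth_on S (\<lambda>z. fibre_dlog n i k z u)"
proof -
  have 1: "smooth_on S (\<lambda>z. c / z $ a)" if "\<And>z. z \<in> S \<Longrightarrow> z $ a \<noteq> 0" for c :: complex and a :: 2
    unfolding divide_inverse using that
    by (intro smooth_on_mult smooth_on_const smooth_on_inverse smooth_on_nth op) auto
  show *: "smooth_on S (\<lambda>z. base_dlog i k z u)"
    unfolding base_dlog_def using S 1[of 1 "u $ 1"] smooth_on_const unfolding coords_in_patch_iff
    by (cases "fst i = fst k") auto
  have 2: "smooth_on S (\<lambda>z. if snd i = snd k then 0 else u $ 2 / z $ 2)"
    using S 1[of 2 "u $ 2"] smooth_on_const unfolding coords_in_patch_iff by (cases "snd i = snd k") auto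
  have 3: "smooth_on S (\<lambda>z. if snd i then 0 else of_nat n * base_dlog i k z u)"
    using smooth_on_const smooth_on_mult[OF op smooth_on_const *] by (cases "snd i") auto
  show "smooth_on S (\<lambda>z. fibre_dlog n i k z u)"
    unfolding fibre_dlog_def by (rule smooth_on_add[OF op 2 3])
qed

definition prim_form :: "bool \<times> bool \<Rightarrow> bool \<times> bool \<Rightarrow> complex ^ 2 \<Rightarrow> complex ^ 2 \<Rightarrow> real" where
  "prim_form i k z u = Im (of_real (1 / 2) * prim i k z u)"

lemma prim_form_one_form:
  assumes S: "manifold_open (hirzebruch n) (hirzebruch_atlas n) S" "S \<subseteq> patch (hirzebruch_atlas n) i"
  shows "one_form_on (hirzebruch_atlas n) S (prim_form i)"
  unfolding one_form_on_def
proof (intro conjI allI ballI)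
  have c: "z \<in> coords_in (hirzebruch_atlas n) k (patch (hirzebruch_atlas n) i)"
    if "z \<in> coords_in (hirzebruch_atlas n) k S" for k z
    using that S by (auto simp: coords_in_def)
  have cal: "calabi (base_weight n k) (fibre_weight n) (twist n k)" for k by (rule calabi_hirzebruch[OF n])
  show "linear (prim_form i k z)" for k z
  proof (rule linearI)
    show "prim_form i k z (u + v) = prim_form i k z u + prim_form i k z v" for u v
      unfolding prim_form_def prim_def calabi.\<tau>_def[OF cal] calabi.\<theta>_def[OF cal] fibre_dlog_def base_dlog_def
      by (simp add: algebra_simps add_divide_distrib)
    show "prim_form i k z (r *\<^sub>R u) = r *\<^sub>R prim_form i k z u" for r u
    proof -
      have sc: "(r *\<^sub>R u) $ a = of_real r * u $ a" for a
        by (subst vector_scaleR_component) (rule scaleR_conv_of_real)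
      have "prim i k z (r *\<^sub>R u) = of_real r * prim i k z u"
        unfolding prim_def calabi.\<tau>_def[OF cal] calabi.\<theta>_def[OF cal] fibre_dlog_def base_dlog_def sc
        by (simp add: algebra_simps)
      then show ?thesis by (simp add: prim_form_def)
    qed
  qed
  show "smooth_on (coords_in (hirzebruch_atlas n) k S) (\<lambda>z. prim_form i k z u)" for k u
    unfolding prim_form_def prim_def using c
    by (intro smooth_on_intros smooth_dlog calabi.smooth_\<tau>[OF cal] coords_open S(1)) auto
  fix k j z u assume "z \<in> coords_in (hirzebruch_atlas n) k (S \<inter> patch (hirzebruch_atlas n) j)"
  then have z: "z \<in> coords_in (hirzebruch_atlas n) k S" "z \<in> coords_in (hirzebruch_atlas n) k (patch (hirzebruch_atlas n) j)"
    by (auto simp: coords_in_def)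
  show "prim_form i k z u = prim_form i j (coord_change (hirzebruch_atlas n) k j z)
      (deriv_at (coord_change (hirzebruch_atlas n) k j) z u)"
    unfolding deriv_at_coord_change[OF z(2)] coord_change_eq_chart_change[OF z(2)] prim_form_def
      prim_chart_change[OF z(2) c[OF z(1)]] ..
qed

text \<open>
  The complex-linear second derivatives are symmetric and cancel, which leaves
  \<open>(1/2) Im (g(v, u) - g(u, v)) = - Im g(u, v)\<close>.
\<close>

lemma ext_deriv_prim_form:
  assumes z: "z \<in> coords_in (hirzebruch_atlas n) k (patch (hirzebruch_atlas n) i)"
  shows "assoc_form (hirzebruch_metric n k) z u v = ext_deriv1 (prim_form i k) z u v"
proof -
  interpret calabi "base_weight n k" "fibre_weight n" "twist n k" by (rule calabi_hirzebruch[OF n])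
  define D where "D u v = d\<tau> z u v - of_real (1 / pi) * base_d2log i k z u v - of_real (fibre_weight n) * fibre_d2log i k z u v" for u v
  have "D u v = D v u"
    unfolding D_def using d\<tau>_commute[of z u v] by (simp add: base_d2log_def fibre_d2log_def mult_ac)
  have "deriv_at (\<lambda>z. prim_form i k z v) z u = Im (of_real (1 / 2) * (D u v + g z v u))" for u v
  proof -
    have "wirtinger (\<lambda>z. of_real (1 / 2) * prim i k z v) (\<lambda>u. of_real (1 / 2) * D u v) (\<lambda>u. of_real (1 / 2) * g z v u) z"
      unfolding prim_def
      by (rule wirtinger_cong, (rule wirtinger_intros wirtinger_\<tau> wirtinger_dlog z)+) (simp_all add: D_def)
    from deriv_at_Im_wirtinger[OF this] show ?thesis unfolding prim_form_def by (simp add: algebra_simps)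
  qed
  then have "ext_deriv1 (prim_form i k) z u v = Im (of_real (1 / 2) * (D u v + g z v u)) - Im (of_real (1 / 2) * (D v u + g z u v))"
    by (simp only: ext_deriv1_def)
  also have "\<dots> = Im (g z v u - g z u v) / 2" unfolding \<open>D u v = D v u\<close> by (simp add: field_simps)
  also have "\<dots> = - Im (g z u v)" unfolding cnj_g[of z u v, symmetric] by simp
  finally show ?thesis unfolding hirzebruch_metric_def assoc_form_G by simp
qed

end

section \<open>A cover with branches of all arguments\<close>

text \<open>
  For \<open>c = 0\<close> this is a disc bundle around the axis \<open>x = 0\<close>, given by a function \<open>r\<close> that is replaced by \<open>1 - r\<close> when the
  two charts are exchanged; for \<open>c \<noteq> 0\<close> it is the complement of a ray. Two discs around opposite axes are
  disjoint, and on all other overlaps one of the two conditions keeps the coordinate off a ray.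
\<close>

definition near_or_slit :: "complex \<Rightarrow> complex \<Rightarrow> complex \<Rightarrow> bool" where
  "near_or_slit c r x \<longleftrightarrow> (if c = 0 then 1 / 2 < Re r else x / c \<notin> \<real>\<^sub>\<le>\<^sub>0)"

definition cover_set :: "nat \<Rightarrow> (bool \<times> bool) \<times> complex \<times> complex \<Rightarrow> ((complex \<times> complex) \<times> (complex \<times> complex)) set set set" where
  "cover_set n = (\<lambda>(i, c, d). hpt n i ` {z. near_or_slit c (fs z) (z $ 1) \<and>
     near_or_slit d (calabi.q (twist n i) z) (z $ 2)})"

lemma fs_chart_change:
  assumes "z \<in> coords_in (hirzebruch_atlas n) k (patch (hirzebruch_atlas n) j)" "fst k \<noteq> fst j"
  shows "fs (chart_change n k j z) = 1 - fs z"
proof -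
  have z: "z $ 1 \<noteq> 0" using assms by (auto simp: coords_in_patch_iff)
  have "fs (fibre_flip y) = fs y" for y by (simp add: fs_def fibre_flip_def)
  then have "fs (chart_change n k j z) = fs (base_flip (twist n k) z)"
    using assms(2) by (simp add: chart_change_def Let_def)
  also have "\<dots> = 1 - fs z"
    using z one_plus_norm_nz[of "z $ 1"] by (simp add: fs_def base_flip_def field_simps)
  finally show ?thesis .
qed

lemma open_near_or_slit:
  assumes "continuous_on UNIV f"
  shows "open {z :: complex ^ 2. near_or_slit c (f z) (z $ a)}"
proof (cases "c = 0")
  case True
  then show ?thesis
    unfolding near_or_slit_def using assms by (auto intro!: open_Collect_less continuous_intros)
next
  case False
  have "open ((\<lambda>z :: complex ^ 2. z $ a / c) -` (- \<real>\<^sub>\<le>\<^sub>0))"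
    using False by (intro open_vimage continuous_intros) auto
  then show ?thesis using False by (simp add: near_or_slit_def vimage_def)
qed

lemma continuous_on_if_smooth_on: "smooth_on S f \<Longrightarrow> continuous_on S f"
  unfolding smooth_on_def using Ck_on.simps(1) by blast

context
  fixes n :: nat
  assumes n: "1 \<le> n"
begin

lemma manifold_open_cover_set: "manifold_open (hirzebruch n) (hirzebruch_atlas n) (cover_set n I)"
proof -
  obtain i c d where I: "I = (i, c, d)" by (cases I)
  interpret calabi "base_weight n i" "fibre_weight n" "twist n i" by (rule calabi_hirzebruch[OF n])
  show ?thesis unfolding I cover_set_def prod.case
    by (intro manifold_open_image open_Collect_conj open_near_or_slit continuous_on_if_smooth_on
        smooth_fs smooth_q open_UNIV)
qed

lemma manifold_open_Int_cover_set:
  "manifold_open (hirzebruch n) (hirzebruch_atlas n) (cover_set n I \<inter> cover_set n J)"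
  using openin_Int[of "manifold_topology (hirzebruch n) (hirzebruch_atlas n)"] manifold_open_cover_set
  unfolding openin_manifold_topology by blast

lemma cover_set_subset_patch: "cover_set n (i, c, d) \<subseteq> patch (hirzebruch_atlas n) i"
  by (auto simp: cover_set_def patch_def)

lemma Union_cover_set: "(\<Union>I. cover_set n I) = hirzebruch n"
proof
  show "(\<Union>I. cover_set n I) \<subseteq> hirzebruch n"
    using manifold_open_cover_set unfolding manifold_open_def by blast
  show "hirzebruch n \<subseteq> (\<Union>I. cover_set n I)"
  proof
    fix p assume "p \<in> hirzebruch n"
    then obtain i z where p: "p = hpt n i z" unfolding Union_patch[symmetric] by (auto simp: patch_def)
    have "calabi.q (twist n i) z = 1" if "z $ 2 = 0"
      using that by (simp add: calabi.q_def[OF calabi_hirzebruch[OF n]])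
    moreover have "fs z = 1" if "z $ 1 = 0" using that by (simp add: fs_def)
    \<comment> \<open>Each coordinate serves as its own parameter: if it is non-zero, dividing by it gives \<open>1\<close>.\<close>
    ultimately have "p \<in> cover_set n (i, z $ 1, z $ 2)"
      unfolding cover_set_def prod.case p by (intro imageI) (auto simp: near_or_slit_def)
    then show "p \<in> (\<Union>I. cover_set n I)" by blast
  qed
qed

lemma near_disjoint:
  assumes "p \<in> cover_set n (i, c, d)" "p \<in> cover_set n (j, c', d')"
  shows "fst i \<noteq> fst j \<Longrightarrow> c \<noteq> 0 \<or> c' \<noteq> 0" "snd i \<noteq> snd j \<Longrightarrow> d \<noteq> 0 \<or> d' \<noteq> 0"
proof -
  obtain z y where z: "p = hpt n i z" "near_or_slit c (fs z) (z $ 1)" "near_or_slit d (calabi.q (twist n i) z) (z $ 2)"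
    and y: "p = hpt n j y" "near_or_slit c' (fs y) (y $ 1)" "near_or_slit d' (calabi.q (twist n j) y) (y $ 2)"
    using assms unfolding cover_set_def by auto
  have c: "z \<in> coords_in (hirzebruch_atlas n) i (patch (hirzebruch_atlas n) j)"
    using trans[OF z(1)[symmetric] y(1)] by (simp add: coords_in_def patch_def)
  have "coord_change (hirzebruch_atlas n) i j z = y"
    using trans[OF z(1)[symmetric] y(1)] by (simp add: coord_change_def inj_hpt)
  then have yz: "y = chart_change n i j z" using coord_change_eq_chart_change[OF c] by simp
  show "c \<noteq> 0 \<or> c' \<noteq> 0" if "fst i \<noteq> fst j"
    using fs_chart_change[OF c that] z(2) y(2) unfolding yz near_or_slit_def by (auto split: if_splits)
  show "d \<noteq> 0 \<or> d' \<noteq> 0" if "snd i \<noteq> snd j"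
    using q_chart_change[OF n c that] z(3) y(3) unfolding yz near_or_slit_def by (auto split: if_splits)
qed

abbreviation "base_arg S i j \<equiv>
  arg_branch n S (base_ratio n i j) (\<lambda>k z u. base_dlog i k z u - base_dlog j k z u)"

abbreviation "fibre_arg S i j \<equiv>
  arg_branch n S (fibre_ratio n i j) (\<lambda>k z u. fibre_dlog n i k z u - fibre_dlog n j k z u)"

lemma arg_sym:
  assumes S: "manifold_open (hirzebruch n) (hirzebruch_atlas n) S"
  shows "base_arg S i j \<alpha> \<Longrightarrow> base_arg S j i (\<lambda>p. - \<alpha> p)" "fibre_arg S i j \<alpha> \<Longrightarrow> fibre_arg S j i (\<lambda>p. - \<alpha> p)"
  by (rule arg_branch_cong, rule arg_branch_inverse[OF S], assumption,
      simp_all add: base_ratio_def fibre_ratio_def)+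

lemma arg_empty: "arg_branch n {} R L \<alpha>"
proof -
  have "Ck_on k {} (f :: complex ^ 2 \<Rightarrow> real)" for k f by (induction k arbitrary: f) auto
  then show ?thesis by (auto simp: arg_branch_def smooth_function_on_def coords_in_def smooth_on_def)
qed

lemma base_arg_exists_slit:
  assumes S: "manifold_open (hirzebruch n) (hirzebruch_atlas n) S"
    and sub: "S \<subseteq> patch (hirzebruch_atlas n) i" "S \<subseteq> cover_set n (j, c, d)"
    and ij: "fst i \<noteq> fst j" "c \<noteq> 0"
  shows "\<exists>\<alpha>. base_arg S i j \<alpha>"
proof -
  have "S \<subseteq> patch (hirzebruch_atlas n) j" using sub(2) cover_set_subset_patch by blast
  note d = has_dlog_ratio(1)[OF S sub(1) this]
  have "base_ratio n i j p / c \<notin> \<real>\<^sub>\<le>\<^sub>0" if "p \<in> S" for p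
  proof -
    from that sub(2) obtain z where "p = hpt n j z" "near_or_slit c (fs z) (z $ 1)"
      unfolding cover_set_def by auto
    then show ?thesis using ij by (simp add: base_ratio_hpt bsec_def near_or_slit_def)
  qed
  from arg_branch_slit[OF S d ij(2) this] show ?thesis by blast
qed

lemma base_arg_exists:
  "\<exists>\<alpha>. base_arg (cover_set n (i, c, d) \<inter> cover_set n (j, c', d')) i j \<alpha>"
proof -
  let ?S = "cover_set n (i, c, d) \<inter> cover_set n (j, c', d')"
  have S: "manifold_open (hirzebruch n) (hirzebruch_atlas n) ?S" by (rule manifold_open_Int_cover_set)
  have sub: "?S \<subseteq> patch (hirzebruch_atlas n) i" "?S \<subseteq> patch (hirzebruch_atlas n) j"
    using cover_set_subset_patch by blast+
  consider "fst i = fst j" | "fst i \<noteq> fst j" "c' \<noteq> 0" | "fst i \<noteq> fst j" "c \<noteq> 0" | "?S = {}"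
    using near_disjoint(1) by blast
  then show ?thesis
  proof cases
    case 1
    have "base_ratio n i j p = 1" if "p \<in> ?S" for p
      using that sub(2) 1 by (auto simp: patch_def base_ratio_hpt bsec_def)
    with 1 have "base_arg ?S i j (\<lambda>_. 0)"
      by (intro arg_branch_cong[OF arg_branch_one]) (auto simp: base_dlog_def)
    then show ?thesis by blast
  next
    case 2
    then show ?thesis by (intro base_arg_exists_slit[OF S sub(1) Int_lower2])
  next
    case 3
    then have "\<exists>\<alpha>. base_arg ?S j i \<alpha>"
      by (intro base_arg_exists_slit[OF S sub(2) Int_lower1]) auto
    then show ?thesis using arg_sym(1)[OF S] by blast
  next
    case 4
    show ?thesis unfolding 4 by (rule exI, rule arg_empty)
  qed
qed

text \<open>
  The quotient of the fibre sections is the fibre coordinate in chart \<open>j\<close>, up to the power of the base quotient that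
  relates the normalizations of \<open>v\<^sub>1 x\<^sup>n\<close>; the intermediate chart \<open>l\<close> separates these two factors.
\<close>

lemma fibre_arg_exists_slit:
  assumes S: "manifold_open (hirzebruch n) (hirzebruch_atlas n) S"
    and sub: "S \<subseteq> patch (hirzebruch_atlas n) i" "S \<subseteq> cover_set n (j, c, d)"
    and ij: "snd i \<noteq> snd j \<Longrightarrow> d \<noteq> 0" and b: "base_arg S i j \<alpha>"
  shows "\<exists>\<beta>. fibre_arg S i j \<beta>"
proof -
  define l where "l = (fst j, snd i)"
  have subj: "S \<subseteq> patch (hirzebruch_atlas n) j" using sub(2) cover_set_subset_patch by blast
  have c: "\<exists>z. p = hpt n j z \<and> z \<in> coords_in (hirzebruch_atlas n) j (patch (hirzebruch_atlas n) i)
      \<and> near_or_slit d (calabi.q (twist n j) z) (z $ 2)" if "p \<in> S" for p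
  proof -
    from that sub(2) obtain z where "p = hpt n j z" "near_or_slit d (calabi.q (twist n j) z) (z $ 2)"
      unfolding cover_set_def by auto
    with that sub(1) show ?thesis by (intro exI[of _ z]) (auto simp: coords_in_def)
  qed
  have subl: "S \<subseteq> patch (hirzebruch_atlas n) l"
  proof
    fix p assume "p \<in> S"
    from c[OF this] obtain z where "p = hpt n j z" "z \<in> coords_in (hirzebruch_atlas n) j (patch (hirzebruch_atlas n) i)"
      by blast
    then have "z \<in> coords_in (hirzebruch_atlas n) j (patch (hirzebruch_atlas n) l)"
      by (auto simp: coords_in_patch_iff l_def)
    with \<open>p = hpt n j z\<close> show "p \<in> patch (hirzebruch_atlas n) l" by (simp add: coords_in_def)
  qed
  have r: "fibre_ratio n i j p = fibre_ratio n l j p * (if snd i then 1 else base_ratio n i j p ^ n)" if "p \<in> S" for p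
    using c[OF that] by (auto simp: fibre_ratio_hpt base_ratio_hpt fsec_def bsec_def l_def)
  have "\<exists>\<beta>. fibre_arg S l j \<beta>"
  proof (cases "snd i = snd j")
    case True
    then have "l = j" by (simp add: l_def)
    moreover have "fibre_ratio n j j p = 1" if "p \<in> S" for p
      using c[OF that] by (auto simp: fibre_ratio_hpt)
    ultimately have "fibre_arg S l j (\<lambda>_. 0)" by (intro arg_branch_cong[OF arg_branch_one]) auto
    then show ?thesis by blast
  next
    case False
    note d = ij[OF False]
    have "fibre_ratio n l j p / d \<notin> \<real>\<^sub>\<le>\<^sub>0" if "p \<in> S" for p
      using c[OF that] d False by (auto simp: fibre_ratio_hpt fsec_def bsec_def l_def near_or_slit_def)
    from arg_branch_slit[OF S has_dlog_ratio(2)[OF S subl subj] d this] show ?thesis by blast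
  qed
  then obtain \<beta> where \<beta>: "fibre_arg S l j \<beta>" by blast
  have "\<exists>\<alpha>'. arg_branch n S (\<lambda>p. if snd i then 1 else base_ratio n i j p ^ n)
      (\<lambda>k z u. if snd i then 0 else of_nat n * (base_dlog i k z u - base_dlog j k z u)) \<alpha>'"
    using arg_branch_one[of n S] arg_branch_power[OF S b, of n] by (cases "snd i") auto
  then obtain \<alpha>' where \<alpha>': "arg_branch n S (\<lambda>p. if snd i then 1 else base_ratio n i j p ^ n)
      (\<lambda>k z u. if snd i then 0 else of_nat n * (base_dlog i k z u - base_dlog j k z u)) \<alpha>'" by blast
  have "fibre_arg S i j (\<lambda>p. \<beta> p + \<alpha>' p)"
    by (rule arg_branch_cong[OF arg_branch_mult[OF S \<beta> \<alpha>']])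
      (simp add: r, simp add: fibre_dlog_def base_dlog_def l_def algebra_simps)
  then show ?thesis by blast
qed

lemma fibre_arg_exists:
  "\<exists>\<beta>. fibre_arg (cover_set n (i, c, d) \<inter> cover_set n (j, c', d')) i j \<beta>"
proof -
  let ?S = "cover_set n (i, c, d) \<inter> cover_set n (j, c', d')"
  have S: "manifold_open (hirzebruch n) (hirzebruch_atlas n) ?S" by (rule manifold_open_Int_cover_set)
  have sub: "?S \<subseteq> patch (hirzebruch_atlas n) i" "?S \<subseteq> patch (hirzebruch_atlas n) j"
    using cover_set_subset_patch by blast+
  obtain \<alpha> where \<alpha>: "base_arg ?S i j \<alpha>" using base_arg_exists by blast
  consider "snd i \<noteq> snd j \<Longrightarrow> d' \<noteq> 0" | "snd i \<noteq> snd j" "d \<noteq> 0" | "?S = {}"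
    using near_disjoint(2) by blast
  then show ?thesis
  proof cases
    case 1
    then show ?thesis by (intro fibre_arg_exists_slit[OF S sub(1) Int_lower2 _ \<alpha>])
  next
    case 2
    then have "\<exists>\<beta>. fibre_arg ?S j i \<beta>"
      by (intro fibre_arg_exists_slit[OF S sub(2) Int_lower1 _ arg_sym(1)[OF S \<alpha>]])
    then show ?thesis using arg_sym(2)[OF S] by blast
  next
    case 3
    show ?thesis unfolding 3 by (rule exI, rule arg_empty)
  qed
qed

end

lemma cis_eq_1_imp: "cis x = 1 \<Longrightarrow> \<exists>m::int. x = 2 * pi * of_int m"
  unfolding cis_conv_exp exp_eq_1 by auto

lemma arg_cocycle:
  assumes "cis a = sgn (r::complex)" "cis b = sgn r'" "cis c = sgn r''" "r'' = r * r'" "r'' \<noteq> 0"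
  shows "\<exists>m::int. a - c + b = 2 * pi * of_int m"
proof (rule cis_eq_1_imp)
  have "cis (a - c + b) = cis a * cis b / cis c"
    by (simp add: cis_mult cis_divide algebra_simps)
  also have "\<dots> = 1" using assms by (simp add: sgn_mult sgn_zero_iff)
  finally show "cis (a - c + b) = 1" .
qed

lemma Im_half_diff:
  "Im (of_real (1 / 2) * (t - of_real r * x' - of_real s * y')) - Im (of_real (1 / 2) * (t - of_real r * x - of_real s * y)) =
     (r * Im (x - x') + s * Im (y - y')) * (1 / 2)"
  by (simp add: field_simps)

text \<open>
  The form \<open>prim_form\<close> changes by half of the differential of the weighted arguments, so these arguments provide the
  functions \<open>f\<close>. A set of the cover may have several indices; \<open>idx\<close> fixes one index for
  each set.
\<close>

theorem rational_class_hirzebruch_metric: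
  assumes n: "1 \<le> n"
  shows "rational_class (hirzebruch n) (hirzebruch_atlas n) (\<lambda>i. assoc_form (hirzebruch_metric n i))"
proof -
  let ?A = "hirzebruch_atlas n"
  define idx where "idx V = (SOME I. cover_set n I = V)" for V
  have idx: "cover_set n (idx V) = V" if "V \<in> range (cover_set n)" for V
    unfolding idx_def by (rule someI_ex) (use that in auto)
  define ch where "ch V = fst (idx V)" for V
  have sub: "V \<subseteq> patch ?A (ch V)" if "V \<in> range (cover_set n)" for V
    using cover_set_subset_patch[OF n, of "fst (idx V)" "fst (snd (idx V))" "snd (snd (idx V))"] idx[OF that]
    by (simp add: ch_def)
  have op: "manifold_open (hirzebruch n) ?A V" if "V \<in> range (cover_set n)" for V
    using that manifold_open_cover_set[OF n] by auto
  have opI: "manifold_open (hirzebruch n) ?A (V \<inter> W)" if "V \<in> range (cover_set n)" "W \<in> range (cover_set n)" for V W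
    using that manifold_open_Int_cover_set[OF n] by auto
  have ex: "\<exists>\<alpha>. base_arg n (V \<inter> W) (ch V) (ch W) \<alpha>" "\<exists>\<beta>. fibre_arg n (V \<inter> W) (ch V) (ch W) \<beta>"
    if "V \<in> range (cover_set n)" "W \<in> range (cover_set n)" for V W
    using base_arg_exists[OF n, of "fst (idx V)" "fst (snd (idx V))" "snd (snd (idx V))"
        "fst (idx W)" "fst (snd (idx W))" "snd (snd (idx W))"]
      fibre_arg_exists[OF n, of "fst (idx V)" "fst (snd (idx V))" "snd (snd (idx V))"
        "fst (idx W)" "fst (snd (idx W))" "snd (snd (idx W))"]
      idx[OF that(1)] idx[OF that(2)] by (simp_all add: ch_def)
  define \<alpha> where "\<alpha> V W = (SOME \<alpha>. base_arg n (V \<inter> W) (ch V) (ch W) \<alpha>)" for V W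
  define \<beta> where "\<beta> V W = (SOME \<beta>. fibre_arg n (V \<inter> W) (ch V) (ch W) \<beta>)" for V W
  have ab: "base_arg n (V \<inter> W) (ch V) (ch W) (\<alpha> V W) \<and> fibre_arg n (V \<inter> W) (ch V) (ch W) (\<beta> V W)"
    if "V \<in> range (cover_set n)" "W \<in> range (cover_set n)" for V W
    unfolding \<alpha>_def \<beta>_def by (intro conjI someI_ex[OF ex(1)[OF that]] someI_ex[OF ex(2)[OF that]])
  define f where "f V W p = (1 / pi * \<alpha> V W p + fibre_weight n * \<beta> V W p) * (1 / 2)" for V W p
  define c where "c V W X p = f W X p - f V X p + f V W p" for V W X p
  have "Cech_de_Rham (hirzebruch n) ?A (\<lambda>i. assoc_form (hirzebruch_metric n i)) (range (cover_set n)) c"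
    unfolding Cech_de_Rham_def
  proof (intro conjI exI[of _ "\<lambda>V. prim_form n (ch V)"] exI[of _ f] ballI allI)
    show "\<Union> (range (cover_set n)) = hirzebruch n" by (rule Union_cover_set[OF n])
    show "c V W X p = f W X p - f V X p + f V W p" for V W X p by (rule c_def)
    fix V assume V: "V \<in> range (cover_set n)"
    show "manifold_open (hirzebruch n) ?A V" by (rule op[OF V])
    show "one_form_on ?A V (prim_form n (ch V))" by (rule prim_form_one_form[OF n op[OF V] sub[OF V]])
    show "assoc_form (hirzebruch_metric n i) z u v = ext_deriv1 (prim_form n (ch V) i) z u v"
      if "z \<in> coords_in ?A i V" for i z u v
      using that sub[OF V] by (intro ext_deriv_prim_form[OF n]) (auto simp: coords_in_def)
    fix W assume W: "W \<in> range (cover_set n)"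
    note A = ab[OF V W, THEN conjunct1, unfolded arg_branch_def]
    note B = ab[OF V W, THEN conjunct2, unfolded arg_branch_def]
    have sm: "smooth_function_on ?A (V \<inter> W) (\<alpha> V W)" "smooth_function_on ?A (V \<inter> W) (\<beta> V W)"
      using A B by blast+
    show "smooth_function_on ?A (V \<inter> W) (f V W)"
      using sm coords_open[OF opI[OF V W]] unfolding smooth_function_on_def f_def[abs_def] comp_def
      by (intro allI smooth_on_mult smooth_on_add smooth_on_const) auto
    fix k z u assume z: "z \<in> coords_in ?A k (V \<inter> W)"
    have "((\<lambda>z. (1 / pi * \<alpha> V W (hpt n k z) + fibre_weight n * \<beta> V W (hpt n k z)) * (1 / 2)) has_derivative
        (\<lambda>u. (1 / pi * Im (base_dlog (ch V) k z u - base_dlog (ch W) k z u)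
          + fibre_weight n * Im (fibre_dlog n (ch V) k z u - fibre_dlog n (ch W) k z u)) * (1 / 2))) (at z)"
      using A B z unfolding comp_def
      by (intro has_derivative_mult_left has_derivative_add has_derivative_mult_right) blast+
    note D = frechet_derivative_at[OF this, symmetric]
    have "deriv_at (f V W \<circ> snd (?A k)) z u = (1 / pi * Im (base_dlog (ch V) k z u - base_dlog (ch W) k z u)
          + fibre_weight n * Im (fibre_dlog n (ch V) k z u - fibre_dlog n (ch W) k z u)) * (1 / 2)"
      by (simp only: f_def[abs_def] comp_def atlas_simps D)
    also have "\<dots> = prim_form n (ch W) k z u - prim_form n (ch V) k z u"
      unfolding prim_form_def[OF n] prim_def[OF n] by (rule Im_half_diff[symmetric])
    finally show "prim_form n (ch W) k z u - prim_form n (ch V) k z u = deriv_at (f V W \<circ> snd (?A k)) z u" ..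
  qed
  moreover have "c V W X p \<in> \<rat>"
    if VWX: "V \<in> range (cover_set n)" "W \<in> range (cover_set n)" "X \<in> range (cover_set n)"
      and p: "p \<in> V \<inter> W \<inter> X" for V W X p
  proof -
    have cis: "cis (\<alpha> V W p) = sgn (base_ratio n (ch V) (ch W) p)"
        "cis (\<beta> V W p) = sgn (fibre_ratio n (ch V) (ch W) p)"
      if "V \<in> range (cover_set n)" "W \<in> range (cover_set n)" "p \<in> V \<inter> W" for V W
      using ab[OF that(1,2)] that(3) unfolding arg_branch_def by blast+
    have mem: "p \<in> V \<inter> W" "p \<in> W \<inter> X" "p \<in> V \<inter> X" using p by auto
    have "p \<in> patch ?A (ch V)" "p \<in> patch ?A (ch W)" "p \<in> patch ?A (ch X)" using VWX p sub by blast+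
    note R = base_ratio_cocycle[OF this]
    obtain m :: int where m: "\<alpha> V W p - \<alpha> V X p + \<alpha> W X p = 2 * pi * m"
      using arg_cocycle[OF cis(1)[OF VWX(1,2) mem(1)] cis(1)[OF VWX(2,3) mem(2)] cis(1)[OF VWX(1,3) mem(3)] R(1,2)]
      by blast
    obtain m' :: int where m': "\<beta> V W p - \<beta> V X p + \<beta> W X p = 2 * pi * m'"
      using arg_cocycle[OF cis(2)[OF VWX(1,2) mem(1)] cis(2)[OF VWX(2,3) mem(2)] cis(2)[OF VWX(1,3) mem(3)] R(3,4)]
      by blast
    have "c V W X p = (1 / pi * (\<alpha> V W p - \<alpha> V X p + \<alpha> W X p) + fibre_weight n * (\<beta> V W p - \<beta> V X p + \<beta> W X p)) * (1 / 2)"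
      unfolding c_def f_def by (simp add: algebra_simps add_divide_distrib diff_divide_distrib)
    also have "\<dots> = m + m' / (real n * (2 * real n + 1))"
    proof -
      have "(1 / pi * (2 * pi * x) + 1 / (pi * d) * (2 * pi * y)) * (1 / 2) = x + y / d" for x y d :: real
        by (simp add: distrib_right)
      then show ?thesis unfolding m m' fibre_weight_def .
    qed
    also have "\<dots> \<in> \<rat>"
      by (intro Rats_add Rats_divide Rats_mult Rats_of_int Rats_of_nat) auto
    finally show ?thesis .
  qed
  ultimately show ?thesis unfolding rational_class_def by blast
qed

theorem theorem1p1:
  fixes n :: nat
  assumes "1 \<le> n"
  shows "\<exists>g. hodge_metric (hirzebruch n) (hirzebruch_atlas n) g \<and>
             positive_hol_sec_curv (hirzebruch_atlas n) g \<and>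
             pinched (hirzebruch_atlas n) g (1 / (1 + 2 * real n)\<^sup>2)"
proof (intro exI conjI)
  show "hodge_metric (hirzebruch n) (hirzebruch_atlas n) (hirzebruch_metric n)"
    unfolding hodge_metric_def
    using kaehler_hirzebruch_metric[OF assms] rational_class_hirzebruch_metric[OF assms] ..
  show *: "pinched (hirzebruch_atlas n) (hirzebruch_metric n) (1 / (1 + 2 * real n)\<^sup>2)"
    by (rule pinched_hirzebruch_metric[OF assms])
  then show "positive_hol_sec_curv (hirzebruch_atlas n) (hirzebruch_metric n)"
    by (simp add: pinched_def)
qed

end
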